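(* In the bipartite agent–item setting described in the context, let $\mathcal{F}_{A,E}=(E,\mathcal{I}_A)$ be the combination of the systems $(E_{A,j},\mathcal{I}_{A,j})$, $j\in[M_A]$, where each $(E_{A,j},\mathcal{I}_{A,j})$ is a $k_j$-growth system, and let $\mathcal{F}_{B,E}=(E,\mathcal{I}_B)$ be the combination of the systems $(E_{B,j},\mathcal{I}_{B,j})$, $j\in[M_B]$, where each $(E_{B,j},\mathcal{I}_{B,j})$ is an $\ell_j$-growth system. Let $\mathcal{F}=(E,\mathcal{I})$ with $\mathcal{I}=\mathcal{I}_A\cap\mathcal{I}_B$, let $k=\max_{e\in E}\big(\sum_{j:\,e\in E_{A,j}}k_j+\sum_{j:\,e\in E_{B,j}}\ell_j\big)$, and let $\mathcal{A}$ be a $(q,\alpha)$ order-oblivious core-selecting (OOCS) algorithm for $\mathcal{F}_{B,E}$. Then, for $p=\sqrt{1-1/(k+1)}$, the Agent-arrival Free-Order Secretary algorithm (described in the context) has utility-competitive ratio at least $$\frac{\alpha(1-q)}{4}\Big(2-2\sqrt{1+\frac1k}+\frac1k\Big),\qquad\text{where}\quad \frac14\Big(2-2\sqrt{1+\frac1k}+\frac1k\Big)\;>\;\frac{1}{16k^2}-\frac{1}{32k^3}.$$ Furthermore, if all components are matroids, i.e. $(E,\mathcal{I}_A\cap\mathcal{I}_B)$ is a $k$-matchoid with all $k_j=1$ and all $\ell_j=1$ and $|\{j:e\in E_{A,j}\}|+|\{j:e\in E_{B,j}\}|\le k$ for every $e\in E$, then for $p=1-\frac{1}{2k}$ the algorithm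 has utility-competitive ratio at least $$\frac{\alpha(1-q)}{16k^2}.$$
   Context: An independence system $(S,\mathcal{I})$ is a finite set $S$ with a nonempty downward-closed family $\mathcal{I}\subseteq 2^S$ of independent sets; circuits are minimal non-independent sets; a basis of $X\subseteq S$ is a maximal independent subset of $X$. The combination of $(S_j,\mathcal{I}_j)$, $j\in[M]$, is $(S,\mathcal{I})$ with $S=\bigcup_jS_j$, $\mathcal{I}=\{I\subseteq S: I\cap S_j\in\mathcal{I}_j\ \forall j\}$. $(S,\mathcal{I})$ is a $k$-growth system ($k$ a positive integer) if for all $X\subseteq S$, $I\in\mathcal{I}$ there is a partition $(Q,Z)$ of $I\setminus X$ with $|Z|\le k|X\setminus I|$ such that $P\cup Q\in\mathcal{I}$ for every basis $P$ of $X$. (The 1-growth systems are exactly matroids.) Write $X+e=X\cup\{e\}$, $X-e=X\setminus\{e\}$, $w(X)=\sum_{x\in X}w(x)$. Setting: $G=(A\cup B,E)$ is a finite bipartite graph (agents $A$, items $B$), $w:E\to\mathbb{R}_{\ge0}$ is injective, and $\delta(v)$, $\delta(Y)$ denote the sets of edges incident to a vertex $v$, resp. to a vertex set $Y\subseteq A$. The agent-side constraint is a combination $\mathcal{F}_A$ on $A$ of systems $(A_j,\mathcal{J}_j)$, $j\in[M_A]$, and the item-side constraint is a combination $\mathcal{F}_B$ on $B$ of systems $(B_j,\mathcal{L}_j)$, $j\in[M_B]$ (so $A=\bigcup_jA_j$, $B=\bigcup_jB_j$). They are transferred to edges, treating all edges at the same agent (resp. item) as parallel copies: $E_{A,j}$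 is the set of edges incident to $A_j$, and $\mathcal{I}_{A,j}$ consists of the sets $X\subseteq E_{A,j}$ such that each agent is incident to at most one edge of $X$ and the set of agents incident to $X$ belongs to $\mathcal{J}_j$; likewise $E_{B,j}$ is the set of edges incident to $B_j$, and $\mathcal{I}_{B,j}$ consists of the $X\subseteq E_{B,j}$ such that each item is incident to at most one edge of $X$ and the set of items incident to $X$ belongs to $\mathcal{L}_j$. Graph and constraints are known; weights are hidden. In the free-order agent-arrival model the algorithm chooses which agent to reveal next; revealing $a$ reveals the weights of all edges in $\delta(a)$, and edges of $\delta(a)$ must be accepted or rejected irrevocably at that time, the accepted set always being in $\mathcal{I}$. An algorithm with random output $\mathrm{ALG}\in\mathcal{I}$ has utility-competitive ratio at least $c$ if $\mathbb{E}[w(\mathrm{ALG})]\ge c\,w(\mathrm{OPT}(E))$, where $\mathrm{OPT}(E)$ is a maximum-weight set in $\mathcal{I}$. Primitive hull and core of an independence system $(S,\mathcal{I})$: $\mathrm{PHull}(X)=X\cup\{e\in S:e\text{ belongs to some circuit contained in }X+e\}$ and $\mathrm{PCore}(X)=\{e\in X:e\notin\mathrm{PHull}(\{f\in X:w(f)>w(e)\})\}$. For a combination of $(S_j,\mathcal{I}_j)$, with primitive hulls $\mathrm{PHull}_j$ and primitive cores $\mathrm{PCore}_j$ of the components: $\mathrm{Hull}(X)=\bigcup_j\mathrm{PHull}_j(X\cap S_j)$ and $\mathrm{Core}(X)=\bigcap_j\big((X\setminus S_j)\cup\mathrm{PCore}_j(X\cap S_j)\big)$. $\mathrm{Hull}_A$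 denotes the hull of the agent-side combination $\mathcal{F}_A$ (a function on subsets of $A$). OOCS algorithms: Let $(S,\mathcal{I})$ be an independence system (given as a combination) with hidden weights. An algorithm $\mathcal{A}_r$ with internal random bits $r$ works as follows. It knows $(S,\mathcal{I})$. The true ground set is a subset $X\subseteq S$ unknown to it. It observes a random sample $Y\subseteq X$ containing each element of $X$ independently with probability $q$, with the weights, and selects none of it; then the elements of $X\setminus Y$ are presented one by one in an order $\sigma$ that may depend on $Y$ but not on $r$, and each is irrevocably accepted or rejected upon presentation, keeping the accepted set $\mathrm{ALG}$ in $\mathcal{I}$. The algorithm is $(q,\alpha)$-OOCS if for every $X\subseteq S$ and every $e\in\mathrm{Core}(X)$, with $Y$ containing each element of $X-e$ independently with probability $q$, $$\mathbb{E}_{Y\sim X-e}\Big[\min_\sigma\Pr_r[e\in\mathrm{ALG}\mid e\notin Y]\Big]\ge\alpha,$$ the minimum being over all orderings $\sigma$ of $X\setminus Y$. $\mathrm{Greedy}(X)$ for $X\subseteq E$: process the edges of $X$ in decreasing order of $w$, starting from $\emptyset$, adding an edge whenever the current set stays in $\mathcal{I}$. An edge $e\notin X$ is greedy-relevant with respect to $X$ if $e\in\mathrm{Greedy}(X+e)$. For $Y\subseteq A$ and $a\in A\setminus Y$, $\mathrm{toprel}(a,Y)$ is the heaviest edge in $\delta(a)$ that is greedy-relevant with respect to $\delta(Y)$, or $\bot$ if none exists. $\mathrm{Rel}(Y)=\{\mathrm{toprel}(a,Y): a\in A\setminus Y,\ \mathrm{toprel}(a,Y)\ne\bot\}$. Agent-arrival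 Free-Order Secretary algorithm with parameter $p$ and $(q,\alpha)$-OOCS algorithm $\mathcal{A}$ for $\mathcal{F}_{B,E}$: 1. $\mathrm{ALG}=\emptyset$, $p_1=p$, $p_2=p_1+(1-p_1)q$, $p_3=(1+p_2)/2$. Choose $t_a$ independently and uniformly from $(0,1)$ for each $a\in A$; $Y=\{a:t_a\in(0,p_1)\}$, $S_0=\{a:t_a\in[p_1,p_2)\}$, $S_1=\{a:t_a\in[p_2,p_3)\}$, $S_2=\{a:t_a\in[p_3,1]\}$. 2. Reveal, without accepting anything, all agents of $Y\cup S_0\cup S_1$. Let $U=S_2$, $E_0=\mathrm{Rel}(Y)\cap\delta(S_0)$, $E_1=\mathrm{Rel}(Y)\cap\delta(S_1)$. Run $\mathcal{A}$ on $\mathcal{F}_{B,E}$ with (unknown) true ground set $\mathrm{Rel}(Y)$ and sample $E_0$; the top-relevant edges of agents of $S_2$ are presented to $\mathcal{A}$ when those agents are revealed (edges of $E_1$ may be regarded as presented at the end). Sort $E_1$ in decreasing order of weight as $e_1,\dots,e_m$, and let $a_i$ be the agent incident to $e_i$. 3. For $j=1,\dots,m$: let $Q=U\cap\mathrm{Hull}_A(\{a_1,\dots,a_j\})$; for each $a\in Q$ in uniformly random order, remove $a$ from $U$ and reveal it; if $\mathrm{toprel}(a,Y)=\bot$ skip to the next agent; otherwise let $f=\mathrm{toprel}(a,Y)$, and if $w(f)>w(e_j)$, $\mathcal{A}$ selects $f$, and $\mathrm{ALG}+f\in\mathcal{I}_A\cap\mathcal{I}_B$, add $f$ to $\mathrm{ALG}$.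 4. For each remaining $a\in U$ in uniformly random order: if $f=\mathrm{toprel}(a,Y)\neq\bot$, $\mathcal{A}$ selects $f$, and $\mathrm{ALG}+f\in\mathcal{I}_A\cap\mathcal{I}_B$, add $f$ to $\mathrm{ALG}$. Return $\mathrm{ALG}$. *)

theory Defs
  imports "HOL-Probability.Probability" "HOL-Combinatorics.Combinatorics"
begin

type_synonym 's system = "'s set \<times> 's set set"

abbreviation ground :: "'s system \<Rightarrow> 's set" where "ground \<equiv> fst"
abbreviation indep :: "'s system \<Rightarrow> 's set set" where "indep \<equiv> snd"

definition independence_system :: "'s system \<Rightarrow> bool" where
  "independence_system F \<longleftrightarrow>
     finite (ground F) \<and> indep F \<subseteq> Pow (ground F) \<and> indep F \<noteq> {} \<and>
     (\<forall>I\<in>indep F. \<forall>J. J \<subseteq> I \<longrightarrow> J \<in> indep F)"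

definition circuit :: "'s system \<Rightarrow> 's set \<Rightarrow> bool" where
  "circuit F C \<longleftrightarrow> C \<subseteq> ground F \<and> C \<notin> indep F \<and> (\<forall>D. D \<subset> C \<longrightarrow> D \<in> indep F)"

definition basis_of :: "'s system \<Rightarrow> 's set \<Rightarrow> 's set \<Rightarrow> bool" where
  "basis_of F X P \<longleftrightarrow>
     P \<subseteq> X \<and> P \<in> indep F \<and> (\<forall>P'. P \<subset> P' \<and> P' \<subseteq> X \<longrightarrow> P' \<notin> indep F)"

definition growth_system :: "nat \<Rightarrow> 's system \<Rightarrow> bool" where
  "growth_system k F \<longleftrightarrow>
     independence_system F \<and> 1 \<le> k \<and>
     (\<forall>X I. X \<subseteq> ground F \<and> I \<in> indep F \<longrightarrow>
        (\<exists>Q Z. Q \<union> Z = I - X \<and> Q \<inter> Z = {} \<and> card Z \<le> k * card (X - I) \<and>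
               (\<forall>P. basis_of F X P \<longrightarrow> P \<union> Q \<in> indep F)))"

definition matroid :: "'s system \<Rightarrow> bool" where
  "matroid F \<longleftrightarrow>
     independence_system F \<and>
     (\<forall>I\<in>indep F. \<forall>J\<in>indep F. card I < card J \<longrightarrow> (\<exists>x\<in>J - I. insert x I \<in> indep F))"

text \<open>A combination is given by the number \<open>M\<close> of its components and the components
  \<open>F 1, \<dots>, F M\<close>; values of \<open>F\<close> at other indices are irrelevant.\<close>

definition combination :: "nat \<Rightarrow> (nat \<Rightarrow> 's system) \<Rightarrow> 's system" where
  "combination M F =
     (let S = (\<Union>j\<in>{1..M}. ground (F j))
      in (S, {I. I \<subseteq> S \<and> (\<forall>j\<in>{1..M}. I \<inter> ground (F j) \<in> indep (F j))}))"

definition PHull :: "'s system \<Rightarrow> 's set \<Rightarrow> 's set" where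
  "PHull F X = X \<union> {e \<in> ground F. \<exists>C. circuit F C \<and> C \<subseteq> insert e X \<and> e \<in> C}"

definition PCore :: "('s \<Rightarrow> real) \<Rightarrow> 's system \<Rightarrow> 's set \<Rightarrow> 's set" where
  "PCore w F X = {e \<in> X. e \<notin> PHull F {f \<in> X. w f > w e}}"

definition Hull :: "nat \<Rightarrow> (nat \<Rightarrow> 's system) \<Rightarrow> 's set \<Rightarrow> 's set" where
  "Hull M F X = (\<Union>j\<in>{1..M}. PHull (F j) (X \<inter> ground (F j)))"

text \<open>The intersection with \<open>X\<close> only matters for \<open>M = 0\<close>, where the big intersection is
  the whole type.\<close>

definition Core :: "('s \<Rightarrow> real) \<Rightarrow> nat \<Rightarrow> (nat \<Rightarrow> 's system) \<Rightarrow> 's set \<Rightarrow> 's set" where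
  "Core w M F X =
     X \<inter> (\<Inter>j\<in>{1..M}. (X - ground (F j)) \<union> PCore w (F j) (X \<inter> ground (F j)))"

text \<open>For each value \<open>r\<close> of the random bits, an online algorithm maps the sample with its weights
  (a partial function whose domain is the sample) and the nonempty list of elements presented so
  far, with their weights, to its decision on the last element of that list. Its earlier
  decisions are determined by the same data.\<close>

type_synonym ('r, 's) online_alg = "'r \<Rightarrow> ('s \<rightharpoonup> real) \<Rightarrow> ('s \<times> real) list \<Rightarrow> bool"

definition weights_on :: "('s \<Rightarrow> real) \<Rightarrow> 's set \<Rightarrow> ('s \<rightharpoonup> real)" where
  "weights_on w Y = (\<lambda>e. if e \<in> Y then Some (w e) else None)"

definition selects_last ::
  "('r, 's) online_alg \<Rightarrow> 'r \<Rightarrow> ('s \<Rightarrow> real) \<Rightarrow> 's set \<Rightarrow> 's list \<Rightarrow> bool" where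
  "selects_last alg r w Y xs \<longleftrightarrow> alg r (weights_on w Y) (map (\<lambda>e. (e, w e)) xs)"

definition selected ::
  "('r, 's) online_alg \<Rightarrow> 'r \<Rightarrow> ('s \<Rightarrow> real) \<Rightarrow> 's set \<Rightarrow> 's list \<Rightarrow> 's set" where
  "selected alg r w Y \<sigma> = {\<sigma> ! i | i. i < length \<sigma> \<and> selects_last alg r w Y (take (Suc i) \<sigma>)}"

definition random_subset :: "real \<Rightarrow> 's set \<Rightarrow> 's set pmf" where
  "random_subset q X = map_pmf (\<lambda>b. {x \<in> X. b x}) (Pi_pmf X False (\<lambda>_. bernoulli_pmf q))"

definition valid_weights :: "('s \<Rightarrow> real) \<Rightarrow> 's set \<Rightarrow> bool" where
  "valid_weights w S \<longleftrightarrow> inj_on w S \<and> (\<forall>e\<in>S. 0 \<le> w e)"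

text \<open>The weights are hidden from the algorithm, so its guarantees are required for all weight
  functions. The random bits are drawn from the probability space \<open>R\<close>.\<close>

definition OOCS ::
  "nat \<Rightarrow> (nat \<Rightarrow> 's system) \<Rightarrow> real \<Rightarrow> real \<Rightarrow> 'r measure \<Rightarrow> ('r, 's) online_alg \<Rightarrow> bool" where
  "OOCS M F q \<alpha> R alg \<longleftrightarrow>
     0 \<le> q \<and> q \<le> 1 \<and> prob_space R \<and>
     (\<forall>ws xs. {r \<in> space R. alg r ws xs} \<in> sets R) \<and>
     (\<forall>w. valid_weights w (ground (combination M F)) \<longrightarrow>
        (\<forall>X Y. \<forall>\<sigma>\<in>permutations_of_set (X - Y). \<forall>r\<in>space R.
            Y \<subseteq> X \<and> X \<subseteq> ground (combination M F) \<longrightarrow>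
            selected alg r w Y \<sigma> \<in> indep (combination M F)) \<and>
        (\<forall>X e. X \<subseteq> ground (combination M F) \<and> e \<in> Core w M F X \<longrightarrow>
            measure_pmf.expectation (random_subset q (X - {e}))
              (\<lambda>Y. Min ((\<lambda>\<sigma>. measure R {r \<in> space R. e \<in> selected alg r w Y \<sigma>})
                           ` permutations_of_set (X - Y))) \<ge> \<alpha>))"

record ('a, 'b) bipartite_instance =
  agents :: "'a set"
  items :: "'b set"
  edges :: "('a \<times> 'b) set"
  num_A :: nat
  sys_A :: "nat \<Rightarrow> 'a system"
  num_B :: nat
  sys_B :: "nat \<Rightarrow> 'b system"

definition wf_instance :: "('a, 'b) bipartite_instance \<Rightarrow> bool" where
  "wf_instance G \<longleftrightarrow>
     finite (agents G) \<and> finite (items G) \<and> edges G \<subseteq> agents G \<times> items G \<and>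
     (\<forall>j\<in>{1..num_A G}. independence_system (sys_A G j)) \<and>
     (\<forall>j\<in>{1..num_B G}. independence_system (sys_B G j)) \<and>
     agents G = (\<Union>j\<in>{1..num_A G}. ground (sys_A G j)) \<and>
     items G = (\<Union>j\<in>{1..num_B G}. ground (sys_B G j))"

text \<open>Transfer of a vertex system to edges, where \<open>v\<close> (\<open>fst\<close> or \<open>snd\<close>) maps an edge to its endpoint
  on the constrained side. Injectivity of \<open>v\<close> on \<open>X\<close> says that each such vertex is incident to
  at most one edge of \<open>X\<close>.\<close>

definition edge_system :: "('e \<Rightarrow> 'v) \<Rightarrow> 'e set \<Rightarrow> 'v system \<Rightarrow> 'e system" where
  "edge_system v E F =
     (let EF = {e \<in> E. v e \<in> ground F}
      in (EF, {X. X \<subseteq> EF \<and> inj_on v X \<and> v ` X \<in> indep F}))"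

definition edge_sys_A :: "('a, 'b) bipartite_instance \<Rightarrow> nat \<Rightarrow> ('a \<times> 'b) system" where
  "edge_sys_A G j = edge_system fst (edges G) (sys_A G j)"

definition edge_sys_B :: "('a, 'b) bipartite_instance \<Rightarrow> nat \<Rightarrow> ('a \<times> 'b) system" where
  "edge_sys_B G j = edge_system snd (edges G) (sys_B G j)"

definition feasible :: "('a, 'b) bipartite_instance \<Rightarrow> ('a \<times> 'b) set set" where
  "feasible G =
     indep (combination (num_A G) (edge_sys_A G)) \<inter> indep (combination (num_B G) (edge_sys_B G))"

definition delta :: "('a, 'b) bipartite_instance \<Rightarrow> 'a set \<Rightarrow> ('a \<times> 'b) set" where
  "delta G Y = {e \<in> edges G. fst e \<in> Y}"

text \<open>Meaningful for finite \<open>X\<close> on which \<open>w\<close> is injective.\<close>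

definition decreasing_list :: "('e \<Rightarrow> real) \<Rightarrow> 'e set \<Rightarrow> 'e list" where
  "decreasing_list w X = sorted_key_list_of_set (\<lambda>e. - w e) X"

definition Greedy :: "'e set set \<Rightarrow> ('e \<Rightarrow> real) \<Rightarrow> 'e set \<Rightarrow> 'e set" where
  "Greedy \<I> w X =
     foldl (\<lambda>M e. if insert e M \<in> \<I> then insert e M else M) {} (decreasing_list w X)"

definition greedy_relevant :: "'e set set \<Rightarrow> ('e \<Rightarrow> real) \<Rightarrow> 'e set \<Rightarrow> 'e \<Rightarrow> bool" where
  "greedy_relevant \<I> w X e \<longleftrightarrow> e \<notin> X \<and> e \<in> Greedy \<I> w (insert e X)"

definition toprel ::
  "('a, 'b) bipartite_instance \<Rightarrow> ('a \<times> 'b \<Rightarrow> real) \<Rightarrow> 'a \<Rightarrow> 'a set \<Rightarrow> ('a \<times> 'b) option" where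
  "toprel G w a Y =
     (let D = {e \<in> delta G {a}. greedy_relevant (feasible G) w (delta G Y) e}
      in if D = {} then None else Some (arg_max_on w D))"

definition Rel ::
  "('a, 'b) bipartite_instance \<Rightarrow> ('a \<times> 'b \<Rightarrow> real) \<Rightarrow> 'a set \<Rightarrow> ('a \<times> 'b) set" where
  "Rel G w Y = {f. \<exists>a\<in>agents G - Y. toprel G w a Y = Some f}"

text \<open>Components of the state: the agents of the last group not yet revealed, the edges presented
  so far to the online algorithm (in order), and the edges accepted so far.\<close>

record ('a, 'b) fos_state =
  unrevealed :: "'a set"
  shown :: "('a \<times> 'b) list"
  accepted :: "('a \<times> 'b) set"

text \<open>Revealing agent \<open>a\<close>: its top-relevant edge \<open>f\<close> w.r.t. \<open>Y\<close> is always presented to \<open>alg\<close>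
  (run with sample \<open>E0\<close>), and accepted if it passes the weight test \<open>ok\<close>, is selected by \<open>alg\<close>,
  and preserves feasibility.\<close>

definition fos_reveal ::
  "('a, 'b) bipartite_instance \<Rightarrow> ('a \<times> 'b \<Rightarrow> real) \<Rightarrow> ('r, 'a \<times> 'b) online_alg \<Rightarrow> 'r \<Rightarrow>
   'a set \<Rightarrow> ('a \<times> 'b) set \<Rightarrow> ('a \<times> 'b \<Rightarrow> bool) \<Rightarrow>
   ('a, 'b) fos_state \<Rightarrow> 'a \<Rightarrow> ('a, 'b) fos_state" where
  "fos_reveal G w alg r Y E0 ok s a =
     (case toprel G w a Y of
        None \<Rightarrow> s\<lparr>unrevealed := unrevealed s - {a}\<rparr>
      | Some f \<Rightarrow>
          \<lparr>unrevealed = unrevealed s - {a},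
           shown = shown s @ [f],
           accepted =
             (if ok f \<and> selects_last alg r w E0 (shown s @ [f]) \<and> insert f (accepted s) \<in> feasible G
              then insert f (accepted s) else accepted s)\<rparr>)"

definition fos_round ::
  "('a, 'b) bipartite_instance \<Rightarrow> ('a \<times> 'b \<Rightarrow> real) \<Rightarrow> ('r, 'a \<times> 'b) online_alg \<Rightarrow> 'r \<Rightarrow>
   'a set \<Rightarrow> ('a \<times> 'b) set \<Rightarrow> ('a \<times> 'b \<Rightarrow> bool) \<Rightarrow> 'a set \<Rightarrow>
   ('a, 'b) fos_state \<Rightarrow> ('a, 'b) fos_state pmf" where
  "fos_round G w alg r Y E0 ok Q s =
     map_pmf (foldl (fos_reveal G w alg r Y E0 ok) s) (pmf_of_set (permutations_of_set Q))"

text \<open>Distribution of the output given the arrival times \<open>t\<close> and the random bits \<open>r\<close> of \<open>alg\<close>; the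
  remaining randomness lies in the uniformly random orders of revelation. The edges of
  \<open>E1\<close> would be presented to \<open>alg\<close> after all others, where they have no effect.\<close>

definition free_order_secretary ::
  "('a, 'b) bipartite_instance \<Rightarrow> ('a \<times> 'b \<Rightarrow> real) \<Rightarrow> real \<Rightarrow> real \<Rightarrow> ('r, 'a \<times> 'b) online_alg \<Rightarrow>
   ('a \<Rightarrow> real) \<times> 'r \<Rightarrow> ('a \<times> 'b) set pmf" where
  "free_order_secretary G w p q alg = (\<lambda>(t, r).
     let p1 = p; p2 = p1 + (1 - p1) * q; p3 = (1 + p2) / 2;
         Y = {a \<in> agents G. t a \<in> {0<..<p1}};
         S0 = {a \<in> agents G. t a \<in> {p1..<p2}};
         S1 = {a \<in> agents G. t a \<in> {p2..<p3}};
         S2 = {a \<in> agents G. t a \<in> {p3..1}};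
         E0 = Rel G w Y \<inter> delta G S0;
         E1 = Rel G w Y \<inter> delta G S1;
         es = decreasing_list w E1;
         init = \<lparr>unrevealed = S2, shown = [], accepted = {}\<rparr>;
         hull_round = (\<lambda>j s. fos_round G w alg r Y E0 (\<lambda>f. w f > w (es ! j))
            (unrevealed s \<inter> Hull (num_A G) (sys_A G) (fst ` set (take (Suc j) es))) s);
         last_round = (\<lambda>s. fos_round G w alg r Y E0 (\<lambda>_. True) (unrevealed s) s)
     in map_pmf accepted
          (bind_pmf (foldl (\<lambda>D j. bind_pmf D (hull_round j)) (return_pmf init) [0..<length es])
             last_round))"

definition fos_space ::
  "('a, 'b) bipartite_instance \<Rightarrow> 'r measure \<Rightarrow> (('a \<Rightarrow> real) \<times> 'r) measure" where
  "fos_space G R = (\<Pi>\<^sub>M a\<in>agents G. uniform_measure lborel {0<..<1}) \<Otimes>\<^sub>M R"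

definition utility_competitive ::
  "'e set set \<Rightarrow> ('e \<Rightarrow> real) \<Rightarrow> 'o measure \<Rightarrow> ('o \<Rightarrow> 'e set pmf) \<Rightarrow> real \<Rightarrow> bool" where
  "utility_competitive \<I> w \<Omega> ALG c \<longleftrightarrow>
     (\<forall>\<omega>\<in>space \<Omega>. set_pmf (ALG \<omega>) \<subseteq> \<I>) \<and>
     (\<integral>\<omega>. measure_pmf.expectation (ALG \<omega>) (sum w) \<partial>\<Omega>) \<ge> c * Max (sum w ` \<I>)"

end

theory Submission
  imports Defs
begin

text \<open>
  Write \<open>M\<close> for the greedy set of the sampled agents \<open>Y\<close>, write \<open>R\<close> for the set \<open>Rel Y\<close>, and let \<open>C\<close> be
  the edges of \<open>R\<close> that lie in the core of \<open>R\<close> for every component on both sides.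

  An edge \<open>e\<close> at an unsampled agent \<open>a\<close> belongs to \<open>Rel Y\<close> iff greedy selects \<open>e\<close> from the edges at
  \<open>Y + a\<close>, and then the edges heavier than \<open>e\<close> in \<open>M\<close> and in \<open>R\<close> are the same for \<open>Y\<close> and \<open>Y + a\<close>. So the
  expected weight of \<open>R\<close> is \<open>(1 - p)/p\<close> times that of \<open>M\<close>, which is at least \<open>p/k\<close> times the
  optimum, and likewise the expected weight of the edges of \<open>R\<close> spanned in component \<open>j\<close> by heavier
  edges of \<open>R\<close> is \<open>(1 - p)/p\<close> times that of the edges of \<open>M\<close> spanned by heavier edges of \<open>R\<close>. As \<open>M\<close> is
  independent, the growth property bounds the latter, level set by level set, by \<open>k\<^sub>j w(R \<inter> E\<^sub>j)\<close>; in a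
  matroid it is even bounded by the weight of the unspanned edges of \<open>R \<inter> E\<^sub>j\<close>. Subtracting these
  losses from the weight of \<open>R\<close> bounds the expected weight of \<open>C\<close> from below.

  An edge \<open>e\<close> of \<open>C\<close> is accepted if its agent \<open>a\<close> is in \<open>S\<^sub>2\<close> (probability \<open>(1 - q)/2\<close>), if the edges of
  \<open>S\<^sub>1\<close> block \<open>a\<close> no later in the order of decreasing weight than those of \<open>S\<^sub>2\<close> do (probability at least
  \<open>1/2\<close> by symmetry), and if the online algorithm selects \<open>e\<close>: when \<open>a\<close> is revealed, everything accepted
  before is then too heavy to block \<open>a\<close>. The order of revelation does not depend on the random bits of
  the online algorithm, so the last event contributes the factor \<open>\<alpha>\<close>.
\<close>

section \<open>Circuits, hulls and growth systems\<close>

lemma independence_system_finite: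
  assumes "independence_system F" "X \<subseteq> ground F"
  shows "finite X"
  using assms finite_subset unfolding independence_system_def by blast

lemma finite_indep:
  assumes "independence_system F"
  shows "finite (indep F)"
  using assms finite_subset[of "indep F" "Pow (ground F)"] by (simp add: independence_system_def)

lemma indep_downward:
  assumes "independence_system F" "I \<in> indep F" "J \<subseteq> I"
  shows "J \<in> indep F"
  using assms unfolding independence_system_def by blast

lemma indep_subset_ground:
  assumes "independence_system F" "I \<in> indep F"
  shows "I \<subseteq> ground F"
  using assms unfolding independence_system_def by auto

lemma empty_indep:
  assumes "independence_system F"
  shows "{} \<in> indep F"
  using assms unfolding independence_system_def by blast

lemma circuit_exists:
  assumes F: "independence_system F" and X: "X \<subseteq> ground F" "X \<notin> indep F"
  obtains C where "circuit F C" "C \<subseteq> X"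
proof -
  have "finite {Y. Y \<subseteq> X \<and> Y \<notin> indep F}"
    using independence_system_finite[OF F X(1)] by simp
  moreover have "{Y. Y \<subseteq> X \<and> Y \<notin> indep F} \<noteq> {}"
    using X(2) by auto
  ultimately obtain C where C: "C \<subseteq> X" "C \<notin> indep F"
      and min: "\<forall>D\<in>{Y. Y \<subseteq> X \<and> Y \<notin> indep F}. D \<subseteq> C \<longrightarrow> C = D"
    using finite_has_minimal[of "{Y. Y \<subseteq> X \<and> Y \<notin> indep F}"] by auto
  have "D \<in> indep F" if "D \<subset> C" for D
    using that C(1) min by (metis (mono_tags, lifting) mem_Collect_eq order_trans psubset_eq)
  then have "circuit F C"
    unfolding circuit_def using C X(1) by auto
  with C(1) that show thesis by blast
qed

lemma circuit_minus:
  assumes "circuit F C" "e \<in> C"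
  shows "C - {e} \<in> indep F"
proof -
  have "C - {e} \<subset> C"
    using assms(2) by auto
  then show ?thesis
    using assms(1) by (simp add: circuit_def)
qed

lemma circuit_dependent: "circuit F C \<Longrightarrow> C \<notin> indep F"
  by (simp add: circuit_def)

lemma basis_ofD:
  assumes "basis_of F X P"
  shows "P \<subseteq> X" "P \<in> indep F"
    and "P \<subseteq> P' \<Longrightarrow> P' \<subseteq> X \<Longrightarrow> P' \<in> indep F \<Longrightarrow> P' = P"
proof -
  show "P \<subseteq> X" "P \<in> indep F"
    using assms by (simp_all add: basis_of_def)
  show "P \<subseteq> P' \<Longrightarrow> P' \<subseteq> X \<Longrightarrow> P' \<in> indep F \<Longrightarrow> P' = P"
    using assms unfolding basis_of_def psubset_eq by metis
qed

lemma PHull_mono: "X \<subseteq> X' \<Longrightarrow> PHull F X \<subseteq> PHull F X'"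
  unfolding PHull_def by (auto intro: order_trans)

text \<open>The circuit contained in \<open>insert e J\<close> must pass through \<open>e\<close>,
  because a circuit avoiding \<open>e\<close> would lie in the independent set \<open>J\<close>.
  This is how a rejected insertion becomes membership in a hull.\<close>

lemma PHull_if_dependent:
  assumes F: "independence_system F" and J: "J \<in> indep F" "J \<subseteq> X"
    and e: "e \<in> ground F" "insert e J \<notin> indep F"
  shows "e \<in> PHull F X"
proof -
  have "insert e J \<subseteq> ground F"
    using indep_subset_ground[OF F J(1)] e(1) by blast
  then obtain C where C: "circuit F C" "C \<subseteq> insert e J"
    using circuit_exists[OF F _ e(2)] by blast
  have "e \<in> C"
  proof (rule ccontr)
    assume "e \<notin> C"
    then have "C \<in> indep F"
      using C(2) by (intro indep_downward[OF F J(1)]) auto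
    then show False
      using C(1) by (simp add: circuit_def)
  qed
  moreover have "C \<subseteq> insert e X"
    using C(2) J(2) by auto
  ultimately show ?thesis
    using C(1) e(1) by (auto simp: PHull_def)
qed

lemma PHull_circuit:
  assumes "e \<in> PHull F X" "e \<notin> X"
  obtains C where "circuit F C" "e \<in> C" "C - {e} \<subseteq> X" "C - {e} \<in> indep F" "e \<in> ground F"
proof -
  obtain C where C: "circuit F C" "C \<subseteq> insert e X" "e \<in> C" "e \<in> ground F"
    using assms by (auto simp: PHull_def)
  show thesis
  proof (rule that[OF C(1,3) _ circuit_minus[OF C(1,3)] C(4)])
    show "C - {e} \<subseteq> X"
      using C(2) by auto
  qed
qed

lemma basis_extend:
  assumes F: "independence_system F" and J: "J \<in> indep F" "J \<subseteq> X"
  obtains P where "basis_of F X P" "J \<subseteq> P"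
proof -
  let ?\<P> = "{P. P \<in> indep F \<and> J \<subseteq> P \<and> P \<subseteq> X}"
  have "finite ?\<P>"
    by (rule finite_subset[OF _ finite_indep[OF F]]) auto
  moreover have "J \<in> ?\<P>"
    using J by simp
  ultimately obtain P where P: "P \<in> ?\<P>" "\<forall>P'\<in>?\<P>. P \<subseteq> P' \<longrightarrow> P = P'"
    using finite_has_maximal[of ?\<P>] by (metis (no_types, lifting) empty_iff)
  have "P' \<notin> indep F" if "P \<subset> P'" "P' \<subseteq> X" for P'
    using that P by auto
  then have "basis_of F X P"
    using P(1) by (simp add: basis_of_def)
  with P(1) that show thesis
    by simp
qed

text \<open>The part \<open>Q\<close> provided by the growth property avoids \<open>PHull F X\<close>: a circuit through
  \<open>e \<in> Q\<close> and \<open>X\<close> would survive in \<open>P \<union> Q\<close> for a basis \<open>P\<close> of \<open>X\<close> containing the rest of it.\<close>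

lemma growth_PHull:
  assumes F: "growth_system k F" and X: "X \<subseteq> ground F" and I: "I \<in> indep F"
  shows "card ((I - X) \<inter> PHull F X) \<le> k * card (X - I)"
proof -
  have ind: "independence_system F"
    using F by (simp add: growth_system_def)
  obtain Q Z where QZ: "Q \<union> Z = I - X" "card Z \<le> k * card (X - I)"
      and Q: "\<And>P. basis_of F X P \<Longrightarrow> P \<union> Q \<in> indep F"
    using F X I unfolding growth_system_def by metis
  have "(I - X) \<inter> PHull F X \<subseteq> Z"
  proof
    fix e assume e: "e \<in> (I - X) \<inter> PHull F X"
    then obtain C where C: "circuit F C" "e \<in> C" "C - {e} \<subseteq> X" "C - {e} \<in> indep F"
      using PHull_circuit[of e F X] by auto
    obtain P where P: "basis_of F X P" "C - {e} \<subseteq> P"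
      using basis_extend[OF ind C(4,3)] .
    have "e \<notin> Q"
    proof
      assume "e \<in> Q"
      then have "C \<in> indep F"
        using P(2) by (intro indep_downward[OF ind Q[OF P(1)]]) auto
      then show False
        using C(1) by (simp add: circuit_def)
    qed
    then show "e \<in> Z"
      using e QZ(1) by blast
  qed
  moreover have "finite Z"
    using independence_system_finite[OF ind indep_subset_ground[OF ind I]]
    by (intro finite_subset[of Z "I - X"]) (use QZ(1) in auto)
  ultimately show ?thesis
    using QZ(2) card_mono order_trans by metis
qed

section \<open>Matroids: augmentation, bases, growth property and core\<close>

lemma matroid_independence_system: "matroid F \<Longrightarrow> independence_system F"
  unfolding matroid_def by blast

lemma matroid_augment:
  assumes F: "matroid F" and I: "I \<in> indep F" and J: "J \<in> indep F" "card I \<le> card J"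
  obtains K where "K \<in> indep F" "I \<subseteq> K" "K \<subseteq> I \<union> J" "card K = card J"
proof -
  let ?\<K> = "{K. K \<in> indep F \<and> I \<subseteq> K \<and> K \<subseteq> I \<union> J \<and> card K \<le> card J}"
  note ind = matroid_independence_system[OF F]
  have "finite ?\<K>"
    by (rule finite_subset[OF _ finite_indep[OF ind]]) auto
  moreover have "I \<in> ?\<K>"
    using I J by simp
  ultimately obtain K where K: "K \<in> ?\<K>" and max: "\<forall>K'\<in>?\<K>. K \<subseteq> K' \<longrightarrow> K = K'"
    using finite_has_maximal[of ?\<K>] by (metis (no_types, lifting) empty_iff)
  have "card K = card J"
  proof (rule ccontr)
    assume "card K \<noteq> card J"
    then have less: "card K < card J"
      using K by simp
    then obtain x where x: "x \<in> J - K" "insert x K \<in> indep F"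
      using F K J(1) unfolding matroid_def by blast
    moreover have "finite K"
      using K independence_system_finite[OF ind indep_subset_ground[OF ind]] by simp
    ultimately have "insert x K \<in> ?\<K>"
      using K less by auto
    then show False
      using max x(1) by auto
  qed
  with K show thesis
    by (intro that[of K]) simp_all
qed

lemma matroid_basis_card:
  assumes F: "matroid F" and P: "basis_of F X P" and J: "J \<in> indep F" "J \<subseteq> X"
  shows "card J \<le> card P"
proof (rule ccontr)
  assume "\<not> card J \<le> card P"
  then obtain x where "x \<in> J - P" "insert x P \<in> indep F"
    using F P J(1) unfolding matroid_def basis_of_def by (metis not_le)
  then show False
    using basis_ofD(1)[OF P] basis_ofD(3)[OF P, of "insert x P"] J(2) by auto
qed

text \<open>Otherwise the remainder \<open>D - {e}\<close> of a circuit \<open>D\<close> through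
  \<open>e\<close> could be augmented from \<open>insert e C\<close> to \<open>card C + 1\<close>
  elements. The augmented set cannot contain \<open>e\<close>, as it would then contain
  \<open>D\<close>, so it is an independent subset of \<open>X\<close> larger than the basis
  \<open>C\<close>.\<close>

lemma matroid_PHull_basis:
  assumes F: "matroid F" and C: "basis_of F X C" and e: "e \<in> PHull F X" "e \<notin> X"
  shows "insert e C \<notin> indep F"
proof
  assume I: "insert e C \<in> indep F"
  note ind = matroid_independence_system[OF F]
  obtain D where D: "circuit F D" "e \<in> D" "D - {e} \<subseteq> X" "D - {e} \<in> indep F"
    using PHull_circuit[OF e] .
  have "finite C"
    using I independence_system_finite[OF ind indep_subset_ground[OF ind I]] by simp
  moreover have "e \<notin> C"
    using basis_ofD(1)[OF C] e(2) by auto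
  ultimately have card: "card (insert e C) = Suc (card C)"
    by simp
  have le: "card (D - {e}) \<le> card C"
    using matroid_basis_card[OF F C D(4,3)] .
  obtain K where K: "K \<in> indep F" "D - {e} \<subseteq> K" "K \<subseteq> (D - {e}) \<union> insert e C"
      "card K = Suc (card C)"
    using matroid_augment[OF F D(4) I] le card by auto
  have "e \<notin> K"
  proof
    assume "e \<in> K"
    then have "D \<subseteq> K"
      using K(2) by blast
    then show False
      using indep_downward[OF ind K(1)] circuit_dependent[OF D(1)] by metis
  qed
  then have "K \<subseteq> X"
    using K(3) D(3) basis_ofD(1)[OF C] by auto
  then have "card K \<le> card C"
    by (rule matroid_basis_card[OF F C K(1)])
  then show False
    using K(4) by simp
qed

text \<open>Extend a basis \<open>P0\<close> of \<open>X\<close> to a basis \<open>K\<close> of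
  \<open>X \<union> I\<close> and take \<open>Q = K - X\<close>. Since \<open>K\<close> has at least
  as many elements as \<open>I\<close>, the rest \<open>Z\<close> has at most
  \<open>card P0 - card (I \<inter> X)\<close> elements, hence at most \<open>card (X - I)\<close>.
  Any other basis \<open>P\<close> of \<open>X\<close> can be augmented from \<open>K\<close> to the
  size of \<open>K\<close>; as nothing can be added to \<open>P\<close> inside \<open>X\<close>, the
  result must be \<open>P \<union> Q\<close>.\<close>

lemma matroid_growth_system:
  assumes F: "matroid F"
  shows "growth_system 1 F"
  unfolding growth_system_def
proof (intro conjI allI impI)
  note ind = matroid_independence_system[OF F]
  show "independence_system F" by (rule ind)
  fix X I assume XI: "X \<subseteq> ground F \<and> I \<in> indep F"
  have fin: "finite X" "finite I"
    using XI independence_system_finite[OF ind] indep_subset_ground[OF ind] by simp_all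
  obtain P0 where P0: "basis_of F X P0"
    using basis_extend[OF ind empty_indep[OF ind]] by (metis empty_subsetI)
  note P0' = basis_ofD(2,1)[OF P0]
  obtain K where K: "basis_of F (X \<union> I) K" "P0 \<subseteq> K"
    using basis_extend[OF ind P0'(1), of "X \<union> I"] P0'(2) by (metis le_supI1)
  have K': "K \<in> indep F" "K \<subseteq> X \<union> I" "card I \<le> card K"
    using basis_ofD[OF K(1)] matroid_basis_card[OF F K(1), of I] XI by simp_all
  have KX: "K \<inter> X = P0"
    using K(2) P0'(2) indep_downward[OF ind K'(1)] by (intro basis_ofD(3)[OF P0]) auto
  define Q where "Q = K - X"
  define Z where "Z = I - X - Q"
  have QI: "Q \<subseteq> I - X"
    using K'(2) unfolding Q_def by blast
  have finQ: "finite Q"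
    using QI fin by (meson finite_Diff finite_subset)
  have KQ: "K = P0 \<union> Q" "P0 \<inter> Q = {}"
    using KX P0'(2) unfolding Q_def by blast+
  have cK: "card K = card P0 + card Q"
    using KQ fin P0'(2) finQ by (metis card_Un_disjoint finite_subset)
  have cZ: "card Z + card Q = card (I - X)"
    unfolding Z_def using card_Diff_subset[OF finQ QI] card_mono[OF _ QI] fin by simp
  have cI: "card (I - X) + card (I \<inter> X) = card I"
    using card_Int_Diff[OF fin(2), of X] by simp
  have cX: "card (X - I) + card (I \<inter> X) = card X"
    using card_Int_Diff[OF fin(1), of I] by (simp add: Int_commute)
  have "card P0 \<le> card X"
    using P0'(2) fin card_mono by blast
  then have "card Z \<le> 1 * card (X - I)"
    using cK cZ cI cX K'(3) by linarith
  moreover have "P \<union> Q \<in> indep F" if P: "basis_of F X P" for P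
  proof -
    note P' = basis_ofD(2,1)[OF P]
    have cP: "card P = card P0"
      using matroid_basis_card[OF F P P0'] matroid_basis_card[OF F P0 P'] by simp
    obtain L where L: "L \<in> indep F" "P \<subseteq> L" "L \<subseteq> P \<union> K" "card L = card K"
      using matroid_augment[OF F P'(1) K'(1)] cP cK by (metis le_add1)
    have "L \<inter> X = P"
      using L(2) P'(2) indep_downward[OF ind L(1)] by (intro basis_ofD(3)[OF P]) auto
    then have "L \<subseteq> P \<union> Q"
      using L(3) unfolding Q_def by blast
    moreover have "card (P \<union> Q) \<le> card L"
      using card_Un_le[of P Q] cP cK L(4) by simp
    moreover have "finite (P \<union> Q)"
      using finQ P'(2) fin finite_subset by auto
    ultimately have "L = P \<union> Q"
      by (metis card_seteq)
    with L(1) show ?thesis by simp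
  qed
  ultimately show "\<exists>Q Z. Q \<union> Z = I - X \<and> Q \<inter> Z = {} \<and> card Z \<le> 1 * card (X - I) \<and>
      (\<forall>P. basis_of F X P \<longrightarrow> P \<union> Q \<in> indep F)"
    using QI unfolding Z_def by (intro exI[of _ Q] exI[of _ "I - X - Q"]) auto
qed simp

text \<open>The core of a matroid is its greedy basis. It is independent because the lightest
  element of a circuit inside it would be spanned by heavier elements.\<close>

lemma matroid_PCore_basis:
  assumes F: "matroid F"
  shows "finite X \<Longrightarrow> X \<subseteq> ground F \<Longrightarrow> inj_on w X \<Longrightarrow> basis_of F X (PCore w F X)"
proof (induction X rule: finite_psubset_induct)
  case (psubset X)
  note ind = matroid_independence_system[OF F]
  have sub: "PCore w F X \<subseteq> X"
    unfolding PCore_def by blast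
  have indep: "PCore w F X \<in> indep F"
  proof (rule ccontr)
    assume "PCore w F X \<notin> indep F"
    then obtain C where C: "circuit F C" "C \<subseteq> PCore w F X"
      using circuit_exists[OF ind] sub psubset.prems(1) by (metis order_trans)
    have "C \<noteq> {}"
      using circuit_dependent[OF C(1)] empty_indep[OF ind] by auto
    moreover have CX: "C \<subseteq> X"
      using C(2) sub by simp
    moreover have "finite C"
      using CX psubset.hyps(1) finite_subset by metis
    ultimately obtain e where e: "e \<in> C" "\<And>f. f \<in> C \<Longrightarrow> w e \<le> w f"
      using arg_min_if_finite(1)[of C w] arg_min_least[of C _ w] by metis
    have "C \<subseteq> insert e {f \<in> X. w f > w e}"
    proof
      fix f assume f: "f \<in> C"
      then have "w f \<noteq> w e \<or> f = e"
        using inj_onD[OF psubset.prems(2), of f e] e(1) CX by auto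
      then show "f \<in> insert e {f \<in> X. w f > w e}"
        using e(2)[OF f] f CX by force
    qed
    then have "e \<in> PHull F {f \<in> X. w f > w e}"
      using C(1) e(1) CX psubset.prems(1) by (auto simp: PHull_def)
    then show False
      using e(1) C(2) by (auto simp: PCore_def)
  qed
  \<comment> \<open>An element \<open>y\<close> outside the core is spanned by the heavier elements
    \<open>?H\<close>. By induction the core of \<open>?H\<close> is a basis of \<open>?H\<close>,
    and it is part of the core of \<open>X\<close>, so \<open>y\<close> cannot be added.\<close>
  have "P' \<notin> indep F" if P': "PCore w F X \<subset> P'" "P' \<subseteq> X" for P'
  proof
    assume P'I: "P' \<in> indep F"
    obtain y where y: "y \<in> P'" "y \<notin> PCore w F X"
      using P' by blast
    let ?H = "{f \<in> X. w f > w y}"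
    have yH: "y \<in> PHull F ?H"
      using y P'(2) by (auto simp: PCore_def)
    have "basis_of F ?H (PCore w F ?H)"
      using y(1) P'(2) psubset.prems by (intro psubset.IH) (auto intro: inj_on_subset)
    then have "insert y (PCore w F ?H) \<notin> indep F"
      using matroid_PHull_basis[OF F _ yH] by simp
    moreover have "PCore w F ?H \<subseteq> PCore w F X"
    proof
      fix f assume f: "f \<in> PCore w F ?H"
      then have "{g \<in> ?H. w g > w f} = {g \<in> X. w g > w f}"
        unfolding PCore_def by auto
      then show "f \<in> PCore w F X"
        using f unfolding PCore_def by auto
    qed
    then have "insert y (PCore w F ?H) \<subseteq> P'"
      using P'(1) y(1) by blast
    ultimately show False
      using indep_downward[OF ind P'I] by metis
  qed
  then show ?case
    using sub indep by (simp add: basis_of_def)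
qed

text \<open>If the spanned part of \<open>I\<close> were larger than the basis \<open>C\<close>, the
  exchange axiom would add one of its elements to \<open>C\<close>, contradicting that it is
  spanned. Compared with \<open>growth_PHull\<close>, the bound uses the rank of \<open>X\<close> in
  place of the size of \<open>X - I\<close>.\<close>

lemma matroid_card_PHull:
  assumes F: "matroid F" and C: "basis_of F X C" and I: "I \<in> indep F"
  shows "card ((I - X) \<inter> PHull F X) \<le> card C"
proof (rule ccontr)
  note ind = matroid_independence_system[OF F]
  assume "\<not> ?thesis"
  moreover have "(I - X) \<inter> PHull F X \<in> indep F"
    by (rule indep_downward[OF ind I]) auto
  ultimately obtain x where x: "x \<in> (I - X) \<inter> PHull F X - C" "insert x C \<in> indep F"
    using F basis_ofD(2)[OF C] unfolding matroid_def by (metis not_le)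
  then show False
    using matroid_PHull_basis[OF F C, of x] by auto
qed

section \<open>Greedy sets and top-relevant edges\<close>

text \<open>Greedy decides on an element by looking at heavier elements only, so statements about
  greedy sets are proved from the heaviest element downwards.\<close>

lemma weight_descending_induct:
  fixes w :: "'e \<Rightarrow> real"
  assumes "finite D" "g \<in> D"
    and step: "\<And>g. g \<in> D \<Longrightarrow> (\<And>h. h \<in> D \<Longrightarrow> w h > w g \<Longrightarrow> P h) \<Longrightarrow> P g"
  shows "P g"
  using assms(2)
proof (induction "card {h \<in> D. w h > w g}" arbitrary: g rule: less_induct)
  case less
  show ?case
  proof (rule step[OF less.prems])
    fix h assume h: "h \<in> D" "w h > w g"
    have "{h' \<in> D. w h' > w h} \<subset> {h' \<in> D. w h' > w g}"
      using h by auto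
    then have "card {h' \<in> D. w h' > w h} < card {h' \<in> D. w h' > w g}"
      using assms(1) by (intro psubset_card_mono) auto
    then show "P h"
      using h(1) by (rule less.hyps)
  qed
qed

lemma arg_max_on_finite:
  fixes w :: "'e \<Rightarrow> real"
  assumes "finite D" "D \<noteq> {}"
  shows "arg_max_on w D \<in> D \<and> (\<forall>g\<in>D. w g \<le> w (arg_max_on w D))"
proof -
  have "Max (w ` D) \<in> w ` D"
    using assms by (intro Max_in) auto
  then obtain m where "m \<in> D" "w m = Max (w ` D)"
    by (metis imageE)
  then have "is_arg_max w (\<lambda>x. x \<in> D) m"
    using assms(1) by (simp add: is_arg_max_linorder)
  then have "is_arg_max w (\<lambda>x. x \<in> D) (arg_max_on w D)"
    unfolding arg_max_on_def arg_max_def by (rule someI)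
  then show ?thesis
    by (simp add: is_arg_max_linorder)
qed

lemma decreasing_list:
  fixes w :: "'e \<Rightarrow> real"
  assumes "finite X" "inj_on w X"
  shows "set (decreasing_list w X) = X" "distinct (decreasing_list w X)"
    and "sorted_wrt (\<lambda>e f. w e > w f) (decreasing_list w X)"
proof -
  interpret folding_insort_key "(\<le>)" "(<)" X "\<lambda>e. - w e"
    by standard (use assms(2) in \<open>auto simp: inj_on_def\<close>)
  \<comment> \<open>The interpretation yields facts about the constants of the locale with explicit
    orders; unfolding identifies these with the class constants used in
    \<open>decreasing_list\<close>. Sorting by the negated weight gives decreasing weights.\<close>
  have "linorder.insort_key (\<le>) = (insort_key :: ('e \<Rightarrow> real) \<Rightarrow> _)"
    by (simp add: linorder.insort_key_def[OF linorder_class.linorder_axioms] insort_key_def)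
  then have eq: "decreasing_list w X = linorder.sorted_key_list_of_set (\<le>) (\<lambda>e. - w e) X"
    by (simp add: decreasing_list_def linorder_class.sorted_key_list_of_set_def
        linorder.sorted_key_list_of_set_def[OF linorder_class.linorder_axioms])
  show "set (decreasing_list w X) = X" "distinct (decreasing_list w X)"
    using assms(1) distinct_if_distinct_map[OF distinct_sorted_key_list_of_set[of X]]
    unfolding eq by simp_all
  show "sorted_wrt (\<lambda>e f. w e > w f) (decreasing_list w X)"
    using strict_sorted_key_list_of_set[of X] unfolding eq by (simp add: sorted_wrt_map)
qed

text \<open>The last conjunct is a fixed-point description of greedy that no longer mentions the
  processing order. It survives appending \<open>x\<close>, because \<open>x\<close> is lighter than
  all earlier elements and so does not enter the sets \<open>{h. w h > w g}\<close> for
  them.\<close>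

lemma greedy_fold:
  fixes w :: "'e \<Rightarrow> real" and \<I> :: "'e set set"
  defines "gr \<equiv> foldl (\<lambda>M e. if insert e M \<in> \<I> then insert e M else M) {}"
  shows "sorted_wrt (\<lambda>e f. w e > w f) xs \<Longrightarrow>
    gr xs \<subseteq> set xs \<and> ({} \<in> \<I> \<longrightarrow> gr xs \<in> \<I>) \<and>
    (\<forall>g\<in>set xs. g \<in> gr xs \<longleftrightarrow> insert g {h \<in> gr xs. w h > w g} \<in> \<I>)"
proof (induction xs rule: rev_induct)
  case Nil
  then show ?case
    by (simp add: gr_def)
next
  case (snoc x xs)
  have srt: "sorted_wrt (\<lambda>e f. w e > w f) xs" and x: "\<And>y. y \<in> set xs \<Longrightarrow> w y > w x"
    using snoc.prems by (auto simp: sorted_wrt_append)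
  note IH = snoc.IH[OF srt]
  have gr: "gr (xs @ [x]) = (if insert x (gr xs) \<in> \<I> then insert x (gr xs) else gr xs)"
    by (simp add: gr_def)
  have xM: "x \<notin> gr xs" "{h \<in> gr (xs @ [x]). w h > w x} = gr xs"
    using IH x by (auto simp: gr)
  have "g \<in> gr (xs @ [x]) \<longleftrightarrow> insert g {h \<in> gr (xs @ [x]). w h > w g} \<in> \<I>"
    if "g \<in> set (xs @ [x])" for g
  proof (cases "g = x")
    case True
    then show ?thesis
      unfolding True xM(2) using xM(1) by (auto simp: gr)
  next
    case False
    then have g: "g \<in> set xs"
      using that by simp
    then have "{h \<in> gr (xs @ [x]). w h > w g} = {h \<in> gr xs. w h > w g}"
      using x[OF g] by (auto simp: gr)
    moreover have "g \<in> gr (xs @ [x]) \<longleftrightarrow> g \<in> gr xs"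
      using False by (simp add: gr)
    ultimately show ?thesis
      using IH g by simp
  qed
  moreover have "gr (xs @ [x]) \<subseteq> set (xs @ [x])" "{} \<in> \<I> \<longrightarrow> gr (xs @ [x]) \<in> \<I>"
    using IH by (auto simp: gr)
  ultimately show ?case
    by blast
qed

lemma Greedy_iff:
  assumes "finite X" "inj_on w X"
  shows "g \<in> Greedy \<I> w X \<longleftrightarrow> g \<in> X \<and> insert g {h \<in> Greedy \<I> w X. w h > w g} \<in> \<I>"
proof -
  note dl = decreasing_list[OF assms]
  have "Greedy \<I> w X \<subseteq> X"
    "\<forall>g\<in>X. g \<in> Greedy \<I> w X \<longleftrightarrow> insert g {h \<in> Greedy \<I> w X. w h > w g} \<in> \<I>"
    using greedy_fold[OF dl(3), of \<I>] unfolding Greedy_def dl(1) by simp_all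
  then show ?thesis
    by (metis subsetD)
qed

lemma Greedy_indep:
  assumes "finite X" "inj_on w X" "{} \<in> \<I>"
  shows "Greedy \<I> w X \<in> \<I>"
  using greedy_fold[OF decreasing_list(3)[OF assms(1,2)], of \<I>] assms(3)
  by (simp add: Greedy_def)

text \<open>By the fixed-point description, the decision on an element heavier than \<open>x\<close>
  consults only elements that are heavier still.\<close>

lemma Greedy_agree:
  assumes X: "finite X" "inj_on w X" and X': "finite X'" "inj_on w X'"
    and eq: "{f \<in> X. w f > x} = {f \<in> X'. w f > x}"
  shows "{f \<in> Greedy \<I> w X. w f > x} = {f \<in> Greedy \<I> w X'. w f > x}"
proof -
  have "w g > x \<longrightarrow> (g \<in> Greedy \<I> w X \<longleftrightarrow> g \<in> Greedy \<I> w X')" if "g \<in> X \<union> X'" for g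
  proof (rule weight_descending_induct[of "X \<union> X'" g w])
    fix g assume g: "g \<in> X \<union> X'"
      and IH: "\<And>h. h \<in> X \<union> X' \<Longrightarrow> w h > w g
                \<Longrightarrow> w h > x \<longrightarrow> (h \<in> Greedy \<I> w X \<longleftrightarrow> h \<in> Greedy \<I> w X')"
    show "w g > x \<longrightarrow> (g \<in> Greedy \<I> w X \<longleftrightarrow> g \<in> Greedy \<I> w X')"
    proof
      assume gx: "w g > x"
      have "h \<in> Greedy \<I> w X \<longleftrightarrow> h \<in> Greedy \<I> w X'" if "w h > w g" for h
        using IH[of h] that gx Greedy_iff[OF X, of h \<I>] Greedy_iff[OF X', of h \<I>] by auto
      then have "{h \<in> Greedy \<I> w X. w h > w g} = {h \<in> Greedy \<I> w X'. w h > w g}"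
        by auto
      moreover have "g \<in> X \<longleftrightarrow> g \<in> X'"
        using eq gx by auto
      ultimately show "g \<in> Greedy \<I> w X \<longleftrightarrow> g \<in> Greedy \<I> w X'"
        using Greedy_iff[OF X, of g \<I>] Greedy_iff[OF X', of g \<I>] by simp
    qed
  qed (use X X' that in auto)
  moreover have "Greedy \<I> w X \<subseteq> X" "Greedy \<I> w X' \<subseteq> X'"
    using Greedy_iff[OF X, of _ \<I>] Greedy_iff[OF X', of _ \<I>] by auto
  ultimately show ?thesis
    by auto
qed

lemma edge_system_independence_system:
  assumes F: "independence_system F" and "finite E"
  shows "independence_system (edge_system v E F)"
proof -
  have "v ` J \<in> indep F" if "v ` I \<in> indep F" "J \<subseteq> I" for I J
    using indep_downward[OF F that(1)] that(2) by (simp add: image_mono)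
  then show ?thesis
    using assms(2) empty_indep[OF F]
    unfolding independence_system_def edge_system_def Let_def fst_conv snd_conv
    by (auto intro: inj_on_subset)
qed

section \<open>Feasible edge sets of a bipartite instance\<close>

locale secretary_instance =
  fixes G :: "('a, 'b) bipartite_instance" and w :: "'a \<times> 'b \<Rightarrow> real"
  assumes wf: "wf_instance G" and weights: "valid_weights w (edges G)"
begin

lemma finite_agents: "finite (agents G)"
  using wf unfolding wf_instance_def by (elim conjE)

lemma finite_items: "finite (items G)"
  using wf unfolding wf_instance_def by (elim conjE)

lemma edges_subset: "edges G \<subseteq> agents G \<times> items G"
  using wf unfolding wf_instance_def by (elim conjE)

lemma finite_edges: "finite (edges G)"
  by (rule finite_subset[OF edges_subset]) (simp add: finite_agents finite_items)

lemma fst_edge: "e \<in> edges G \<Longrightarrow> fst e \<in> agents G"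
  using edges_subset by auto

lemma snd_edge: "e \<in> edges G \<Longrightarrow> snd e \<in> items G"
  using edges_subset by auto

lemma inj_w: "inj_on w (edges G)"
  using weights by (simp add: valid_weights_def)

lemma w_nonneg: "e \<in> edges G \<Longrightarrow> 0 \<le> w e"
  using weights by (simp add: valid_weights_def)

lemma w_eq_iff: "e \<in> edges G \<Longrightarrow> f \<in> edges G \<Longrightarrow> w e = w f \<longleftrightarrow> e = f"
  using inj_w by (auto simp: inj_on_def)

text \<open>Agent-side components are tagged \<open>Inl\<close> and item-side components
  \<open>Inr\<close>, so that the growth and core arguments treat both sides at once.\<close>

definition comps :: "(nat + nat) set" where
  "comps = {1..num_A G} <+> {1..num_B G}"

definition comp :: "nat + nat \<Rightarrow> ('a \<times> 'b) system" where
  "comp = case_sum (edge_sys_A G) (edge_sys_B G)"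

lemma finite_comps: "finite comps"
  by (simp add: comps_def)

lemma comp_independence_system: "j \<in> comps \<Longrightarrow> independence_system (comp j)"
  using wf finite_edges
  by (auto simp: comps_def comp_def edge_sys_A_def edge_sys_B_def wf_instance_def
           intro!: edge_system_independence_system)

lemma ground_edge_sys:
  "ground (edge_sys_A G j) = {e \<in> edges G. fst e \<in> ground (sys_A G j)}"
  "ground (edge_sys_B G j) = {e \<in> edges G. snd e \<in> ground (sys_B G j)}"
  by (simp_all add: edge_sys_A_def edge_sys_B_def edge_system_def Let_def)

lemma indep_edge_sys:
  "X \<in> indep (edge_sys_A G j) \<longleftrightarrow>
     X \<subseteq> ground (edge_sys_A G j) \<and> inj_on fst X \<and> fst ` X \<in> indep (sys_A G j)"
  "X \<in> indep (edge_sys_B G j) \<longleftrightarrow>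
     X \<subseteq> ground (edge_sys_B G j) \<and> inj_on snd X \<and> snd ` X \<in> indep (sys_B G j)"
  by (simp_all add: edge_sys_A_def edge_sys_B_def edge_system_def Let_def)

lemma agent_component:
  assumes "a \<in> agents G"
  obtains j where "j \<in> {1..num_A G}" "a \<in> ground (sys_A G j)"
  using assms wf by (auto simp: wf_instance_def)

lemma ground_combination:
  "ground (combination (num_A G) (edge_sys_A G)) = edges G"
  "ground (combination (num_B G) (edge_sys_B G)) = edges G"
proof -
  have "agents G = (\<Union>j\<in>{1..num_A G}. ground (sys_A G j))"
       "items G = (\<Union>j\<in>{1..num_B G}. ground (sys_B G j))"
    using wf by (simp_all add: wf_instance_def)
  then show "ground (combination (num_A G) (edge_sys_A G)) = edges G"
    "ground (combination (num_B G) (edge_sys_B G)) = edges G"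
    using fst_edge snd_edge by (auto simp: combination_def Let_def ground_edge_sys)
qed

lemma indep_combination:
  "I \<in> indep (combination (num_A G) (edge_sys_A G)) \<longleftrightarrow>
     I \<subseteq> edges G \<and>
     (\<forall>j\<in>{1..num_A G}. I \<inter> ground (edge_sys_A G j) \<in> indep (edge_sys_A G j))"
  "I \<in> indep (combination (num_B G) (edge_sys_B G)) \<longleftrightarrow>
     I \<subseteq> edges G \<and>
     (\<forall>j\<in>{1..num_B G}. I \<inter> ground (edge_sys_B G j) \<in> indep (edge_sys_B G j))"
  using ground_combination unfolding combination_def Let_def by simp_all

lemma feasible_iff:
  "I \<in> feasible G \<longleftrightarrow> I \<subseteq> edges G \<and> (\<forall>j\<in>comps. I \<inter> ground (comp j) \<in> indep (comp j))"
proof -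
  have "(\<forall>j\<in>comps. I \<inter> ground (comp j) \<in> indep (comp j)) \<longleftrightarrow>
      (\<forall>j\<in>{1..num_A G}. I \<inter> ground (edge_sys_A G j) \<in> indep (edge_sys_A G j)) \<and>
      (\<forall>j\<in>{1..num_B G}. I \<inter> ground (edge_sys_B G j) \<in> indep (edge_sys_B G j))"
    unfolding comps_def Plus_def by (simp add: ball_Un comp_def)
  then show ?thesis
    by (auto simp: feasible_def indep_combination simp del: atLeastAtMost_iff)
qed

lemma feasible_subset_edges: "I \<in> feasible G \<Longrightarrow> I \<subseteq> edges G"
  by (simp add: feasible_iff)

lemma finite_feasible: "finite (feasible G)"
  by (rule finite_subset[of _ "Pow (edges G)"]) (use feasible_subset_edges finite_edges in auto)

lemma feasible_finite: "I \<in> feasible G \<Longrightarrow> finite I"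
  using feasible_subset_edges finite_edges finite_subset by metis

lemma empty_feasible: "{} \<in> feasible G"
  using empty_indep[OF comp_independence_system] by (simp add: feasible_iff)

lemma feasible_downward:
  assumes "I \<in> feasible G" "J \<subseteq> I"
  shows "J \<in> feasible G"
proof -
  have "J \<inter> ground (comp j) \<in> indep (comp j)" if "j \<in> comps" for j
  proof (rule indep_downward[OF comp_independence_system[OF that]])
    show "I \<inter> ground (comp j) \<in> indep (comp j)"
      using assms(1) that by (simp add: feasible_iff)
  qed (use assms(2) in auto)
  moreover have "J \<subseteq> edges G"
    using assms(2) feasible_subset_edges[OF assms(1)] by simp
  ultimately show ?thesis
    by (simp add: feasible_iff)
qed

text \<open>Every agent lies in some agent-side component, and in that component two edges at the
  same agent are parallel.\<close>

lemma feasible_inj_fst: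
  assumes I: "I \<in> feasible G"
  shows "inj_on fst I"
proof (rule inj_onI)
  fix e f assume ef: "e \<in> I" "f \<in> I" "fst e = fst f"
  have sub: "I \<subseteq> edges G"
    using I by (rule feasible_subset_edges)
  then have "fst e \<in> agents G"
    using ef(1) fst_edge subsetD by metis
  then obtain j where j: "j \<in> {1..num_A G}" "fst e \<in> ground (sys_A G j)"
    by (rule agent_component)
  have "I \<inter> ground (edge_sys_A G j) \<in> indep (edge_sys_A G j)"
    using I j(1) by (simp add: feasible_def indep_combination del: atLeastAtMost_iff)
  then have "inj_on fst (I \<inter> ground (edge_sys_A G j))"
    by (simp add: indep_edge_sys)
  moreover have "e \<in> I \<inter> ground (edge_sys_A G j)" "f \<in> I \<inter> ground (edge_sys_A G j)"
    using ef j(2) sub by (auto simp: ground_edge_sys)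
  ultimately show "e = f"
    using ef(3) by (auto dest: inj_onD)
qed

lemma delta_iff: "e \<in> delta G Y \<longleftrightarrow> e \<in> edges G \<and> fst e \<in> Y"
  by (simp add: delta_def)

lemma delta_greedy_ok: "finite (delta G Y)" "inj_on w (delta G Y)"
  using finite_edges inj_w by (auto simp: delta_def intro: inj_on_subset)

section \<open>Greedy sets of sampled agents and top-relevant edges\<close>

definition greedy_on :: "'a set \<Rightarrow> ('a \<times> 'b) set" where
  "greedy_on Y = Greedy (feasible G) w (delta G Y)"

definition relevant :: "'a set \<Rightarrow> 'a \<times> 'b \<Rightarrow> bool" where
  "relevant Y e \<longleftrightarrow> fst e \<notin> Y \<and> insert e {h \<in> greedy_on Y. w h > w e} \<in> feasible G"

lemma greedy_on_iff:
  "g \<in> greedy_on Y \<longleftrightarrow>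
     g \<in> edges G \<and> fst g \<in> Y \<and> insert g {h \<in> greedy_on Y. w h > w g} \<in> feasible G"
  unfolding greedy_on_def by (subst Greedy_iff[OF delta_greedy_ok]) (auto simp: delta_iff)

lemma greedy_on_feasible: "greedy_on Y \<in> feasible G"
  unfolding greedy_on_def by (rule Greedy_indep[OF delta_greedy_ok empty_feasible])

text \<open>Adding \<open>e\<close> to the input does not change the greedy set above the weight of
  \<open>e\<close>, so relevance can be tested against the one set \<open>greedy_on Y\<close>
  instead of a separate greedy run for each \<open>e\<close>.\<close>

lemma greedy_relevant_iff:
  assumes "e \<in> edges G"
  shows "greedy_relevant (feasible G) w (delta G Y) e \<longleftrightarrow> relevant Y e"
proof (cases "fst e \<in> Y")
  case False
  let ?X = "insert e (delta G Y)"
  have X: "finite ?X" "inj_on w ?X"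
    using delta_greedy_ok(1) assms inj_on_subset[OF inj_w, of ?X]
    by (simp_all add: delta_def subset_iff)
  have "{f \<in> Greedy (feasible G) w ?X. w f > w e} = {f \<in> greedy_on Y. w f > w e}"
    unfolding greedy_on_def using X delta_greedy_ok by (intro Greedy_agree) auto
  then show ?thesis
    using False Greedy_iff[OF X, of e "feasible G"]
    by (simp add: greedy_relevant_def relevant_def delta_iff)
qed (use assms in \<open>simp add: greedy_relevant_def relevant_def delta_iff\<close>)

lemma toprel_eq_Some_iff:
  "toprel G w a Y = Some e \<longleftrightarrow>
     e \<in> edges G \<and> fst e = a \<and> relevant Y e \<and>
     (\<forall>g\<in>edges G. fst g = a \<and> relevant Y g \<longrightarrow> w g \<le> w e)"
proof -
  define D where "D = {g \<in> edges G. fst g = a \<and> relevant Y g}"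
  have "{g \<in> delta G {a}. greedy_relevant (feasible G) w (delta G Y) g} = D"
    using greedy_relevant_iff by (auto simp: delta_iff D_def)
  then have eq: "toprel G w a Y = (if D = {} then None else Some (arg_max_on w D))"
    by (simp add: toprel_def)
  have "toprel G w a Y = Some e \<longleftrightarrow> e \<in> D \<and> (\<forall>g\<in>D. w g \<le> w e)"
  proof (cases "D = {}")
    case True
    then show ?thesis
      by (simp add: eq)
  next
    case False
    have D: "finite D" "D \<subseteq> edges G"
      using finite_edges by (simp_all add: D_def)
    have max: "arg_max_on w D \<in> D" "\<forall>g\<in>D. w g \<le> w (arg_max_on w D)"
      using arg_max_on_finite[OF D(1) False, of w] by simp_all
    show ?thesis
    proof
      assume "toprel G w a Y = Some e"
      then show "e \<in> D \<and> (\<forall>g\<in>D. w g \<le> w e)"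
        using max False by (simp add: eq)
    next
      assume e: "e \<in> D \<and> (\<forall>g\<in>D. w g \<le> w e)"
      then have "w (arg_max_on w D) = w e"
        using max by (metis order_antisym)
      then have "arg_max_on w D = e"
        using max(1) e D(2) w_eq_iff by (metis subsetD)
      then show "toprel G w a Y = Some e"
        using False by (simp add: eq)
    qed
  qed
  then show ?thesis
    unfolding D_def by blast
qed

lemma Rel_iff:
  "e \<in> Rel G w Y \<longleftrightarrow>
     e \<in> edges G \<and> relevant Y e \<and>
     (\<forall>g\<in>edges G. fst g = fst e \<and> relevant Y g \<longrightarrow> w g \<le> w e)"
proof -
  have "e \<in> Rel G w Y \<longleftrightarrow> fst e \<in> agents G - Y \<and> toprel G w (fst e) Y = Some e"
    by (auto simp: Rel_def toprel_eq_Some_iff)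
  then show ?thesis
    using fst_edge[of e] unfolding toprel_eq_Some_iff relevant_def by auto
qed

lemma toprel_Rel: "toprel G w a Y = Some e \<longleftrightarrow> e \<in> Rel G w Y \<and> fst e = a"
  unfolding toprel_eq_Some_iff Rel_iff by metis

lemma Rel_subset_edges: "Rel G w Y \<subseteq> edges G"
  by (auto simp: Rel_iff)

lemma Rel_fst: "e \<in> Rel G w Y \<Longrightarrow> fst e \<in> agents G - Y"
  using fst_edge by (auto simp: Rel_iff relevant_def)

lemma inj_fst_Rel: "inj_on fst (Rel G w Y)"
proof (rule inj_onI)
  fix e f assume "e \<in> Rel G w Y" "f \<in> Rel G w Y" "fst e = fst f"
  then have "w e \<le> w f" "w f \<le> w e" "e \<in> edges G" "f \<in> edges G"
    by (auto simp: Rel_iff)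
  then show "e = f"
    using w_eq_iff by auto
qed

text \<open>Moving the agent of \<open>e\<close> into the sample does not change what happens to the edges heavier
  than \<open>e\<close>, so \<open>e\<close> is top-relevant without its agent in the sample iff greedy selects it with
  the agent in the sample.\<close>

lemma greedy_on_insert_agree:
  assumes e: "e \<in> edges G" "fst e \<notin> Y" "e \<in> Rel G w Y \<or> e \<in> greedy_on (insert (fst e) Y)"
    and g: "g \<in> edges G" "w g > w e"
  shows "g \<in> greedy_on Y \<longleftrightarrow> g \<in> greedy_on (insert (fst e) Y)"
proof -
  let ?Y = "insert (fst e) Y"
  have "w g > w e \<longrightarrow> (g \<in> greedy_on Y \<longleftrightarrow> g \<in> greedy_on ?Y)"
  proof (rule weight_descending_induct[OF finite_edges g(1), of w])
    fix g assume g: "g \<in> edges G"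
      and IH: "\<And>h. h \<in> edges G \<Longrightarrow> w h > w g
                \<Longrightarrow> w h > w e \<longrightarrow> (h \<in> greedy_on Y \<longleftrightarrow> h \<in> greedy_on ?Y)"
    show "w g > w e \<longrightarrow> (g \<in> greedy_on Y \<longleftrightarrow> g \<in> greedy_on ?Y)"
    proof
      assume ge: "w g > w e"
      have "h \<in> greedy_on Y \<longleftrightarrow> h \<in> greedy_on ?Y" if "w h > w g" for h
        using IH[of h] that ge greedy_on_iff[of h Y] greedy_on_iff[of h ?Y] by auto
      then have eq: "{h \<in> greedy_on Y. w h > w g} = {h \<in> greedy_on ?Y. w h > w g}"
        by auto
      show "g \<in> greedy_on Y \<longleftrightarrow> g \<in> greedy_on ?Y"
      proof (cases "fst g = fst e")
        case False
        then show ?thesis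
          using greedy_on_iff[of g Y] greedy_on_iff[of g ?Y] eq by simp
      next
        case True
        have "g \<notin> greedy_on Y"
          using True e(2) greedy_on_iff[of g Y] by simp
        moreover have "g \<notin> greedy_on ?Y"
        proof
          assume gM: "g \<in> greedy_on ?Y"
          \<comment> \<open>A heavier edge at the agent of \<open>e\<close> in the greedy set
            contradicts either alternative: greedy keeps at most one edge per agent, and a
            top-relevant \<open>e\<close> is the heaviest relevant edge of its agent.\<close>
          from e(3) show False
          proof
            assume "e \<in> greedy_on ?Y"
            then have "g = e"
              using inj_onD[OF feasible_inj_fst[OF greedy_on_feasible] True gM] by simp
            then show False
              using ge by simp
          next
            assume "e \<in> Rel G w Y"
            moreover have "relevant Y g"
              using gM eq True e(2) greedy_on_iff[of g ?Y] by (simp add: relevant_def)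
            ultimately show False
              using g ge True by (auto simp: Rel_iff)
          qed
        qed
        ultimately show ?thesis
          by simp
      qed
    qed
  qed
  then show ?thesis
    using g(2) by simp
qed

lemma greedy_on_insert_agree_set:
  assumes "e \<in> edges G" "fst e \<notin> Y" "e \<in> Rel G w Y \<or> e \<in> greedy_on (insert (fst e) Y)" "w e \<le> x"
  shows "{h \<in> greedy_on Y. w h > x} = {h \<in> greedy_on (insert (fst e) Y). w h > x}"
  using greedy_on_insert_agree[OF assms(1-3)] assms(4) greedy_on_iff[of _ Y]
    greedy_on_iff[of _ "insert (fst e) Y"]
  by (metis (mono_tags, opaque_lifting) order.strict_trans1)

lemma Rel_iff_greedy_on_insert:
  assumes e: "e \<in> edges G" "fst e \<notin> Y"
  shows "e \<in> Rel G w Y \<longleftrightarrow> e \<in> greedy_on (insert (fst e) Y)"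
proof
  assume "e \<in> Rel G w Y"
  then show "e \<in> greedy_on (insert (fst e) Y)"
    using greedy_on_insert_agree_set[OF e, of "w e"] e greedy_on_iff[of e "insert (fst e) Y"]
    by (simp add: Rel_iff relevant_def)
next
  assume eM: "e \<in> greedy_on (insert (fst e) Y)"
  note agree = greedy_on_insert_agree_set[OF e disjI2[OF eM]]
  have "relevant Y e"
    using eM agree[of "w e"] e greedy_on_iff[of e "insert (fst e) Y"] by (simp add: relevant_def)
  moreover have "w g \<le> w e" if g: "g \<in> edges G" "fst g = fst e" "relevant Y g" for g
  proof (rule ccontr)
    assume "\<not> w g \<le> w e"
    then have ge: "w e < w g"
      by simp
    then have "g \<in> greedy_on (insert (fst e) Y)"
      using g agree[of "w g"] greedy_on_iff[of g "insert (fst e) Y"] by (simp add: relevant_def)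
    then have "g = e"
      using inj_onD[OF feasible_inj_fst[OF greedy_on_feasible] g(2)] eM by simp
    then show False
      using ge by simp
  qed
  ultimately show "e \<in> Rel G w Y"
    using e(1) by (simp add: Rel_iff)
qed

text \<open>At other agents, relevance above the weight of \<open>e\<close> is decided by the part
  of the greedy set above that weight, which is the same for both samples. At the agent of
  \<open>e\<close> neither side has a heavier edge: \<open>e\<close> is top-relevant for
  \<open>Y\<close>, and in \<open>insert (fst e) Y\<close> this agent is sampled.\<close>

lemma Rel_insert_agree:
  assumes e: "e \<in> edges G" "fst e \<notin> Y" and eR: "e \<in> Rel G w Y"
  shows "{g \<in> Rel G w Y. w g > w e} = {g \<in> Rel G w (insert (fst e) Y). w g > w e}"
proof -
  let ?Y = "insert (fst e) Y"
  note agree = greedy_on_insert_agree_set[OF e disjI1[OF eR]]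
  have rel: "relevant Y h \<longleftrightarrow> relevant ?Y h" if "w h > w e" "fst h \<noteq> fst e" for h
    using that agree[of "w h"] by (simp add: relevant_def)
  have "g \<in> Rel G w Y \<longleftrightarrow> g \<in> Rel G w ?Y" if g: "g \<in> edges G" "w g > w e" for g
  proof (cases "fst g = fst e")
    case True
    then have "g \<notin> Rel G w Y"
      using inj_onD[OF inj_fst_Rel True _ eR] g(2) by auto
    moreover have "g \<notin> Rel G w ?Y"
      using Rel_fst[of g ?Y] True by auto
    ultimately show ?thesis
      by simp
  next
    case False
    have "(\<forall>h\<in>edges G. fst h = fst g \<and> relevant Y h \<longrightarrow> w h \<le> w g) \<longleftrightarrow>
          (\<forall>h\<in>edges G. fst h = fst g \<and> relevant ?Y h \<longrightarrow> w h \<le> w g)"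
      using rel False g(2) by (smt (verit))
    then show ?thesis
      using rel[OF g(2) False] by (simp add: Rel_iff)
  qed
  then show ?thesis
    using Rel_subset_edges by blast
qed

end

section \<open>The expected weight of the core\<close>

text \<open>The expectation over \<open>random_subset q X\<close>, written as a finite sum.
  Conditioning on one element and exchanging sums are then algebraic identities, valid for every
  real \<open>q\<close>.\<close>

definition subset_expectation :: "real \<Rightarrow> 's set \<Rightarrow> ('s set \<Rightarrow> real) \<Rightarrow> real" where
  "subset_expectation q X f = (\<Sum>S\<in>Pow X. q ^ card S * (1 - q) ^ card (X - S) * f S)"

lemma subset_expectation_empty [simp]: "subset_expectation q {} f = f {}"
  by (simp add: subset_expectation_def)

lemma subset_expectation_insert:
  assumes "finite X" "a \<notin> X"
  shows "subset_expectation q (insert a X) f =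
    q * subset_expectation q X (\<lambda>S. f (insert a S)) + (1 - q) * subset_expectation q X f"
proof -
  let ?g = "\<lambda>S. q ^ card S * (1 - q) ^ card (insert a X - S) * f S"
  have "subset_expectation q (insert a X) f = sum ?g (Pow X) + sum ?g (insert a ` Pow X)"
    unfolding subset_expectation_def Pow_insert
    using assms by (intro sum.union_disjoint) auto
  also have "sum ?g (insert a ` Pow X) = (\<Sum>S\<in>Pow X. ?g (insert a S))"
    by (rule sum.reindex_cong[of "insert a"]) (use assms in \<open>auto simp: inj_on_def\<close>)
  also have "\<dots> = q * subset_expectation q X (\<lambda>S. f (insert a S))"
    unfolding subset_expectation_def sum_distrib_left
  proof (rule sum.cong[OF refl])
    fix S assume S: "S \<in> Pow X"
    then have "finite S" "a \<notin> S"
      using assms finite_subset by auto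
    moreover have "insert a X - insert a S = X - S"
      using assms(2) by auto
    ultimately show "?g (insert a S) = q * (q ^ card S * (1 - q) ^ card (X - S) * f (insert a S))"
      by simp
  qed
  also have "sum ?g (Pow X) = (1 - q) * subset_expectation q X f"
    unfolding subset_expectation_def sum_distrib_left
  proof (rule sum.cong[OF refl])
    fix S assume S: "S \<in> Pow X"
    then have "insert a X - S = insert a (X - S)" "a \<notin> X - S"
      using assms(2) by auto
    then show "?g S = (1 - q) * (q ^ card S * (1 - q) ^ card (X - S) * f S)"
      using assms(1) by simp
  qed
  finally show ?thesis by simp
qed

lemma subset_expectation_const:
  assumes "finite X"
  shows "subset_expectation q X (\<lambda>_. c) = c"
  using assms by induction (simp_all add: subset_expectation_insert algebra_simps)

lemma subset_expectation_cong:
  "(\<And>S. S \<subseteq> X \<Longrightarrow> f S = g S) \<Longrightarrow> subset_expectation q X f = subset_expectation q X g"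
  by (simp add: subset_expectation_def)

lemma subset_expectation_mono:
  assumes "0 \<le> q" "q \<le> 1" "\<And>S. S \<subseteq> X \<Longrightarrow> f S \<le> g S"
  shows "subset_expectation q X f \<le> subset_expectation q X g"
  unfolding subset_expectation_def using assms by (intro sum_mono mult_left_mono) auto

lemma subset_expectation_nonneg:
  assumes "0 \<le> q" "q \<le> 1" "\<And>S. S \<subseteq> X \<Longrightarrow> 0 \<le> f S"
  shows "0 \<le> subset_expectation q X f"
  unfolding subset_expectation_def using assms by (intro sum_nonneg mult_nonneg_nonneg) auto

lemma subset_expectation_sum:
  "subset_expectation q X (\<lambda>S. \<Sum>i\<in>J. f i S) = (\<Sum>i\<in>J. subset_expectation q X (f i))"
  unfolding subset_expectation_def sum_distrib_left by (rule sum.swap)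

lemma subset_expectation_mult:
  "subset_expectation q X (\<lambda>S. c * f S) = c * subset_expectation q X f"
  unfolding subset_expectation_def by (simp add: sum_distrib_left mult_ac)

lemma subset_expectation_diff:
  "subset_expectation q X (\<lambda>S. f S - g S) = subset_expectation q X f - subset_expectation q X g"
  unfolding subset_expectation_def by (simp add: right_diff_distrib sum_subtractf)

lemma subset_expectation_add:
  "subset_expectation q X (\<lambda>S. f S + g S) = subset_expectation q X f + subset_expectation q X g"
  unfolding subset_expectation_def by (simp add: distrib_left sum.distrib)

lemma subset_expectation_half_complement:
  assumes "finite X"
  shows "subset_expectation (1/2) X (\<lambda>S. f (X - S)) = subset_expectation (1/2) X f"
  unfolding subset_expectation_def
  by (rule sum.reindex_bij_witness[of _ "\<lambda>S. X - S" "\<lambda>S. X - S"])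
     (auto simp: double_diff mult_ac)

lemma subset_expectation_image:
  assumes "finite Z"
  shows "finite R \<Longrightarrow> inj_on v R \<Longrightarrow> v ` R \<subseteq> Z \<Longrightarrow>
    subset_expectation q Z (\<lambda>S. f {e \<in> R. v e \<in> S}) = subset_expectation q R f"
  using assms
proof (induction Z arbitrary: R f)
  case empty
  then show ?case by simp
next
  case (insert a Z)
  show ?case
  proof (cases "a \<in> v ` R")
    case False
    have "{e \<in> R. v e \<in> insert a S} = {e \<in> R. v e \<in> S}" for S
      using False by auto
    moreover have "v ` R \<subseteq> Z"
      using False insert.prems by auto
    ultimately show ?thesis
      using insert by (simp add: subset_expectation_insert algebra_simps)
  next
    case True
    then obtain e where e: "e \<in> R" "v e = a"
      by auto
    define R' where "R' = R - {e}"
    have R: "R = insert e R'" "e \<notin> R'" "finite R'" "inj_on v R'"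
      using e insert.prems by (auto simp: R'_def intro: inj_on_subset)
    have vR: "v e' \<noteq> a" if "e' \<in> R'" for e'
      using that e insert.prems(2) by (auto simp: R'_def inj_on_def)
    then have R'Z: "v ` R' \<subseteq> Z"
      using insert.prems(3) by (auto simp: R'_def)
    have 1: "{e' \<in> R. v e' \<in> insert a S} = insert e {e' \<in> R'. v e' \<in> S}"
      and 2: "S \<subseteq> Z \<Longrightarrow> {e' \<in> R. v e' \<in> S} = {e' \<in> R'. v e' \<in> S}" for S
      using R(1) e(2) vR insert.hyps(2) by auto
    have "subset_expectation q (insert a Z) (\<lambda>S. f {e \<in> R. v e \<in> S}) =
        q * subset_expectation q Z (\<lambda>S. f (insert e {e' \<in> R'. v e' \<in> S})) +
        (1 - q) * subset_expectation q Z (\<lambda>S. f {e' \<in> R'. v e' \<in> S})"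
      unfolding subset_expectation_insert[OF insert.hyps(1,2)] 1
      using 2 by (simp cong: subset_expectation_cong)
    also have "\<dots> = subset_expectation q R f"
      unfolding R(1) subset_expectation_insert[OF R(3,2)]
      using insert.IH[OF R(3,4) R'Z] insert.IH[OF R(3,4) R'Z, of "\<lambda>S. f (insert e S)"] by simp
    finally show ?thesis .
  qed
qed

lemma expectation_random_subset:
  assumes q: "0 \<le> q" "q \<le> 1" and "finite X"
  shows "measure_pmf.expectation (random_subset q X) f = subset_expectation q X f"
  using assms(3)
proof (induction X arbitrary: f)
  case empty
  then show ?case
    by (simp add: random_subset_def)
next
  case (insert a X)
  let ?P = "Pi_pmf X False (\<lambda>_. bernoulli_pmf q)"
  have fin: "finite (set_pmf ?P)"
    by (rule finite_subset[OF set_Pi_pmf_subset'[OF insert.hyps(1)]])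
       (use insert.hyps(1) in auto)
  have "random_subset q (insert a X) =
      bind_pmf (bernoulli_pmf q) (\<lambda>y. map_pmf (\<lambda>b. {x \<in> insert a X. (b(a := y)) x}) ?P)"
    unfolding random_subset_def Pi_pmf_insert'[OF insert.hyps]
    by (simp add: map_bind_pmf map_pmf_def bind_assoc_pmf bind_return_pmf)
  also have "\<dots> = bind_pmf (bernoulli_pmf q)
      (\<lambda>y. map_pmf (if y then insert a else (\<lambda>S. S)) (random_subset q X))"
  proof (rule bind_pmf_cong[OF refl])
    fix y
    have "{x \<in> insert a X. (b(a := y)) x} = (if y then insert a else (\<lambda>S. S)) {x \<in> X. b x}" for b
      using insert.hyps(2) by auto
    then show "map_pmf (\<lambda>b. {x \<in> insert a X. (b(a := y)) x}) ?P =
        map_pmf (if y then insert a else (\<lambda>S. S)) (random_subset q X)"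
      by (simp add: random_subset_def map_pmf_comp)
  qed
  also have "measure_pmf.expectation \<dots> f =
     (\<Sum>y\<in>{True, False}. pmf (bernoulli_pmf q) y *\<^sub>R
       measure_pmf.expectation (map_pmf (if y then insert a else (\<lambda>S. S)) (random_subset q X)) f)"
    using fin by (intro pmf_expectation_bind) (auto simp: random_subset_def)
  also have "\<dots> = subset_expectation q (insert a X) f"
    using insert.IH insert.IH[of "\<lambda>S. f (insert a S)"] q insert.hyps
    by (simp add: subset_expectation_insert)
  finally show ?case .
qed

text \<open>Layer-cake: integrate the inequality between the level sets over \<open>x\<close>.\<close>

lemma sum_le_if_level_sums_le:
  fixes w c d :: "'e \<Rightarrow> real"
  assumes fin: "finite S" "finite T" and w: "\<And>e. e \<in> S \<union> T \<Longrightarrow> 0 \<le> w e"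
    and le: "\<And>x. sum c {e \<in> S. x \<le> w e} \<le> sum d {e \<in> T. x \<le> w e}"
  shows "(\<Sum>e\<in>S. c e * w e) \<le> (\<Sum>e\<in>T. d e * w e)"
proof -
  \<comment> \<open>All weights lie between 0 and \<open>B\<close>, so integrating the level sums
    over this interval recovers the weighted sums. Inserting 0 makes \<open>B\<close> meaningful
    when there are no elements.\<close>
  define B where "B = Max (insert 0 (w ` (S \<union> T)))"
  have B: "w e \<le> B" if "e \<in> S \<union> T" for e
    unfolding B_def using fin that by (intro Max_ge) auto
  have layer: "((\<lambda>x. sum b {e \<in> U. x \<le> w e}) has_integral (\<Sum>e\<in>U. b e * w e)) {0..B}"
    if U: "U \<subseteq> S \<union> T" for U b
  proof -
    have finU: "finite U"
      using U fin finite_subset by auto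
    have "((\<lambda>x. if x \<in> {0..w e} then b e else 0) has_integral b e * w e) {0..B}" if "e \<in> U" for e
    proof -
      have "((\<lambda>x. b e) has_integral b e * w e) {0..w e}"
        using has_integral_const_real[of "b e" 0 "w e"] w[of e] U that
        by (auto simp: mult.commute)
      then show ?thesis
        using B[of e] U that by (subst has_integral_restrict) auto
    qed
    then have "((\<lambda>x. \<Sum>e\<in>U. if x \<in> {0..w e} then b e else 0) has_integral (\<Sum>e\<in>U. b e * w e)) {0..B}"
      by (intro has_integral_sum finU)
    moreover have "(\<Sum>e\<in>U. if x \<in> {0..w e} then b e else 0) = sum b {e \<in> U. x \<le> w e}"
      if "x \<in> {0..B}" for x
      using that finU by (simp add: sum.If_cases Int_def)
    ultimately show ?thesis
      by (rule has_integral_eq[rotated]) auto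
  qed
  show ?thesis
    by (rule has_integral_le[OF layer layer]) (use le in auto)
qed

section \<open>Expected weights of the greedy set, of the relevant edges and of the core\<close>

context secretary_instance
begin

lemma finite_Rel: "finite (Rel G w Y)"
  using Rel_subset_edges finite_edges finite_subset by metis

lemma greedy_on_subset_edges: "greedy_on Y \<subseteq> edges G"
  using feasible_subset_edges[OF greedy_on_feasible] .

lemma finite_greedy_on: "finite (greedy_on Y)"
  using feasible_finite[OF greedy_on_feasible] .

lemma Rel_greedy_on_disjoint: "Rel G w Y \<inter> greedy_on Y = {}"
  using Rel_fst greedy_on_iff by blast

text \<open>The agent of a given edge is in the sample with probability \<open>p\<close> independently of the
  other agents, hence an edge that greedy selects once its agent is sampled ends up in \<open>Rel\<close>
  and in the greedy set with odds \<open>(1 - p) : p\<close>.\<close>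

lemma Rel_greedy_exchange:
  "p * subset_expectation p (agents G)
         (\<lambda>Y. \<Sum>e\<in>Rel G w Y. g e {h \<in> Rel G w Y. w h > w e}) =
   (1 - p) * subset_expectation p (agents G)
         (\<lambda>Y. \<Sum>e\<in>greedy_on Y. g e {h \<in> Rel G w Y. w h > w e})"
proof -
  let ?g = "\<lambda>e Y. g e {h \<in> Rel G w Y. w h > w e}"
  have ext: "(\<Sum>e\<in>Z. f e) = (\<Sum>e\<in>edges G. if e \<in> Z then f e else 0)" if "Z \<subseteq> edges G"
    for Z and f :: "'a \<times> 'b \<Rightarrow> real"
    using that finite_edges by (simp add: sum.If_cases Int_absorb1)
  \<comment> \<open>For a single edge, condition on whether its agent is sampled. Membership in
    \<open>Rel\<close> requires that it is not, membership in the greedy set that it is; given the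
    other agents, both events and the heavier edges of \<open>Rel\<close> then coincide.\<close>
  have edge: "p * subset_expectation p (agents G) (\<lambda>Y. if e \<in> Rel G w Y then ?g e Y else 0) =
        (1 - p) * subset_expectation p (agents G) (\<lambda>Y. if e \<in> greedy_on Y then ?g e Y else 0)"
    if e: "e \<in> edges G" for e
  proof -
    define A where "A = agents G - {fst e}"
    have A: "agents G = insert (fst e) A" "fst e \<notin> A" "finite A"
      using fst_edge[OF e] finite_agents by (auto simp: A_def)
    have "subset_expectation p (agents G) (\<lambda>Y. if e \<in> Rel G w Y then ?g e Y else 0) =
        (1 - p) * subset_expectation p A (\<lambda>Y. if e \<in> Rel G w Y then ?g e Y else 0)"
    proof -
      have "e \<notin> Rel G w (insert (fst e) S)" for S
        using Rel_fst[of e "insert (fst e) S"] by auto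
      then show ?thesis
        using A by (simp add: subset_expectation_insert subset_expectation_const)
    qed
    moreover have "subset_expectation p (agents G) (\<lambda>Y. if e \<in> greedy_on Y then ?g e Y else 0) =
        p * subset_expectation p A (\<lambda>Y. if e \<in> Rel G w Y then ?g e Y else 0)"
    proof -
      have "(if e \<in> greedy_on S then ?g e S else 0) = 0" if "S \<subseteq> A" for S
        using that A(2) greedy_on_iff[of e S] by auto
      then have "subset_expectation p A (\<lambda>S. if e \<in> greedy_on S then ?g e S else 0) = 0"
        using subset_expectation_const[OF A(3), of p 0] by (simp cong: subset_expectation_cong)
      moreover have "(if e \<in> greedy_on (insert (fst e) S) then ?g e (insert (fst e) S) else 0) =
          (if e \<in> Rel G w S then ?g e S else 0)" if "S \<subseteq> A" for S
      proof -
        have "fst e \<notin> S"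
          using that A(2) by auto
        then show ?thesis
          using Rel_iff_greedy_on_insert[OF e] Rel_insert_agree[OF e] by simp
      qed
      ultimately show ?thesis
        unfolding A(1) subset_expectation_insert[OF A(3,2)] by (simp cong: subset_expectation_cong)
    qed
    ultimately show ?thesis
      by simp
  qed
  show ?thesis
    unfolding ext[OF Rel_subset_edges] ext[OF greedy_on_subset_edges] subset_expectation_sum
    unfolding sum_distrib_left using edge by (intro sum.cong) auto
qed

text \<open>For an edge of \<open>Rel\<close> in component \<open>j\<close> this is failure of the
  core test there. It is also applied to edges of the greedy set, where independence permits a bound
  on their number.\<close>

definition spanned :: "nat + nat \<Rightarrow> 'a set \<Rightarrow> 'a \<times> 'b \<Rightarrow> bool" where
  "spanned j Y e \<longleftrightarrow> e \<in> PHull (comp j) ({h \<in> Rel G w Y. w h > w e} \<inter> ground (comp j))"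

lemma spanned_ground: "spanned j Y e \<Longrightarrow> e \<in> ground (comp j)"
  by (auto simp: spanned_def PHull_def)

lemma greedy_on_comp_indep: "j \<in> comps \<Longrightarrow> greedy_on Y \<inter> ground (comp j) \<in> indep (comp j)"
  using greedy_on_feasible by (simp add: feasible_iff)

text \<open>For \<open>e\<close> of weight at least \<open>x\<close>, all relevant edges heavier
  than \<open>e\<close> belong to the level set \<open>X\<close>, so monotonicity puts
  \<open>e\<close> into the hull of \<open>X\<close>. In this form the cardinality bounds on spanned
  parts of independent sets apply level by level.\<close>

lemma spanned_level_subset:
  fixes x j Y
  defines "X \<equiv> {h \<in> Rel G w Y \<inter> ground (comp j). x \<le> w h}"
  shows "{e \<in> {e \<in> greedy_on Y. spanned j Y e}. x \<le> w e} \<subseteq>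
     (greedy_on Y \<inter> ground (comp j) - X) \<inter> PHull (comp j) X"
proof
  fix e assume e: "e \<in> {e \<in> {e \<in> greedy_on Y. spanned j Y e}. x \<le> w e}"
  have "{h \<in> Rel G w Y. w h > w e} \<inter> ground (comp j) \<subseteq> X"
    using e by (auto simp: X_def)
  then have "e \<in> PHull (comp j) X"
    using PHull_mono e unfolding spanned_def by blast
  moreover have "e \<notin> X"
    using e Rel_greedy_on_disjoint by (auto simp: X_def)
  ultimately show "e \<in> (greedy_on Y \<inter> ground (comp j) - X) \<inter> PHull (comp j) X"
    using e spanned_ground[of j Y e] by simp
qed

text \<open>On each level, \<open>growth_PHull\<close> compares the independent set
  \<open>greedy_on Y\<close> with the level set of \<open>Rel\<close>; the levels are then combined
  by integration.\<close>

lemma greedy_spanned_growth: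
  assumes j: "j \<in> comps" and growth: "growth_system k (comp j)"
  shows "(\<Sum>e | e \<in> greedy_on Y \<and> spanned j Y e. w e)
     \<le> real k * (\<Sum>e\<in>Rel G w Y \<inter> ground (comp j). w e)"
proof -
  let ?S = "{e \<in> greedy_on Y. spanned j Y e}" and ?T = "Rel G w Y \<inter> ground (comp j)"
  have "(\<Sum>e\<in>?S. 1 * w e) \<le> (\<Sum>e\<in>?T. real k * w e)"
  proof (rule sum_le_if_level_sums_le)
    show "finite ?S" "finite ?T"
      using finite_greedy_on finite_Rel by auto
    show "0 \<le> w e" if "e \<in> ?S \<union> ?T" for e
      using that w_nonneg greedy_on_subset_edges Rel_subset_edges by blast
    fix x
    let ?I = "greedy_on Y \<inter> ground (comp j)" and ?X = "{h \<in> ?T. x \<le> w h}"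
    have "card {e \<in> ?S. x \<le> w e} \<le> card ((?I - ?X) \<inter> PHull (comp j) ?X)"
      using finite_greedy_on by (intro card_mono[OF _ spanned_level_subset]) auto
    also have "\<dots> \<le> k * card (?X - ?I)"
      using growth_PHull[OF growth, of ?X ?I] greedy_on_comp_indep[OF j] by auto
    also have "\<dots> \<le> k * card ?X"
      using finite_Rel by (intro mult_le_mono2 card_mono) auto
    finally have "card {e \<in> ?S. x \<le> w e} \<le> k * card ?X" .
    then show "sum (\<lambda>_. 1) {e \<in> ?S. x \<le> w e} \<le> sum (\<lambda>_. real k) ?X"
      by (simp flip: of_nat_mult add: mult.commute)
  qed
  then show ?thesis
    by (simp add: sum_distrib_left)
qed

text \<open>The unspanned edges of a level set of \<open>Rel\<close> are exactly its core, hence a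
  basis of it, and a matroid basis is at least as large as the part of an independent set that it
  spans.\<close>

lemma greedy_spanned_matroid:
  assumes j: "j \<in> comps" and mat: "matroid (comp j)"
  shows "(\<Sum>e | e \<in> greedy_on Y \<and> spanned j Y e. w e)
     \<le> (\<Sum>e | e \<in> Rel G w Y \<inter> ground (comp j) \<and> \<not> spanned j Y e. w e)"
proof -
  let ?R = "Rel G w Y \<inter> ground (comp j)"
  let ?S = "{e \<in> greedy_on Y. spanned j Y e}" and ?T = "{e \<in> ?R. \<not> spanned j Y e}"
  have "(\<Sum>e\<in>?S. 1 * w e) \<le> (\<Sum>e\<in>?T. 1 * w e)"
  proof (rule sum_le_if_level_sums_le)
    show "finite ?S" "finite ?T"
      using finite_greedy_on finite_Rel by auto
    show "0 \<le> w e" if "e \<in> ?S \<union> ?T" for e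
      using that w_nonneg greedy_on_subset_edges Rel_subset_edges by blast
    fix x
    let ?I = "greedy_on Y \<inter> ground (comp j)" and ?X = "{h \<in> ?R. x \<le> w h}"
    have X: "finite ?X" "?X \<subseteq> ground (comp j)" "inj_on w ?X"
      using finite_Rel Rel_subset_edges by (auto intro: inj_on_subset[OF inj_w])
    have "{h \<in> ?X. w h > w e} = {h \<in> Rel G w Y. w h > w e} \<inter> ground (comp j)" if "x \<le> w e" for e
      using that by auto
    then have "{e \<in> ?T. x \<le> w e} = PCore w (comp j) ?X"
      by (auto simp: PCore_def spanned_def)
    moreover have "card {e \<in> ?S. x \<le> w e} \<le> card ((?I - ?X) \<inter> PHull (comp j) ?X)"
      using finite_greedy_on by (intro card_mono[OF _ spanned_level_subset]) auto
    moreover have "\<dots> \<le> card (PCore w (comp j) ?X)"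
      by (rule matroid_card_PHull[OF mat matroid_PCore_basis[OF mat X] greedy_on_comp_indep[OF j]])
    ultimately show "sum (\<lambda>_. 1::real) {e \<in> ?S. x \<le> w e} \<le> sum (\<lambda>_. 1) {e \<in> ?T. x \<le> w e}"
      by simp
  qed
  then show ?thesis
    by simp
qed

lemma sum_over_components:
  fixes \<kappa> :: "nat + nat \<Rightarrow> real"
  assumes "finite S"
  shows "(\<Sum>j\<in>comps. \<kappa> j * (\<Sum>e\<in>S \<inter> ground (comp j). f e)) =
     (\<Sum>e\<in>S. (\<Sum>j | j \<in> comps \<and> e \<in> ground (comp j). \<kappa> j) * f e)"
proof -
  have "(\<Sum>j\<in>comps. \<kappa> j * (\<Sum>e\<in>S \<inter> ground (comp j). f e)) =
      (\<Sum>j\<in>comps. \<Sum>e\<in>S. if e \<in> ground (comp j) then \<kappa> j * f e else 0)"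
    using assms by (auto simp: sum_distrib_left sum.inter_restrict intro!: sum.cong)
  also have "\<dots> = (\<Sum>e\<in>S. \<Sum>j\<in>comps. if e \<in> ground (comp j) then \<kappa> j * f e else 0)"
    by (rule sum.swap)
  also have "\<dots> = (\<Sum>e\<in>S. (\<Sum>j | j \<in> comps \<and> e \<in> ground (comp j). \<kappa> j) * f e)"
    using finite_comps by (auto simp: sum_distrib_right sum.inter_filter intro!: sum.cong)
  finally show ?thesis .
qed

text \<open>An edge of the optimum above level \<open>x\<close> that greedy rejects is blocked by
  greedy edges above \<open>x\<close>, so it lies in their hull in some component \<open>j\<close>.
  The growth property charges such edges to greedy edges outside the optimum, each at most
  \<kappa>\<open>j\<close> times in component \<open>j\<close> and hence at most \<open>k\<close>
  times in total.\<close>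

lemma greedy_approximation:
  fixes \<kappa> :: "nat + nat \<Rightarrow> nat"
  assumes growth: "\<And>j. j \<in> comps \<Longrightarrow> growth_system (\<kappa> j) (comp j)"
    and k: "1 \<le> k" "\<And>e. e \<in> edges G \<Longrightarrow> (\<Sum>j | j \<in> comps \<and> e \<in> ground (comp j). \<kappa> j) \<le> k"
    and opt: "opt \<in> feasible G"
  shows "(\<Sum>e\<in>opt \<inter> delta G Y. w e) \<le> real k * (\<Sum>e\<in>greedy_on Y. w e)"
proof -
  let ?O = "opt \<inter> delta G Y"
  have O: "?O \<in> feasible G"
    using feasible_downward[OF opt] by simp
  have "(\<Sum>e\<in>?O. 1 * w e) \<le> (\<Sum>e\<in>greedy_on Y. real k * w e)"
  proof (rule sum_le_if_level_sums_le)
    show "finite ?O" "finite (greedy_on Y)"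
      using feasible_finite[OF O] finite_greedy_on by auto
    show "0 \<le> w e" if "e \<in> ?O \<union> greedy_on Y" for e
      using that w_nonneg greedy_on_subset_edges feasible_subset_edges[OF O] by blast
    fix x
    define Ox where "Ox = {e \<in> ?O. x \<le> w e}"
    define Mx where "Mx = {e \<in> greedy_on Y. x \<le> w e}"
    have fin: "finite Ox" "finite Mx"
      by (auto simp: Ox_def Mx_def finite_greedy_on intro: finite_subset[OF _ feasible_finite[OF O]])
    have Ox: "Ox \<in> feasible G"
      by (rule feasible_downward[OF O]) (auto simp: Ox_def)
    have Mx: "Mx \<in> feasible G"
      by (rule feasible_downward[OF greedy_on_feasible]) (auto simp: Mx_def)
    define H where
      "H j = (Ox \<inter> ground (comp j) - Mx \<inter> ground (comp j)) \<inter> PHull (comp j) (Mx \<inter> ground (comp j))" for j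
    have "Ox - Mx \<subseteq> (\<Union>j\<in>comps. H j)"
    proof
      fix e assume e: "e \<in> Ox - Mx"
      then have eE: "e \<in> edges G" "fst e \<in> Y" "e \<notin> greedy_on Y" "x \<le> w e"
        by (auto simp: Ox_def Mx_def delta_iff)
      then have "insert e {h \<in> greedy_on Y. w h > w e} \<notin> feasible G"
        using greedy_on_iff[of e Y] by simp
      moreover have "insert e {h \<in> greedy_on Y. w h > w e} \<subseteq> insert e Mx"
        using eE(4) by (auto simp: Mx_def)
      ultimately have "insert e Mx \<notin> feasible G"
        using feasible_downward by metis
      moreover have "insert e Mx \<subseteq> edges G"
        using eE(1) feasible_subset_edges[OF Mx] by simp
      ultimately obtain j where j: "j \<in> comps" "insert e Mx \<inter> ground (comp j) \<notin> indep (comp j)"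
        unfolding feasible_iff by metis
      have MI: "Mx \<inter> ground (comp j) \<in> indep (comp j)"
        using Mx j(1) by (simp add: feasible_iff)
      have eg: "e \<in> ground (comp j)"
      proof (rule ccontr)
        assume "e \<notin> ground (comp j)"
        then have "insert e Mx \<inter> ground (comp j) = Mx \<inter> ground (comp j)"
          by simp
        then show False
          using j(2) MI by simp
      qed
      then have "insert e (Mx \<inter> ground (comp j)) \<notin> indep (comp j)"
        using j(2) by simp
      then have "e \<in> PHull (comp j) (Mx \<inter> ground (comp j))"
        using PHull_if_dependent[OF comp_independence_system[OF j(1)] MI _ eg] by simp
      then show "e \<in> (\<Union>j\<in>comps. H j)"
        using e eg j(1) by (auto simp: H_def)
    qed
    then have "card (Ox - Mx) \<le> card (\<Union>j\<in>comps. H j)"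
      using finite_comps fin by (intro card_mono) (auto simp: H_def)
    also have "\<dots> \<le> (\<Sum>j\<in>comps. card (H j))"
      by (rule card_UN_le[OF finite_comps])
    finally have "real (card (Ox - Mx)) \<le> real (\<Sum>j\<in>comps. card (H j))"
      by (rule of_nat_mono)
    also have "\<dots> \<le> (\<Sum>j\<in>comps. real (\<kappa> j) * (\<Sum>e\<in>(Mx - Ox) \<inter> ground (comp j). 1))"
      unfolding of_nat_sum
    proof (rule sum_mono)
      fix j assume j: "j \<in> comps"
      have eq: "Mx \<inter> ground (comp j) - Ox \<inter> ground (comp j) = (Mx - Ox) \<inter> ground (comp j)"
        by auto
      have "card (H j) \<le> \<kappa> j * card (Mx \<inter> ground (comp j) - Ox \<inter> ground (comp j))"
        unfolding H_def using Ox j by (intro growth_PHull[OF growth]) (auto simp: feasible_iff)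
      then have "real (card (H j)) \<le> real (\<kappa> j * card ((Mx - Ox) \<inter> ground (comp j)))"
        unfolding eq by (rule of_nat_mono)
      then show "real (card (H j)) \<le> real (\<kappa> j) * (\<Sum>e\<in>(Mx - Ox) \<inter> ground (comp j). 1)"
        by simp
    qed
    also have "\<dots> = (\<Sum>e\<in>Mx - Ox. (\<Sum>j | j \<in> comps \<and> e \<in> ground (comp j). real (\<kappa> j)) * 1)"
      using fin by (intro sum_over_components) auto
    also have "\<dots> \<le> (\<Sum>e\<in>Mx - Ox. real k)"
    proof (rule sum_mono)
      fix e assume "e \<in> Mx - Ox"
      then have "e \<in> edges G"
        using feasible_subset_edges[OF Mx] by auto
      then have "real (\<Sum>j | j \<in> comps \<and> e \<in> ground (comp j). \<kappa> j) \<le> real k"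
        using k(2) by (intro of_nat_mono)
      then show "(\<Sum>j | j \<in> comps \<and> e \<in> ground (comp j). real (\<kappa> j)) * 1 \<le> real k"
        by simp
    qed
    finally have le: "real (card (Ox - Mx)) \<le> real k * real (card (Mx - Ox))"
      by (simp add: mult.commute)
    have "card Ox = card (Ox \<inter> Mx) + card (Ox - Mx)" "card Mx = card (Ox \<inter> Mx) + card (Mx - Ox)"
      using card_Int_Diff[OF fin(1), of Mx] card_Int_Diff[OF fin(2), of Ox] by (simp_all add: Int_commute)
    \<comment> \<open>Edges common to both sets are charged to themselves, which costs a factor 1
      and so at most \<open>k\<close>.\<close>
    moreover have "real (card (Ox \<inter> Mx)) \<le> real k * real (card (Ox \<inter> Mx))"
      using k(1) mult_right_mono[of 1 "real k" "real (card (Ox \<inter> Mx))"] by simp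
    ultimately have "real (card Ox) \<le> real k * real (card Mx)"
      using le by (simp add: distrib_left)
    then show "sum (\<lambda>_. 1) {e \<in> ?O. x \<le> w e} \<le> sum (\<lambda>_. real k) {e \<in> greedy_on Y. x \<le> w e}"
      unfolding Ox_def[symmetric] Mx_def[symmetric] by (simp add: mult.commute)
  qed
  then show ?thesis
    by (simp add: sum_distrib_left)
qed

text \<open>The optimum restricted to the sampled agents has expected weight
  \<open>p * sum w opt\<close>, of which greedy collects at least a fraction \<open>1/k\<close>. The
  exchange identity passes to \<open>Rel\<close> with factor \<open>(1 - p) / p\<close>, cancelling
  \<open>p\<close>.\<close>

lemma expected_Rel_weight:
  fixes \<kappa> :: "nat + nat \<Rightarrow> nat"
  assumes growth: "\<And>j. j \<in> comps \<Longrightarrow> growth_system (\<kappa> j) (comp j)"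
    and k: "1 \<le> k" "\<And>e. e \<in> edges G \<Longrightarrow> (\<Sum>j | j \<in> comps \<and> e \<in> ground (comp j). \<kappa> j) \<le> k"
    and opt: "opt \<in> feasible G" and p: "0 < p" "p \<le> 1"
  shows "(1 - p) / real k * sum w opt
    \<le> subset_expectation p (agents G) (\<lambda>Y. sum w (Rel G w Y))"
proof -
  let ?E = "subset_expectation p (agents G)"
  have optE: "opt \<subseteq> edges G" "finite opt"
    using opt feasible_subset_edges feasible_finite by auto
  have "?E (\<lambda>Y. if fst e \<in> Y then w e else 0) = p * w e" if "e \<in> opt" for e
  proof -
    define A where "A = agents G - {fst e}"
    have A: "agents G = insert (fst e) A" "fst e \<notin> A" "finite A"
      using fst_edge[of e] that optE finite_agents by (auto simp: A_def)
    have "(if fst e \<in> S then w e else 0) = 0" if "S \<subseteq> A" for S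
      using that A(2) by auto
    then have "subset_expectation p A (\<lambda>S. if fst e \<in> S then w e else 0) = 0"
      using subset_expectation_const[OF A(3), of p 0] by (simp cong: subset_expectation_cong)
    then show ?thesis
      unfolding A(1) subset_expectation_insert[OF A(3,2)]
      by (simp add: subset_expectation_const[OF A(3)])
  qed
  then have "p * sum w opt = ?E (\<lambda>Y. \<Sum>e\<in>opt. if fst e \<in> Y then w e else 0)"
    unfolding subset_expectation_sum by (simp add: sum_distrib_left)
  also have "\<dots> \<le> ?E (\<lambda>Y. real k * sum w (greedy_on Y))"
  proof (rule subset_expectation_mono)
    fix Y
    have "(\<Sum>e\<in>opt. if fst e \<in> Y then w e else 0) = sum w (opt \<inter> delta G Y)"
      using optE by (simp add: sum.inter_filter[symmetric] delta_def)
         (rule sum.cong, auto)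
    then show "(\<Sum>e\<in>opt. if fst e \<in> Y then w e else 0) \<le> real k * sum w (greedy_on Y)"
      using greedy_approximation[OF growth k opt] by simp
  qed (use p in auto)
  finally have "p * sum w opt \<le> real k * ?E (\<lambda>Y. sum w (greedy_on Y))"
    by (simp add: subset_expectation_mult)
  then have "(1 - p) * (p * sum w opt) \<le> (1 - p) * (real k * ?E (\<lambda>Y. sum w (greedy_on Y)))"
    using p by (intro mult_left_mono) auto
  also have "\<dots> = real k * (p * ?E (\<lambda>Y. sum w (Rel G w Y)))"
    using Rel_greedy_exchange[of p "\<lambda>e _. w e"] by simp
  finally have "p * ((1 - p) * sum w opt) \<le> p * (real k * ?E (\<lambda>Y. sum w (Rel G w Y)))"
    by (simp add: mult_ac)
  then have "(1 - p) * sum w opt \<le> real k * ?E (\<lambda>Y. sum w (Rel G w Y))"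
    using p(1) by (simp only: mult_le_cancel_left_pos)
  then show ?thesis
    using k(1) by (simp add: field_simps)
qed

text \<open>The parameter \<theta> measures the loss per component: it is \<open>(1 - p) / p\<close>
  for growth systems and \<open>1 - p\<close> for matroids. Summing the losses over all components
  costs at most the fraction \<theta>\<open>* k\<close> of the expected weight of
  \<open>Rel\<close>.\<close>

lemma expected_core_weight:
  fixes \<kappa> :: "nat + nat \<Rightarrow> nat"
  assumes growth: "\<And>j. j \<in> comps \<Longrightarrow> growth_system (\<kappa> j) (comp j)"
    and k: "1 \<le> k" "\<And>e. e \<in> edges G \<Longrightarrow> (\<Sum>j | j \<in> comps \<and> e \<in> ground (comp j). \<kappa> j) \<le> k"
    and opt: "opt \<in> feasible G" and p: "0 < p" "p \<le> 1"
    and \<theta>: "0 \<le> \<theta>" "\<theta> * real k \<le> 1"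
    and noncore: "\<And>j. j \<in> comps \<Longrightarrow>
      subset_expectation p (agents G) (\<lambda>Y. \<Sum>e | e \<in> Rel G w Y \<and> spanned j Y e. w e) \<le>
      \<theta> * real (\<kappa> j) *
        subset_expectation p (agents G) (\<lambda>Y. \<Sum>e\<in>Rel G w Y \<inter> ground (comp j). w e)"
  shows "(1 - \<theta> * real k) * ((1 - p) / real k) * sum w opt
    \<le> subset_expectation p (agents G)
        (\<lambda>Y. \<Sum>e | e \<in> Rel G w Y \<and> (\<forall>j\<in>comps. \<not> spanned j Y e). w e)"
proof -
  let ?E = "subset_expectation p (agents G)"
  let ?W = "?E (\<lambda>Y. sum w (Rel G w Y))"
  let ?N = "\<lambda>j Y. \<Sum>e | e \<in> Rel G w Y \<and> spanned j Y e. w e"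
  have wR: "0 \<le> w e" if "e \<in> Rel G w Y" for e Y
    using that w_nonneg Rel_subset_edges by blast
  have "(\<Sum>j\<in>comps. ?E (?N j)) \<le>
      (\<Sum>j\<in>comps. \<theta> * real (\<kappa> j) * ?E (\<lambda>Y. \<Sum>e\<in>Rel G w Y \<inter> ground (comp j). w e))"
    by (intro sum_mono noncore)
  also have "\<dots> = \<theta> * ?E (\<lambda>Y. \<Sum>j\<in>comps. real (\<kappa> j) * (\<Sum>e\<in>Rel G w Y \<inter> ground (comp j). w e))"
    by (simp only: subset_expectation_sum subset_expectation_mult sum_distrib_left[symmetric] mult.assoc)
  also have "\<dots> \<le> \<theta> * ?E (\<lambda>Y. real k * sum w (Rel G w Y))"
  proof (intro mult_left_mono subset_expectation_mono)
    fix Y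
    have "(\<Sum>j | j \<in> comps \<and> e \<in> ground (comp j). real (\<kappa> j)) * w e \<le> real k * w e"
      if "e \<in> Rel G w Y" for e
    proof (rule mult_right_mono[OF _ wR[OF that]])
      have "real (\<Sum>j | j \<in> comps \<and> e \<in> ground (comp j). \<kappa> j) \<le> real k"
        using that Rel_subset_edges k(2) by (intro of_nat_mono) blast
      then show "(\<Sum>j | j \<in> comps \<and> e \<in> ground (comp j). real (\<kappa> j)) \<le> real k"
        by simp
    qed
    then show "(\<Sum>j\<in>comps. real (\<kappa> j) * (\<Sum>e\<in>Rel G w Y \<inter> ground (comp j). w e))
        \<le> real k * sum w (Rel G w Y)"
      unfolding sum_over_components[OF finite_Rel] sum_distrib_left[of "real k"] by (intro sum_mono)
  qed (use p \<theta> in auto)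
  finally have N: "(\<Sum>j\<in>comps. ?E (?N j)) \<le> \<theta> * real k * ?W"
    by (simp add: subset_expectation_mult mult_ac)
  have "(1 - \<theta> * real k) * ((1 - p) / real k * sum w opt) \<le> (1 - \<theta> * real k) * ?W"
    using expected_Rel_weight[OF growth k opt p] \<theta> by (intro mult_left_mono) auto
  also have "\<dots> \<le> ?W - (\<Sum>j\<in>comps. ?E (?N j))"
    using N by (simp add: algebra_simps)
  also have "\<dots> = ?E (\<lambda>Y. sum w (Rel G w Y) - (\<Sum>j\<in>comps. ?N j Y))"
    by (simp add: subset_expectation_diff subset_expectation_sum)
  also have "\<dots> \<le> ?E (\<lambda>Y. \<Sum>e | e \<in> Rel G w Y \<and> (\<forall>j\<in>comps. \<not> spanned j Y e). w e)"
  proof (rule subset_expectation_mono)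
    fix Y
    \<comment> \<open>Union bound: an edge outside the core is counted in the loss of at least one
      component.\<close>
    have "w e \<le> (if \<forall>j\<in>comps. \<not> spanned j Y e then w e else 0) +
        (\<Sum>j\<in>comps. if spanned j Y e then w e else 0)" if "e \<in> Rel G w Y" for e
    proof (cases "\<forall>j\<in>comps. \<not> spanned j Y e")
      case True
      then show ?thesis
        using wR[OF that] by (simp add: sum_nonneg)
    next
      case False
      then obtain j where "j \<in> comps" "spanned j Y e"
        by auto
      then have "w e \<le> (\<Sum>j\<in>comps. if spanned j Y e then w e else 0)"
        using member_le_sum[of j comps "\<lambda>j. if spanned j Y e then w e else 0"] wR[OF that]
          finite_comps by simp
      then show ?thesis
        using False by simp
    qed
    then have "sum w (Rel G w Y) \<le> (\<Sum>e\<in>Rel G w Y. (if \<forall>j\<in>comps. \<not> spanned j Y e then w e else 0) +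
        (\<Sum>j\<in>comps. if spanned j Y e then w e else 0))"
      by (intro sum_mono)
    also have "\<dots> = (\<Sum>e | e \<in> Rel G w Y \<and> (\<forall>j\<in>comps. \<not> spanned j Y e). w e) + (\<Sum>j\<in>comps. ?N j Y)"
      by (simp add: sum.distrib sum.inter_filter finite_Rel
          sum.swap[where A = "Rel G w Y" and B = comps])
    finally show "sum w (Rel G w Y) - (\<Sum>j\<in>comps. ?N j Y)
        \<le> (\<Sum>e | e \<in> Rel G w Y \<and> (\<forall>j\<in>comps. \<not> spanned j Y e). w e)"
      by simp
  qed (use p in auto)
  finally show ?thesis
    by (simp add: mult_ac)
qed

text \<open>The exchange identity applies because \<open>spanned\<close> depends on \<open>Y\<close>
  only through the edges of \<open>Rel\<close> heavier than \<open>e\<close>.\<close>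

lemma spanned_exchange:
  "p * subset_expectation p (agents G) (\<lambda>Y. \<Sum>e | e \<in> Rel G w Y \<and> spanned j Y e. w e) =
   (1 - p) * subset_expectation p (agents G) (\<lambda>Y. \<Sum>e | e \<in> greedy_on Y \<and> spanned j Y e. w e)"
  using Rel_greedy_exchange[of p
      "\<lambda>e H. if e \<in> PHull (comp j) (H \<inter> ground (comp j)) then w e else 0"]
  by (simp add: sum.inter_filter finite_Rel finite_greedy_on spanned_def)

lemma expected_core_weight_growth:
  fixes \<kappa> :: "nat + nat \<Rightarrow> nat"
  assumes growth: "\<And>j. j \<in> comps \<Longrightarrow> growth_system (\<kappa> j) (comp j)"
    and k: "1 \<le> k" "\<And>e. e \<in> edges G \<Longrightarrow> (\<Sum>j | j \<in> comps \<and> e \<in> ground (comp j). \<kappa> j) \<le> k"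
    and opt: "opt \<in> feasible G" and p: "0 < p" "p \<le> 1" "(1 - p) / p * real k \<le> 1"
  shows "(1 - (1 - p) / p * real k) * ((1 - p) / real k) * sum w opt
    \<le> subset_expectation p (agents G)
        (\<lambda>Y. \<Sum>e | e \<in> Rel G w Y \<and> (\<forall>j\<in>comps. \<not> spanned j Y e). w e)"
proof (rule expected_core_weight[OF growth k opt p(1,2) _ p(3)])
  let ?E = "subset_expectation p (agents G)"
  fix j assume j: "j \<in> comps"
  let ?N = "?E (\<lambda>Y. \<Sum>e | e \<in> Rel G w Y \<and> spanned j Y e. w e)"
    and ?W = "?E (\<lambda>Y. \<Sum>e\<in>Rel G w Y \<inter> ground (comp j). w e)"
  have "?E (\<lambda>Y. \<Sum>e | e \<in> greedy_on Y \<and> spanned j Y e. w e) \<le> real (\<kappa> j) * ?W"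
    unfolding subset_expectation_mult[symmetric]
    using p greedy_spanned_growth[OF j growth[OF j]] by (intro subset_expectation_mono) auto
  then have "p * ?N \<le> (1 - p) * (real (\<kappa> j) * ?W)"
    unfolding spanned_exchange using p by (intro mult_left_mono) auto
  then show "?N \<le> (1 - p) / p * real (\<kappa> j) * ?W"
    using p(1) by (simp add: field_simps)
qed (use p in auto)

text \<open>Here the spanned greedy weight is bounded by the unspanned weight of \<open>Rel\<close>,
  that is, by its total weight in the component minus the loss itself.\<close>

lemma expected_core_weight_matroid:
  assumes mat: "\<And>j. j \<in> comps \<Longrightarrow> matroid (comp j)"
    and k: "1 \<le> k" "\<And>e. e \<in> edges G \<Longrightarrow> card {j \<in> comps. e \<in> ground (comp j)} \<le> k"
    and opt: "opt \<in> feasible G" and p: "0 < p" "p \<le> 1" "(1 - p) * real k \<le> 1"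
  shows "(1 - (1 - p) * real k) * ((1 - p) / real k) * sum w opt
    \<le> subset_expectation p (agents G)
        (\<lambda>Y. \<Sum>e | e \<in> Rel G w Y \<and> (\<forall>j\<in>comps. \<not> spanned j Y e). w e)"
proof (rule expected_core_weight[where \<kappa> = "\<lambda>_. 1", OF _ k(1) _ opt p(1,2) _ p(3)])
  let ?E = "subset_expectation p (agents G)"
  fix j assume j: "j \<in> comps"
  show "growth_system 1 (comp j)"
    by (rule matroid_growth_system[OF mat[OF j]])
  let ?N = "\<lambda>Y. \<Sum>e | e \<in> Rel G w Y \<and> spanned j Y e. w e"
    and ?W = "\<lambda>Y. \<Sum>e\<in>Rel G w Y \<inter> ground (comp j). w e"
  have "(\<Sum>e | e \<in> greedy_on Y \<and> spanned j Y e. w e) \<le> ?W Y - ?N Y" for Y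
  proof -
    have "?W Y = (\<Sum>e | e \<in> Rel G w Y \<inter> ground (comp j) \<and> \<not> spanned j Y e. w e) + ?N Y"
      using finite_Rel spanned_ground
      by (subst sum.union_disjoint[symmetric]) (auto intro!: sum.cong)
    then show ?thesis
      using greedy_spanned_matroid[OF j mat[OF j], of Y] by simp
  qed
  then have "?E (\<lambda>Y. \<Sum>e | e \<in> greedy_on Y \<and> spanned j Y e. w e) \<le> ?E ?W - ?E ?N"
    unfolding subset_expectation_diff[symmetric] using p by (intro subset_expectation_mono) auto
  then have "p * ?E ?N \<le> (1 - p) * (?E ?W - ?E ?N)"
    unfolding spanned_exchange using p by (intro mult_left_mono) auto
  \<comment> \<open>The loss occurs on both sides with coefficients \<open>p\<close> and
    \<open>-(1 - p)\<close>. Collecting them gives coefficient 1 and thus the factor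
    \<open>1 - p\<close> rather than \<open>(1 - p) / p\<close>.\<close>
  then show "?E ?N \<le> (1 - p) * real 1 * ?E ?W"
    by (simp add: algebra_simps)
qed (use p k in auto)

end

section \<open>Runs of the algorithm\<close>

lemma Hull_mono: "X \<subseteq> X' \<Longrightarrow> Hull M F X \<subseteq> Hull M F X'"
  unfolding Hull_def by (intro UN_mono PHull_mono) auto

context secretary_instance
begin

lemma comps_iff: "Inl j \<in> comps \<longleftrightarrow> j \<in> {1..num_A G}" "Inr j \<in> comps \<longleftrightarrow> j \<in> {1..num_B G}"
  unfolding comps_def by blast+

abbreviation Hull_A :: "'a set \<Rightarrow> 'a set" where
  "Hull_A \<equiv> Hull (num_A G) (sys_A G)"

lemma Hull_A_image_mono:
  "X \<subseteq> X' \<Longrightarrow> a \<in> Hull_A (fst ` X) \<Longrightarrow> a \<in> Hull_A (fst ` X')"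
  by (rule subsetD[OF Hull_mono[OF image_mono]])

lemma sys_A_independence_system: "j \<in> {1..num_A G} \<Longrightarrow> independence_system (sys_A G j)"
  using wf unfolding wf_instance_def by auto

text \<open>A hull contains the set it is formed from, so an agent outside it is not yet matched and
  adding \<open>e\<close> keeps one edge per agent. The agent set stays independent because a
  dependency would put the agent into the hull.\<close>

lemma indep_A_insert:
  assumes I: "I \<in> feasible G" and e: "e \<in> edges G" "fst e \<notin> Hull_A (fst ` I)"
  shows "insert e I \<in> indep (combination (num_A G) (edge_sys_A G))"
proof -
  have "insert e I \<inter> ground (edge_sys_A G j) \<in> indep (edge_sys_A G j)" if j: "j \<in> {1..num_A G}" for j
  proof -
    have Ij: "I \<inter> ground (edge_sys_A G j) \<in> indep (edge_sys_A G j)"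
      using I j by (simp add: feasible_def indep_combination del: atLeastAtMost_iff)
    show ?thesis
    proof (cases "fst e \<in> ground (sys_A G j)")
      case False
      then have "insert e I \<inter> ground (edge_sys_A G j) = I \<inter> ground (edge_sys_A G j)"
        by (auto simp: ground_edge_sys)
      then show ?thesis
        using Ij by simp
    next
      case True
      let ?I = "I \<inter> ground (edge_sys_A G j)"
      have nPHull: "fst e \<notin> PHull (sys_A G j) (fst ` I \<inter> ground (sys_A G j))"
        using e(2) j unfolding Hull_def by (metis UN_I)
      have eq: "insert e I \<inter> ground (edge_sys_A G j) = insert e ?I"
        using True e(1) by (auto simp: ground_edge_sys)
      have sub: "fst ` ?I \<subseteq> fst ` I \<inter> ground (sys_A G j)"
        by (auto simp: ground_edge_sys)
      have II: "?I \<subseteq> ground (edge_sys_A G j)" "inj_on fst ?I" "fst ` ?I \<in> indep (sys_A G j)"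
        using Ij by (simp_all add: indep_edge_sys)
      have "insert (fst e) (fst ` ?I) \<in> indep (sys_A G j)"
        using PHull_if_dependent[OF sys_A_independence_system[OF j] II(3) sub True] nPHull by metis
      moreover have "fst e \<notin> fst ` ?I"
        using nPHull sub unfolding PHull_def by blast
      ultimately have "insert e ?I \<in> indep (edge_sys_A G j)"
        using II True e(1) unfolding indep_edge_sys by (auto simp: ground_edge_sys)
      then show ?thesis
        by (simp add: eq)
    qed
  qed
  moreover have "insert e I \<subseteq> edges G"
    using feasible_subset_edges[OF I] e(1) by simp
  ultimately show ?thesis
    by (simp add: indep_combination)
qed

lemma indep_B_downward:
  assumes I: "I \<in> indep (combination (num_B G) (edge_sys_B G))" and "J \<subseteq> I"
  shows "J \<in> indep (combination (num_B G) (edge_sys_B G))"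
proof -
  have "J \<inter> ground (edge_sys_B G j) \<in> indep (edge_sys_B G j)" if j: "j \<in> {1..num_B G}" for j
  proof (rule indep_downward)
    show "independence_system (edge_sys_B G j)"
      using comp_independence_system[of "Inr j"] j by (simp add: comps_iff comp_def)
    show "I \<inter> ground (edge_sys_B G j) \<in> indep (edge_sys_B G j)"
      using I j by (simp add: indep_combination del: atLeastAtMost_iff)
  qed (use assms(2) in auto)
  then show ?thesis
    using I assms(2) by (auto simp: indep_combination simp del: atLeastAtMost_iff)
qed

text \<open>The core is defined on edges, the hull tested by the algorithm on agents. Since
  \<open>Rel\<close> has at most one edge per agent, a circuit of agents through the agent of
  \<open>e\<close> lifts to edges of \<open>Rel\<close>, and \<open>e\<close> would be spanned in
  the corresponding edge system.\<close>

lemma core_agent_not_in_Hull: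
  assumes e: "e \<in> Rel G w Y" and core: "\<And>j. j \<in> comps \<Longrightarrow> \<not> spanned j Y e"
  shows "fst e \<notin> Hull_A (fst ` {g \<in> Rel G w Y. w g > w e})"
proof
  let ?H = "{g \<in> Rel G w Y. w g > w e}"
  assume "fst e \<in> Hull_A (fst ` ?H)"
  then obtain j where j: "j \<in> {1..num_A G}"
      and eP: "fst e \<in> PHull (sys_A G j) (fst ` ?H \<inter> ground (sys_A G j))"
    unfolding Hull_def by blast
  have "fst e \<notin> fst ` ?H"
  proof
    assume "fst e \<in> fst ` ?H"
    then obtain g where "fst e = fst g" "g \<in> Rel G w Y" "w g > w e"
      by blast
    then show False
      using inj_onD[OF inj_fst_Rel[of Y], of e g] e by simp
  qed
  then have "fst e \<notin> fst ` ?H \<inter> ground (sys_A G j)"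
    by simp
  then obtain C where C: "circuit (sys_A G j) C" "fst e \<in> C"
      "C - {fst e} \<subseteq> fst ` ?H \<inter> ground (sys_A G j)"
      "C - {fst e} \<in> indep (sys_A G j)" "fst e \<in> ground (sys_A G j)"
    by (rule PHull_circuit[OF eP])
  define J where "J = {g \<in> ?H. fst g \<in> C - {fst e}}"
  have eE: "e \<in> edges G"
    using e Rel_subset_edges by blast
  have JH: "J \<subseteq> ?H"
    by (auto simp: J_def)
  have img: "fst ` J = C - {fst e}"
    using C(3) by (auto simp: J_def)
  have Jg: "J \<subseteq> ground (edge_sys_A G j)"
  proof
    fix g assume "g \<in> J"
    then have "g \<in> Rel G w Y" "fst g \<in> C - {fst e}"
      by (simp_all add: J_def)
    then show "g \<in> ground (edge_sys_A G j)"
      using subsetD[OF Rel_subset_edges] subsetD[OF C(3)] by (simp add: ground_edge_sys)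
  qed
  have "inj_on fst J"
    using JH by (intro inj_on_subset[OF inj_fst_Rel]) auto
  then have "J \<in> indep (edge_sys_A G j)"
    using Jg img C(4) by (simp add: indep_edge_sys)
  moreover have "fst ` insert e J = C"
    using img C(2) by auto
  then have "insert e J \<notin> indep (edge_sys_A G j)"
    using circuit_dependent[OF C(1)] by (simp add: indep_edge_sys)
  moreover have "e \<in> ground (edge_sys_A G j)"
    using eE C(5) by (simp add: ground_edge_sys)
  moreover have "independence_system (edge_sys_A G j)"
    using comp_independence_system[of "Inl j"] j by (simp add: comps_iff comp_def)
  ultimately have "e \<in> PHull (edge_sys_A G j) (?H \<inter> ground (edge_sys_A G j))"
    using JH Jg by (intro PHull_if_dependent[of _ J]) auto
  then have "spanned (Inl j) Y e"
    by (simp add: spanned_def comp_def)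
  moreover have "Inl j \<in> comps"
    using j by (simp add: comps_iff)
  ultimately show False
    using core by metis
qed

lemma core_edge_in_Core:
  assumes e: "e \<in> Rel G w Y" and core: "\<And>j. j \<in> comps \<Longrightarrow> \<not> spanned j Y e"
  shows "e \<in> Core w (num_B G) (edge_sys_B G) (Rel G w Y)"
proof -
  have "e \<in> (Rel G w Y - ground (edge_sys_B G j)) \<union>
      PCore w (edge_sys_B G j) (Rel G w Y \<inter> ground (edge_sys_B G j))"
    if "j \<in> {1..num_B G}" for j
  proof -
    have "\<not> spanned (Inr j) Y e"
      using that by (intro core) (simp add: comps_iff)
    moreover have "{f \<in> Rel G w Y \<inter> ground (edge_sys_B G j). w f > w e} =
        {f \<in> Rel G w Y. w f > w e} \<inter> ground (edge_sys_B G j)"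
      by auto
    ultimately show ?thesis
      using e by (auto simp: spanned_def comp_def PCore_def)
  qed
  then show ?thesis
    using e by (simp add: Core_def)
qed

section \<open>The algorithm run on a fixed order of revelation\<close>

definition tops :: "'a set \<Rightarrow> 'a list \<Rightarrow> ('a \<times> 'b) list" where
  "tops Y \<pi> = List.map_filter (\<lambda>a. toprel G w a Y) \<pi>"

lemma tops_simps [simp]:
  "tops Y [] = []" "tops Y (\<pi> @ \<rho>) = tops Y \<pi> @ tops Y \<rho>"
  "tops Y (a # \<pi>) = (case toprel G w a Y of None \<Rightarrow> tops Y \<pi> | Some f \<Rightarrow> f # tops Y \<pi>)"
  by (induction \<pi>) (auto simp: tops_def split: option.split)

lemma set_tops: "set (tops Y \<pi>) = Rel G w Y \<inter> delta G (set \<pi>)"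
proof (induction \<pi>)
  case (Cons a \<pi>)
  have "Rel G w Y \<inter> delta G (set (a # \<pi>)) =
      {f. toprel G w a Y = Some f} \<union> (Rel G w Y \<inter> delta G (set \<pi>))"
    by (auto simp: toprel_Rel delta_iff dest: subsetD[OF Rel_subset_edges])
  then show ?case
    using Cons by (auto split: option.split)
qed (simp add: delta_def)

lemma distinct_tops: "distinct \<pi> \<Longrightarrow> distinct (tops Y \<pi>)"
proof (induction \<pi>)
  case (Cons a \<pi>)
  have "f \<notin> set (tops Y \<pi>)" if "toprel G w a Y = Some f" for f
    using that Cons.prems by (simp add: set_tops toprel_Rel delta_iff)
  then show ?case
    using Cons by (auto split: option.split)
qed simp

definition run ::
  "('r, 'a \<times> 'b) online_alg \<Rightarrow> 'r \<Rightarrow> 'a set \<Rightarrow> ('a \<times> 'b) set \<Rightarrow> ('a \<Rightarrow> 'a \<times> 'b \<Rightarrow> bool)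
    \<Rightarrow> 'a set \<Rightarrow> 'a list \<Rightarrow> ('a, 'b) fos_state" where
  "run alg r Y E0 ok S \<pi> = foldl (\<lambda>s a. fos_reveal G w alg r Y E0 (ok a) s a)
     \<lparr>unrevealed = S, shown = [], accepted = {}\<rparr> \<pi>"

lemma run_Nil: "run alg r Y E0 ok S [] = \<lparr>unrevealed = S, shown = [], accepted = {}\<rparr>"
  by (simp add: run_def)

lemma run_snoc:
  "run alg r Y E0 ok S (\<pi> @ [a]) = fos_reveal G w alg r Y E0 (ok a) (run alg r Y E0 ok S \<pi>) a"
  by (simp add: run_def)

lemma unrevealed_run: "unrevealed (run alg r Y E0 ok S \<pi>) = S - set \<pi>"
  by (induction \<pi> rule: rev_induct)
     (auto simp: run_Nil run_snoc fos_reveal_def split: option.split)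

text \<open>What is presented to the online algorithm depends on the order of revelation alone, not
  on the random bits or on earlier acceptances.\<close>

lemma shown_run: "shown (run alg r Y E0 ok S \<pi>) = tops Y \<pi>"
  by (induction \<pi> rule: rev_induct) (auto simp: run_Nil run_snoc fos_reveal_def split: option.split)

lemma accepted_run_snoc:
  "accepted (run alg r Y E0 ok S (\<pi> @ [a])) = (case toprel G w a Y of
      None \<Rightarrow> accepted (run alg r Y E0 ok S \<pi>)
    | Some f \<Rightarrow>
        if ok a f \<and> selects_last alg r w E0 (tops Y \<pi> @ [f])
          \<and> insert f (accepted (run alg r Y E0 ok S \<pi>)) \<in> feasible G
        then insert f (accepted (run alg r Y E0 ok S \<pi>)) else accepted (run alg r Y E0 ok S \<pi>))"
  by (simp add: run_snoc fos_reveal_def shown_run split: option.split)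

lemma accepted_run_mono:
  "accepted (run alg r Y E0 ok S \<pi>) \<subseteq> accepted (run alg r Y E0 ok S (\<pi> @ \<rho>))"
proof (induction \<rho> rule: rev_induct)
  case (snoc a \<rho>)
  then show ?case
    unfolding append_assoc[symmetric] accepted_run_snoc by (auto split: option.split)
qed simp

lemma accepted_run_feasible: "accepted (run alg r Y E0 ok S \<pi>) \<in> feasible G"
proof (induction \<pi> rule: rev_induct)
  case Nil
  then show ?case
    by (simp add: run_Nil empty_feasible)
next
  case (snoc a \<pi>)
  then show ?case
    by (simp add: accepted_run_snoc split: option.split)
qed

lemma accepted_runD:
  assumes "f \<in> accepted (run alg r Y E0 ok S \<pi>)"
  shows "f \<in> Rel G w Y \<and> fst f \<in> set \<pi> \<and> ok (fst f) f"
  using assms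
proof (induction \<pi> rule: rev_induct)
  case Nil
  then show ?case
    by (simp add: run_Nil)
next
  case (snoc a \<pi>)
  then show ?case
    by (auto simp: accepted_run_snoc toprel_Rel split: option.splits if_splits)
qed

text \<open>The list \<open>zs\<close> stands for edges presented later. They do not affect earlier
  decisions, and allowing them makes it possible to compare with a run over the whole true ground
  set outside the sample.\<close>

lemma accepted_run_selected:
  "accepted (run alg r Y E0 ok S \<pi>) \<subseteq> selected alg r w E0 (tops Y \<pi> @ zs)"
proof (induction \<pi> arbitrary: zs rule: rev_induct)
  case Nil
  then show ?case
    by (simp add: run_Nil)
next
  case (snoc a \<pi>)
  have "f \<in> selected alg r w E0 (tops Y \<pi> @ f # zs)"
    if "selects_last alg r w E0 (tops Y \<pi> @ [f])" for f
    unfolding selected_def using that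
    by (intro CollectI exI[of _ "length (tops Y \<pi>)"]) (simp add: nth_append)
  then show ?case
    using snoc[of zs] snoc[of "the (toprel G w a Y) # zs"]
    by (auto simp: accepted_run_snoc split: option.splits if_splits)
qed

lemma selected_selects_last:
  assumes "distinct (xs @ e # ys)" "e \<in> selected alg r w E0 (xs @ e # ys)"
  shows "selects_last alg r w E0 (xs @ [e])"
proof -
  obtain i where i: "i < length (xs @ e # ys)" "(xs @ e # ys) ! i = e"
      "selects_last alg r w E0 (take (Suc i) (xs @ e # ys))"
    using assms(2) unfolding selected_def by auto
  have "i = length xs"
    using assms(1) i(1,2) nth_eq_iff_index_eq[of "xs @ e # ys" i "length xs"]
    by (simp add: nth_append)
  then show ?thesis
    using i(3) by simp
qed

text \<open>\<open>thr\<close> is the weight test of the round in which an agent is revealed; \<open>H j\<close> is the hull used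
  in round \<open>j\<close>, and no test applies in the last round.\<close>

definition thr ::
  "('a \<times> 'b) list \<Rightarrow> (nat \<Rightarrow> 'a set) \<Rightarrow> 'a \<Rightarrow> 'a \<times> 'b \<Rightarrow> bool" where
  "thr es H a f \<longleftrightarrow> (\<forall>j<length es. a \<in> H j \<and> (\<forall>i<j. a \<notin> H i) \<longrightarrow> w f > w (es ! j))"

definition hull_order :: "'a set \<Rightarrow> (nat \<Rightarrow> 'a set) \<Rightarrow> nat \<Rightarrow> 'a list pmf" where
  "hull_order S H m = foldl (\<lambda>D j. bind_pmf D
      (\<lambda>\<pi>. map_pmf ((@) \<pi>) (pmf_of_set (permutations_of_set ((S - set \<pi>) \<inter> H j)))))
      (return_pmf []) [0..<m]"

definition reveal_order :: "'a set \<Rightarrow> (nat \<Rightarrow> 'a set) \<Rightarrow> nat \<Rightarrow> 'a list pmf" where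
  "reveal_order S H m = bind_pmf (hull_order S H m)
      (\<lambda>\<pi>. map_pmf ((@) \<pi>) (pmf_of_set (permutations_of_set (S - set \<pi>))))"

lemma hull_order_Suc:
  "hull_order S H (Suc m) = bind_pmf (hull_order S H m)
      (\<lambda>\<pi>. map_pmf ((@) \<pi>) (pmf_of_set (permutations_of_set ((S - set \<pi>) \<inter> H m))))"
  by (simp add: hull_order_def)

lemma set_pmf_permutations:
  assumes "finite S"
  shows "set_pmf (pmf_of_set (permutations_of_set S)) = permutations_of_set S"
  using assms by (intro set_pmf_of_set) auto

text \<open>All that is retained of the random order: agents come sorted by the first of the
  \<open>m\<close> hulls that contains them, with agents in no such hull at the end. The order
  within a round is left open.\<close>

definition hull_sorted :: "(nat \<Rightarrow> 'a set) \<Rightarrow> nat \<Rightarrow> 'a list \<Rightarrow> bool" where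
  "hull_sorted H m = sorted_wrt (\<lambda>b a. \<forall>j<m. a \<in> H j \<longrightarrow> (\<exists>i\<le>j. b \<in> H i))"

lemma set_pmf_hull_order:
  assumes "finite S" "\<pi> \<in> set_pmf (hull_order S H n)"
  shows "set \<pi> = S \<inter> (\<Union>i<n. H i) \<and> distinct \<pi> \<and> hull_sorted H m \<pi>"
  using assms(2)
proof (induction n arbitrary: \<pi>)
  case 0
  then show ?case
    by (simp add: hull_order_def hull_sorted_def)
next
  case (Suc n)
  then obtain \<pi>' \<rho> where \<pi>: "\<pi> = \<pi>' @ \<rho>" "\<pi>' \<in> set_pmf (hull_order S H n)"
      and \<rho>: "\<rho> \<in> permutations_of_set ((S - set \<pi>') \<inter> H n)"
    using assms(1) by (auto simp: hull_order_Suc set_pmf_permutations)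
  have IH: "set \<pi>' = S \<inter> (\<Union>i<n. H i)" "distinct \<pi>'" "hull_sorted H m \<pi>'"
    using Suc.IH[OF \<pi>(2)] by simp_all
  have \<rho>': "set \<rho> = (S - set \<pi>') \<inter> H n" "distinct \<rho>"
    using \<rho> by (auto simp: permutations_of_set_def)
  \<comment> \<open>An agent drawn in round \<open>n\<close> lies in no earlier hull, since it would
    already be listed in \<pi>\<open>'\<close>.\<close>
  have late: "n \<le> j" if "a \<in> set \<rho>" "a \<in> H j" for a j
    using that \<rho>'(1) IH(1) by (auto simp: not_less[symmetric])
  have "hull_sorted H m \<rho>"
    unfolding hull_sorted_def sorted_wrt_iff_nth_less using late \<rho>'(1)
    by (metis IntD2 nth_mem order.strict_trans)
  moreover have "\<forall>b\<in>set \<pi>'. \<forall>a\<in>set \<rho>. \<forall>j<m. a \<in> H j \<longrightarrow> (\<exists>i\<le>j. b \<in> H i)"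
    using late IH(1) by (auto intro: less_imp_le order.trans) (meson lessThan_iff less_imp_le order.trans)
  ultimately have "hull_sorted H m \<pi>"
    using IH(3) by (simp add: hull_sorted_def sorted_wrt_append \<pi>(1))
  moreover have "set \<pi> = S \<inter> (\<Union>i<Suc n. H i)"
    using IH(1) \<rho>'(1) by (auto simp: \<pi>(1) less_Suc_eq)
  ultimately show ?case
    using IH(2) \<rho>' by (auto simp: \<pi>(1))
qed

lemma set_pmf_reveal_order:
  assumes "finite S" "\<pi> \<in> set_pmf (reveal_order S H m)"
  shows "set \<pi> = S" "distinct \<pi>" "hull_sorted H m \<pi>"
proof -
  obtain \<pi>' \<rho> where \<pi>: "\<pi> = \<pi>' @ \<rho>" "\<pi>' \<in> set_pmf (hull_order S H m)"
      and \<rho>: "\<rho> \<in> permutations_of_set (S - set \<pi>')"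
    using assms by (auto simp: reveal_order_def set_pmf_permutations)
  have \<pi>': "set \<pi>' = S \<inter> (\<Union>i<m. H i)" "distinct \<pi>'" "hull_sorted H m \<pi>'"
    using set_pmf_hull_order[OF assms(1) \<pi>(2)] by simp_all
  have \<rho>': "set \<rho> = S - set \<pi>'" "distinct \<rho>"
    using \<rho> by (auto simp: permutations_of_set_def)
  show "set \<pi> = S" "distinct \<pi>"
    using \<pi>' \<rho>' by (auto simp: \<pi>(1))
  have "a \<notin> H j" if "a \<in> set \<rho>" "j < m" for a j
    using that \<pi>'(1) \<rho>'(1) by auto
  then have "sorted_wrt (\<lambda>b a. \<forall>j<m. a \<in> H j \<longrightarrow> (\<exists>i\<le>j. b \<in> H i)) \<rho>"
    "\<forall>b\<in>set \<pi>'. \<forall>a\<in>set \<rho>. \<forall>j<m. a \<in> H j \<longrightarrow> (\<exists>i\<le>j. b \<in> H i)"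
    by (auto simp: sorted_wrt_iff_nth_less)
  then show "hull_sorted H m \<pi>"
    using \<pi>'(3) by (simp add: hull_sorted_def sorted_wrt_append \<pi>(1))
qed

lemma fos_round_run:
  assumes "finite S" and ok': "\<And>a. a \<in> (S - set \<pi>) \<inter> Q \<Longrightarrow> ok a = ok'"
  shows "fos_round G w alg r Y E0 ok' ((S - set \<pi>) \<inter> Q) (run alg r Y E0 ok S \<pi>) =
    map_pmf (\<lambda>\<rho>. run alg r Y E0 ok S (\<pi> @ \<rho>))
      (pmf_of_set (permutations_of_set ((S - set \<pi>) \<inter> Q)))"
  unfolding fos_round_def
proof (rule map_pmf_cong[OF refl])
  fix \<rho> assume "\<rho> \<in> set_pmf (pmf_of_set (permutations_of_set ((S - set \<pi>) \<inter> Q)))"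
  then have "\<rho> \<in> permutations_of_set ((S - set \<pi>) \<inter> Q)"
    using assms(1) by (simp add: set_pmf_permutations)
  then have "set \<rho> = (S - set \<pi>) \<inter> Q"
    by (simp add: permutations_of_set_def)
  then show "foldl (fos_reveal G w alg r Y E0 ok') (run alg r Y E0 ok S \<pi>) \<rho> =
      run alg r Y E0 ok S (\<pi> @ \<rho>)"
    unfolding run_def foldl_append by (intro foldl_cong) (simp_all add: ok')
qed

text \<open>The order in which the agents are revealed depends on the hulls only. Hence it can be drawn
  first, independently of the random bits of the online algorithm.\<close>

lemma free_order_eq_run:
  fixes alg :: "('r, 'a \<times> 'b) online_alg" and r Y E0
    and es :: "('a \<times> 'b) list" and H :: "nat \<Rightarrow> 'a set"
  assumes S: "finite S"
  defines "hull_round \<equiv> \<lambda>j s. fos_round G w alg r Y E0 (\<lambda>f. w f > w (es ! j)) (unrevealed s \<inter> H j) s"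
    and "last_round \<equiv> \<lambda>s. fos_round G w alg r Y E0 (\<lambda>_. True) (unrevealed s) s"
  shows "bind_pmf (foldl (\<lambda>D j. bind_pmf D (hull_round j))
        (return_pmf \<lparr>unrevealed = S, shown = [], accepted = {}\<rparr>) [0..<length es]) last_round =
    map_pmf (run alg r Y E0 (thr es H) S) (reveal_order S H (length es))"
proof -
  let ?run = "run alg r Y E0 (thr es H) S" and ?m = "length es"
  have hulls: "foldl (\<lambda>D j. bind_pmf D (hull_round j))
      (return_pmf \<lparr>unrevealed = S, shown = [], accepted = {}\<rparr>) [0..<n] =
      map_pmf ?run (hull_order S H n)" if "n \<le> ?m" for n
    using that
  proof (induction n)
    case 0
    then show ?case
      by (simp add: hull_order_def run_Nil)
  next
    case (Suc n)
    have "hull_round n (?run \<pi>) = map_pmf (\<lambda>\<rho>. ?run (\<pi> @ \<rho>))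
        (pmf_of_set (permutations_of_set ((S - set \<pi>) \<inter> H n)))"
      if \<pi>: "\<pi> \<in> set_pmf (hull_order S H n)" for \<pi>
      unfolding hull_round_def unrevealed_run
    proof (rule fos_round_run[OF S])
      fix a assume a: "a \<in> (S - set \<pi>) \<inter> H n"
      then have "a \<notin> H i" if "i < n" for i
        using that set_pmf_hull_order[OF S \<pi>] by auto
      \<comment> \<open>Round \<open>n\<close> is the first one whose hull contains
        \<open>a\<close>, so \<open>thr\<close> reduces to the weight test of this round.\<close>
      then have "n < ?m \<and> a \<in> H j \<and> (\<forall>i<j. a \<notin> H i) \<longleftrightarrow> n < ?m \<and> j = n" for j
        using a by (metis IntD2 nat_neq_iff)
      then show "thr es H a = (\<lambda>f. w f > w (es ! n))"
        using Suc.prems by (auto simp: thr_def fun_eq_iff)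
    qed
    then show ?case
      using Suc by (simp add: hull_order_Suc bind_map_pmf map_bind_pmf map_pmf_comp cong: bind_pmf_cong)
  qed
  have "last_round (?run \<pi>) = map_pmf (\<lambda>\<rho>. ?run (\<pi> @ \<rho>)) (pmf_of_set (permutations_of_set (S - set \<pi>)))"
    if \<pi>: "\<pi> \<in> set_pmf (hull_order S H ?m)" for \<pi>
  proof -
    have "fos_round G w alg r Y E0 (\<lambda>_. True) ((S - set \<pi>) \<inter> UNIV) (?run \<pi>) =
        map_pmf (\<lambda>\<rho>. ?run (\<pi> @ \<rho>)) (pmf_of_set (permutations_of_set ((S - set \<pi>) \<inter> UNIV)))"
    proof (rule fos_round_run[OF S])
      fix a assume "a \<in> (S - set \<pi>) \<inter> UNIV"
      then have "a \<notin> H i" if "i < ?m" for i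
        using that set_pmf_hull_order[OF S \<pi>] by auto
      then show "thr es H a = (\<lambda>_. True)"
        by (auto simp: thr_def fun_eq_iff)
    qed
    then show ?thesis
      by (simp add: last_round_def unrevealed_run)
  qed
  then show ?thesis
    unfolding hulls[OF order_refl]
    by (simp add: reveal_order_def bind_map_pmf map_bind_pmf map_pmf_comp cong: bind_pmf_cong)
qed

section \<open>Blocking of agents and acceptance of core edges\<close>

definition E1_list :: "'a set \<Rightarrow> 'a set \<Rightarrow> ('a \<times> 'b) list" where
  "E1_list Y S1 = decreasing_list w (Rel G w Y \<inter> delta G S1)"

definition E1_hull :: "'a set \<Rightarrow> 'a set \<Rightarrow> nat \<Rightarrow> 'a set" where
  "E1_hull Y S1 j = Hull_A (fst ` set (take (Suc j) (E1_list Y S1)))"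

lemma E1_list:
  "set (E1_list Y S1) = Rel G w Y \<inter> delta G S1" "distinct (E1_list Y S1)"
  "sorted_wrt (\<lambda>e f. w e > w f) (E1_list Y S1)"
proof -
  have "finite (Rel G w Y \<inter> delta G S1)" "inj_on w (Rel G w Y \<inter> delta G S1)"
    using finite_Rel Rel_subset_edges by (auto intro: inj_on_subset[OF inj_w])
  then show "set (E1_list Y S1) = Rel G w Y \<inter> delta G S1" "distinct (E1_list Y S1)"
    "sorted_wrt (\<lambda>e f. w e > w f) (E1_list Y S1)"
    unfolding E1_list_def by (rule decreasing_list)+
qed

text \<open>\<open>dominates Y e S1 S2\<close> says that the agent of \<open>e\<close> is blocked by the edges of \<open>S1\<close> at least as
  early, in the order of decreasing weight, as by those of \<open>S2\<close>.\<close>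

definition dominates :: "'a set \<Rightarrow> 'a \<times> 'b \<Rightarrow> 'a set \<Rightarrow> 'a set \<Rightarrow> bool" where
  "dominates Y e S1 S2 \<longleftrightarrow>
     (\<forall>x. fst e \<in> Hull_A (fst ` {g \<in> Rel G w Y \<inter> delta G S2. w g > x}) \<longrightarrow>
          fst e \<in> Hull_A (fst ` {g \<in> Rel G w Y \<inter> delta G S1. w g > x}))"

text \<open>The levels at which a group blocks the agent form a downward closed set of reals, and
  any two such sets are comparable.\<close>

lemma dominates_total: "dominates Y e S1 S2 \<or> dominates Y e S2 S1"
proof (rule ccontr)
  let ?B = "\<lambda>S x. fst e \<in> Hull_A (fst ` {g \<in> Rel G w Y \<inter> delta G S. w g > x})"
  assume "\<not> ?thesis"
  then obtain x y where xy: "?B S2 x" "\<not> ?B S1 x" "?B S1 y" "\<not> ?B S2 y"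
    unfolding dominates_def by blast
  have mono: "?B S x" if "?B S y" "x \<le> y" for S x y
    using that(2) by (intro Hull_A_image_mono[OF _ that(1)]) auto
  show False
    using xy mono[of S2 x y] mono[of S1 y x] by (cases "x \<le> y") auto
qed

text \<open>Everything accepted before the agent of \<open>e\<close> is revealed is so heavy that
  the edges of \<open>S1\<close> above the same level do not block this agent; otherwise it would
  have been revealed in an earlier round. By domination the accepted edges do not block it either,
  which settles the agent side. On the item side, \<open>e\<close> and all accepted edges belong to
  the independent set selected by the online algorithm.\<close>

lemma core_edge_accepted:
  fixes Y S1 S2 E0 e \<pi>
  defines "es \<equiv> E1_list Y S1" and "H \<equiv> E1_hull Y S1"
  assumes S: "S1 \<inter> S2 = {}"
    and e: "e \<in> Rel G w Y" "fst e \<in> S2"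
    and core: "fst e \<notin> Hull_A (fst ` {g \<in> Rel G w Y. w g > w e})"
    and dom: "dominates Y e S1 (S2 - {fst e})"
    and \<pi>: "set \<pi> = S2" "distinct \<pi>" "hull_sorted H (length es) \<pi>"
    and sel: "selected alg r w E0 (tops Y \<pi> @ es) \<in> indep (combination (num_B G) (edge_sys_B G))"
    and eS: "e \<in> selected alg r w E0 (tops Y \<pi> @ es)"
  shows "e \<in> accepted (run alg r Y E0 (thr es H) S2 \<pi>)"
proof -
  let ?run = "run alg r Y E0 (thr es H) S2" and ?a = "fst e"
  have es: "set es = Rel G w Y \<inter> delta G S1" "distinct es" "sorted_wrt (\<lambda>e f. w e > w f) es"
    unfolding es_def by (rule E1_list)+
  have Hj: "H j = Hull_A (fst ` set (take (Suc j) es))" for j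
    by (simp add: H_def es_def E1_hull_def)
  have eE: "e \<in> edges G"
    using e(1) Rel_subset_edges by blast
  obtain \<pi>1 \<pi>2 where split: "\<pi> = \<pi>1 @ ?a # \<pi>2"
    using e(2) \<pi>(1) by (metis split_list)
  have topa: "toprel G w ?a Y = Some e"
    using e(1) by (simp add: toprel_Rel)
  let ?acc = "accepted (?run \<pi>1)"
  \<comment> \<open>The edge \<open>e\<close> passes its weight test: if \<open>es ! j\<close> were
    heavier than \<open>e\<close>, the edges \<open>es ! 0\<close> to \<open>es ! j\<close> would
    all be relevant edges heavier than \<open>e\<close>, and the core hypothesis keeps the agent out
    of their hull.\<close>
  have light: "w (es ! j) < w e" if j: "j < length es" "?a \<in> H j" for j
  proof (rule ccontr)
    assume "\<not> w (es ! j) < w e"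
    moreover have esj: "es ! j \<in> Rel G w Y" "fst (es ! j) \<in> S1"
      using nth_mem[OF j(1)] es(1) by (auto simp: delta_iff)
    moreover have "es ! j \<noteq> e"
      using esj(2) e(2) S by auto
    ultimately have gt: "w (es ! j) > w e"
      using w_eq_iff[OF eE, of "es ! j"] Rel_subset_edges by force
    have "w g > w e" "g \<in> Rel G w Y" if "g \<in> set (take (Suc j) es)" for g
    proof -
      obtain i where i: "i < Suc j" "g = es ! i"
        using \<open>g \<in> set (take (Suc j) es)\<close> by (auto simp: in_set_conv_nth)
      then have "w g \<ge> w (es ! j)"
        using sorted_wrt_nth_less[OF es(3), of i j] j(1) by (cases "i = j") auto
      then show "w g > w e"
        using gt by simp
      show "g \<in> Rel G w Y"
        using that es(1) in_set_takeD by fastforce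
    qed
    then have "H j \<subseteq> Hull_A (fst ` {g \<in> Rel G w Y. w g > w e})"
      unfolding Hj by (intro Hull_mono image_mono) auto
    then show False
      using j(2) core by blast
  qed
  have acc: "f \<in> Rel G w Y \<inter> delta G (S2 - {?a})" "fst f \<in> set \<pi>1" "thr es H (fst f) f"
    if "f \<in> ?acc" for f
  proof -
    show "fst f \<in> set \<pi>1" "thr es H (fst f) f"
      using accepted_runD[OF that] by auto
    then show "f \<in> Rel G w Y \<inter> delta G (S2 - {?a})"
      using accepted_runD[OF that] \<pi>(1,2) Rel_subset_edges by (auto simp: split delta_iff)
  qed
  have prefix_free: "?a \<notin> Hull_A (fst ` set (take n es))"
    if n: "n \<le> length es" "\<And>j. j < n \<Longrightarrow> ?a \<notin> H j" for n
  proof (cases n)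
    \<comment> \<open>The hull of the empty set may still contain agents that are loops; the core
      hypothesis excludes this for the agent of \<open>e\<close>.\<close>
    case 0
    then show ?thesis
      using core Hull_mono[of "{}" "fst ` {g \<in> Rel G w Y. w g > w e}" "num_A G" "sys_A G"] by auto
  next
    case (Suc n')
    then show ?thesis
      using n(2)[of n'] by (simp add: Hj)
  qed
  have not_blocked: "?a \<notin> Hull_A (fst ` {g \<in> Rel G w Y \<inter> delta G (S2 - {?a}). w g > x})"
    if n: "n \<le> length es" and free: "\<And>j. j < n \<Longrightarrow> ?a \<notin> H j"
      and sub: "{g \<in> set es. w g > x} \<subseteq> set (take n es)" for n x
  proof
    assume "?a \<in> Hull_A (fst ` {g \<in> Rel G w Y \<inter> delta G (S2 - {?a}). w g > x})"
    then have "?a \<in> Hull_A (fst ` {g \<in> set es. w g > x})"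
      using dom unfolding dominates_def es(1) by blast
    moreover have "?a \<notin> Hull_A (fst ` set (take n es))"
      using n free by (rule prefix_free)
    ultimately show False
      using Hull_A_image_mono[OF sub] by metis
  qed
  have free: "?a \<notin> Hull_A (fst ` ?acc)"
  proof (cases "\<exists>j<length es. ?a \<in> H j")
    case True
    define j where "j = (LEAST j. j < length es \<and> ?a \<in> H j)"
    have j: "j < length es" "?a \<in> H j"
      using LeastI_ex[OF True] by (simp_all add: j_def)
    have first: "?a \<notin> H i" if "i < j" for i
      using not_less_Least[of i "\<lambda>j. j < length es \<and> ?a \<in> H j"] that j(1) by (simp add: j_def)
    \<comment> \<open>Since \<open>f\<close> belongs to an agent revealed before that of
      \<open>e\<close>, this agent entered the hulls at some index \<open>i\<close> not exceeding
      \<open>j\<close>, and its test was against \<open>es ! i\<close>, which is at least as heavy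
      as \<open>es ! j\<close>.\<close>
    have "w f > w (es ! j)" if f: "f \<in> ?acc" for f
    proof -
      have "\<exists>i\<le>j. fst f \<in> H i"
        using \<pi>(3) acc(2)[OF f] j by (auto simp: split hull_sorted_def sorted_wrt_append)
      then obtain i where "i \<le> j" "fst f \<in> H i" "\<And>i'. i' < i \<Longrightarrow> fst f \<notin> H i'"
        using exists_least_iff[of "\<lambda>i. i \<le> j \<and> fst f \<in> H i"] by (metis order.strict_trans2 less_imp_le)
      then have "w f > w (es ! i)" "w (es ! i) \<ge> w (es ! j)"
        using acc(3)[OF f] j(1) sorted_wrt_nth_less[OF es(3), of i j]
        by (auto simp: thr_def) (cases "i = j"; simp)
      then show ?thesis
        by simp
    qed
    then have "?acc \<subseteq> {g \<in> Rel G w Y \<inter> delta G (S2 - {?a}). w g > w (es ! j)}"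
      using acc(1) by auto
    moreover have "{g \<in> set es. w g > w (es ! j)} \<subseteq> set (take j es)"
    proof
      fix g assume "g \<in> {g \<in> set es. w g > w (es ! j)}"
      then obtain i where i: "i < length es" "g = es ! i" "w (es ! i) > w (es ! j)"
        by (auto simp: in_set_conv_nth)
      then have "i < j"
        using sorted_wrt_nth_less[OF es(3), of j i] by (cases "i = j"; cases "i < j") auto
      then show "g \<in> set (take j es)"
        using i by (auto simp: in_set_conv_nth)
    qed
    ultimately show ?thesis
      using not_blocked[OF less_imp_le[OF j(1)] first] by (blast intro: Hull_A_image_mono)
  next
    case False
    \<comment> \<open>If the agent lies in no hull, all of \<open>es\<close> fails to block it. As
      weights are nonnegative, the level -1 makes domination speak about all edges.\<close>
    have "w g > -1" if "g \<in> Rel G w Y" for g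
      using w_nonneg[of g] that Rel_subset_edges by force
    then have "?acc \<subseteq> {g \<in> Rel G w Y \<inter> delta G (S2 - {?a}). w g > -1}"
      using acc(1) by auto
    moreover have "?a \<notin> Hull_A (fst ` {g \<in> Rel G w Y \<inter> delta G (S2 - {?a}). w g > -1})"
      using False by (intro not_blocked[of "length es"]) auto
    ultimately show ?thesis
      by (blast intro: Hull_A_image_mono)
  qed
  have tops: "tops Y \<pi> @ es = tops Y \<pi>1 @ e # (tops Y \<pi>2 @ es)"
    by (simp add: split topa)
  have dist: "distinct (tops Y \<pi> @ es)"
    using distinct_tops[OF \<pi>(2)] es(1,2) S \<pi>(1) by (auto simp: set_tops delta_iff)
  have "insert e ?acc \<in> indep (combination (num_A G) (edge_sys_A G))"
    using indep_A_insert[OF accepted_run_feasible eE free] .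
  moreover have "insert e ?acc \<in> indep (combination (num_B G) (edge_sys_B G))"
  proof (rule indep_B_downward[OF sel])
    show "insert e ?acc \<subseteq> selected alg r w E0 (tops Y \<pi> @ es)"
      using eS accepted_run_selected[of alg r Y E0 "thr es H" S2 \<pi>1 "e # (tops Y \<pi>2 @ es)"]
      unfolding tops by simp
  qed
  ultimately have "insert e ?acc \<in> feasible G"
    by (simp add: feasible_def)
  moreover have "selects_last alg r w E0 (tops Y \<pi>1 @ [e])"
    using selected_selects_last dist eS unfolding tops by metis
  moreover have "thr es H ?a e"
    using light by (auto simp: thr_def)
  ultimately have "e \<in> accepted (?run (\<pi>1 @ [?a]))"
    by (simp add: accepted_run_snoc topa)
  then show ?thesis
    using accepted_run_mono[of alg r Y E0 "thr es H" S2 "\<pi>1 @ [?a]" \<pi>2] by (auto simp: split)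
qed

end

section \<open>Success probability of a core edge\<close>

context secretary_instance
begin

definition outcome ::
  "('r, 'a \<times> 'b) online_alg \<Rightarrow> 'r \<Rightarrow> 'a set \<Rightarrow> 'a set \<Rightarrow> 'a set \<Rightarrow> 'a set \<Rightarrow> ('a \<times> 'b) set pmf" where
  "outcome alg r Y S0 S1 S2 =
     map_pmf (\<lambda>\<pi>. accepted (run alg r Y (Rel G w Y \<inter> delta G S0)
                       (thr (E1_list Y S1) (E1_hull Y S1)) S2 \<pi>))
       (reveal_order S2 (E1_hull Y S1) (length (E1_list Y S1)))"

lemma set_pmf_outcome: "set_pmf (outcome alg r Y S0 S1 S2) \<subseteq> feasible G"
  unfolding outcome_def using accepted_run_feasible by auto

text \<open>A finite sum over orders whose coefficients do not involve \<open>r\<close>, so that it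
  commutes with integration over the random bits.\<close>

lemma expectation_outcome:
  assumes "finite S2"
  shows "measure_pmf.expectation (outcome alg r Y S0 S1 S2) f =
    (\<Sum>\<pi>\<in>permutations_of_set S2. pmf (reveal_order S2 (E1_hull Y S1) (length (E1_list Y S1))) \<pi> *
       f (accepted (run alg r Y (Rel G w Y \<inter> delta G S0)
                       (thr (E1_list Y S1) (E1_hull Y S1)) S2 \<pi>)))"
proof -
  have "\<pi> \<in> permutations_of_set S2" if "\<pi> \<in> set_pmf (reveal_order S2 H m)" for \<pi> H m
    using set_pmf_reveal_order[OF assms that] by (simp add: permutations_of_set_def)
  then show ?thesis
    unfolding outcome_def integral_map_pmf
    by (subst integral_measure_pmf[OF finite_permutations_of_set]) simp_all
qed

definition regions :: "real \<Rightarrow> real \<Rightarrow> ('a \<Rightarrow> real) \<Rightarrow> 'a set \<times> 'a set \<times> 'a set \<times> 'a set" where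
  "regions p q t =
     (let p2 = p + (1 - p) * q; p3 = (1 + p2) / 2
      in ({a \<in> agents G. t a \<in> {0<..<p}}, {a \<in> agents G. t a \<in> {p..<p2}},
          {a \<in> agents G. t a \<in> {p2..<p3}}, {a \<in> agents G. t a \<in> {p3..1}}))"

text \<open>The arrival times matter only through the partition of the agents that they
  induce.\<close>

lemma free_order_secretary_eq_outcome:
  "free_order_secretary G w p q alg (t, r) = (case regions p q t of (Y, S0, S1, S2) \<Rightarrow> outcome alg r Y S0 S1 S2)"
proof -
  define p2 where "p2 = p + (1 - p) * q"
  define p3 where "p3 = (1 + p2) / 2"
  define Y where "Y = {a \<in> agents G. t a \<in> {0<..<p}}"
  define S0 where "S0 = {a \<in> agents G. t a \<in> {p..<p2}}"
  define S1 where "S1 = {a \<in> agents G. t a \<in> {p2..<p3}}"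
  define S2 where "S2 = {a \<in> agents G. t a \<in> {p3..1}}"
  have "finite S2"
    using finite_agents by (simp add: S2_def)
  note run = free_order_eq_run[OF this, where es = "E1_list Y S1" and H = "E1_hull Y S1"
      and alg = alg and r = r and Y = Y and ?E0.0 = "Rel G w Y \<inter> delta G S0"]
  have "outcome alg r Y S0 S1 S2 = map_pmf accepted
      (map_pmf (run alg r Y (Rel G w Y \<inter> delta G S0) (thr (E1_list Y S1) (E1_hull Y S1)) S2)
        (reveal_order S2 (E1_hull Y S1) (length (E1_list Y S1))))"
    by (simp add: outcome_def map_pmf_comp)
  also have "\<dots> = free_order_secretary G w p q alg (t, r)"
    unfolding run[symmetric]
    by (simp only: free_order_secretary_def Let_def prod.case p2_def p3_def Y_def S0_def S1_def
        S2_def E1_hull_def E1_list_def)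
  finally show ?thesis
    by (simp only: regions_def Let_def prod.case p2_def p3_def Y_def S0_def S1_def S2_def)
qed

end

section \<open>The online algorithm on the item side and its success probability\<close>

locale secretary_algorithm = secretary_instance G w
  for G :: "('a, 'b) bipartite_instance" and w :: "'a \<times> 'b \<Rightarrow> real" +
  fixes q \<alpha> :: real and R :: "'r measure" and alg :: "('r, 'a \<times> 'b) online_alg"
  assumes oocs: "OOCS (num_B G) (edge_sys_B G) q \<alpha> R alg"
begin

lemma q_range: "0 \<le> q" "q \<le> 1"
  using oocs by (simp_all add: OOCS_def)

sublocale R: prob_space R
  using oocs by (simp add: OOCS_def)

lemma alg_measurable: "{r \<in> space R. alg r ws xs} \<in> sets R"
  using oocs by (simp add: OOCS_def)

lemma selected_indep:
  assumes "Y \<subseteq> X" "X \<subseteq> edges G" "\<sigma> \<in> permutations_of_set (X - Y)" "r \<in> space R"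
  shows "selected alg r w Y \<sigma> \<in> indep (combination (num_B G) (edge_sys_B G))"
  using oocs weights assms unfolding OOCS_def ground_combination by blast

text \<open>The integrand in the OOCS inequality for the true ground set \<open>Rel G w Y\<close>
  and the sample \<open>T\<close>.\<close>

definition guarantee :: "'a set \<Rightarrow> 'a \<times> 'b \<Rightarrow> ('a \<times> 'b) set \<Rightarrow> real" where
  "guarantee Y e T = Min ((\<lambda>\<sigma>. measure R {r \<in> space R. e \<in> selected alg r w T \<sigma>})
     ` permutations_of_set (Rel G w Y - T))"

lemma core_guarantee:
  assumes "e \<in> Core w (num_B G) (edge_sys_B G) (Rel G w Y)"
  shows "\<alpha> \<le> subset_expectation q (Rel G w Y - {e}) (guarantee Y e)"
proof -
  have "\<alpha> \<le> measure_pmf.expectation (random_subset q (Rel G w Y - {e})) (guarantee Y e)"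
    unfolding guarantee_def
    using oocs weights assms Rel_subset_edges unfolding OOCS_def ground_combination by blast
  then show ?thesis
    using q_range finite_Rel by (simp add: expectation_random_subset)
qed

lemma guarantee_nonneg: "0 \<le> guarantee Y e T"
  unfolding guarantee_def using finite_Rel
  by (subst Min_ge_iff) auto

lemma guarantee_le:
  "\<sigma> \<in> permutations_of_set (Rel G w Y - T) \<Longrightarrow>
    guarantee Y e T \<le> measure R {r \<in> space R. e \<in> selected alg r w T \<sigma>}"
  unfolding guarantee_def using finite_Rel by (intro Min_le) auto

lemma accepted_measurable:
  "(\<lambda>r. accepted (run alg r Y E0 ok S \<pi>)) \<in> measurable R (count_space UNIV)"
proof (induction \<pi> rule: rev_induct)
  case Nil
  then show ?case
    by (simp add: run_Nil)
next
  case (snoc a \<pi>)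
  let ?acc = "\<lambda>r. accepted (run alg r Y E0 ok S \<pi>)"
  show ?case
  proof (cases "toprel G w a Y")
    case None
    then show ?thesis
      using snoc by (simp add: accepted_run_snoc)
  next
    case (Some f)
    have ins: "(\<lambda>r. insert f (?acc r)) \<in> measurable R (count_space UNIV)"
      using measurable_compose[OF snoc, of "insert f" "count_space UNIV"] by simp
    have "{r \<in> space R. ok a f \<and> selects_last alg r w E0 (tops Y \<pi> @ [f])
        \<and> insert f (?acc r) \<in> feasible G} \<in> sets R"
    proof -
      have "{r \<in> space R. insert f (?acc r) \<in> feasible G} \<in> sets R"
        using measurable_sets[OF ins, of "feasible G"] by (simp add: vimage_def Int_def conj_commute)
      then show ?thesis
        using alg_measurable unfolding selects_last_def by (intro sets.sets_Collect) auto
    qed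
    then show ?thesis
      using ins snoc unfolding accepted_run_snoc Some option.case by (intro measurable_If)
  qed
qed

lemma accepted_event: "{r \<in> space R. e \<in> accepted (run alg r Y E0 ok S \<pi>)} \<in> sets R"
  using measurable_sets[OF accepted_measurable, of "{X. e \<in> X}" Y E0 ok S \<pi>]
  by (simp add: vimage_def Int_def conj_commute)

lemma sum_accepted:
  assumes "r \<in> space R"
  shows "sum w (accepted (run alg r Y E0 ok S \<pi>)) =
    (\<Sum>e\<in>edges G. w e * indicator {r \<in> space R. e \<in> accepted (run alg r Y E0 ok S \<pi>)} r)"
proof -
  have "edges G \<inter> accepted (run alg r Y E0 ok S \<pi>) = accepted (run alg r Y E0 ok S \<pi>)"
    using feasible_subset_edges[OF accepted_run_feasible] by (rule Int_absorb1)
  then show ?thesis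
    using assms finite_edges
    by (simp add: indicator_def if_distrib[of "\<lambda>x. _ * x"] sum.If_cases cong: if_cong)
qed

lemma sum_accepted_measurable:
  "(\<lambda>r. sum w (accepted (run alg r Y E0 ok S \<pi>))) \<in> borel_measurable R"
  using measurable_compose[OF accepted_measurable, of "sum w" borel] by simp

lemma sum_feasible_bounds:
  assumes "I \<in> feasible G"
  shows "0 \<le> sum w I" "sum w I \<le> sum w (edges G)"
proof -
  note sub = feasible_subset_edges[OF assms]
  show "0 \<le> sum w I"
    by (rule sum_nonneg) (rule w_nonneg[OF subsetD[OF sub]])
  show "sum w I \<le> sum w (edges G)"
    by (rule sum_mono2[OF finite_edges sub]) (rule w_nonneg, simp)
qed

lemma sum_accepted_integrable: "integrable R (\<lambda>r. sum w (accepted (run alg r Y E0 ok S \<pi>)))"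
proof (rule R.integrable_const_bound[OF AE_I2 sum_accepted_measurable])
  fix r
  show "norm (sum w (accepted (run alg r Y E0 ok S \<pi>))) \<le> sum w (edges G)"
    using sum_feasible_bounds[OF accepted_run_feasible[of alg r Y E0 ok S \<pi>]] by simp
qed

lemma integral_sum_accepted:
  "(\<integral>r. sum w (accepted (run alg r Y E0 ok S \<pi>)) \<partial>R) =
    (\<Sum>e\<in>edges G. w e * measure R {r \<in> space R. e \<in> accepted (run alg r Y E0 ok S \<pi>)})"
proof -
  have "(\<integral>r. sum w (accepted (run alg r Y E0 ok S \<pi>)) \<partial>R) =
      (\<integral>r. (\<Sum>e\<in>edges G. w e * indicator {r \<in> space R. e \<in> accepted (run alg r Y E0 ok S \<pi>)} r) \<partial>R)"
    by (rule Bochner_Integration.integral_cong[OF refl sum_accepted])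
  also have "\<dots> = (\<Sum>e\<in>edges G. w e * measure R {r \<in> space R. e \<in> accepted (run alg r Y E0 ok S \<pi>)})"
    using accepted_event
    by (subst Bochner_Integration.integral_sum)
       (auto intro!: integrable_mult_right sum.cong simp: R.emeasure_eq_measure Int_absorb1)
  finally show ?thesis .
qed

definition config_value :: "'a set \<Rightarrow> 'a set \<Rightarrow> 'a set \<Rightarrow> 'a set \<Rightarrow> real" where
  "config_value Y S0 S1 S2 = (\<integral>r. measure_pmf.expectation (outcome alg r Y S0 S1 S2) (sum w) \<partial>R)"

definition core_edges :: "'a set \<Rightarrow> ('a \<times> 'b) set" where
  "core_edges Y = {e \<in> Rel G w Y. \<forall>j\<in>comps. \<not> spanned j Y e}"

text \<open>For core edges, a lower bound on the acceptance probability that holds for every order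
  of revelation: domination does not refer to the order, and \<open>guarantee\<close> is a minimum
  over all orders.\<close>

definition success :: "'a set \<Rightarrow> 'a \<times> 'b \<Rightarrow> 'a set \<Rightarrow> 'a set \<Rightarrow> 'a set \<Rightarrow> real" where
  "success Y e S0 S1 S2 = (if fst e \<in> S2 \<and> dominates Y e S1 (S2 - {fst e})
     then guarantee Y e (Rel G w Y \<inter> delta G S0) else 0)"

lemma success_nonneg: "0 \<le> success Y e S0 S1 S2"
  by (simp add: success_def guarantee_nonneg)

lemma core_edges_subset: "core_edges Y \<subseteq> Rel G w Y" "core_edges Y \<subseteq> edges G"
  using Rel_subset_edges by (auto simp: core_edges_def)

lemma core_edges_w_nonneg: "e \<in> core_edges Y \<Longrightarrow> 0 \<le> w e"
  using core_edges_subset(2) by (rule w_nonneg[OF subsetD])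

lemma config_value_lower_bound:
  assumes S: "S0 \<subseteq> agents G - Y" "S1 \<subseteq> agents G - Y - S0"
    and S2: "S2 = agents G - Y - S0 - S1"
  shows "(\<Sum>e\<in>core_edges Y. w e * success Y e S0 S1 S2) \<le> config_value Y S0 S1 S2"
proof -
  let ?es = "E1_list Y S1" and ?H = "E1_hull Y S1" and ?E0 = "Rel G w Y \<inter> delta G S0"
  let ?O = "reveal_order S2 ?H (length ?es)" and ?P = "permutations_of_set S2"
  let ?acc = "\<lambda>r \<pi>. accepted (run alg r Y ?E0 (thr ?es ?H) S2 \<pi>)"
  let ?L = "\<Sum>e\<in>core_edges Y. w e * success Y e S0 S1 S2"
  have fin: "finite S2"
    using S2 finite_agents by simp
  have each: "?L \<le> (\<integral>r. sum w (?acc r \<pi>) \<partial>R)" if \<pi>: "\<pi> \<in> set_pmf ?O" for \<pi>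
  proof -
    note \<pi>' = set_pmf_reveal_order[OF fin \<pi>]
    let ?\<sigma> = "tops Y \<pi> @ ?es"
    \<comment> \<open>Completed by the edges of \<open>S1\<close>, the presented sequence is an
      ordering of the true ground set minus the sample, so \<open>guarantee\<close> applies to it.
      It is fixed before \<open>r\<close> is drawn.\<close>
    have "set ?\<sigma> = Rel G w Y - ?E0"
    proof -
      have "g \<in> edges G \<and> fst g \<in> agents G - Y" if "g \<in> Rel G w Y" for g
        using Rel_fst[OF that] subsetD[OF Rel_subset_edges that] by simp
      moreover have "S0 \<inter> S1 = {}"
        using S by auto
      ultimately show ?thesis
        unfolding set_append set_tops E1_list(1) \<pi>'(1) S2 by (auto simp: delta_iff)
    qed
    moreover have "distinct ?\<sigma>"
      using distinct_tops[OF \<pi>'(2)] E1_list S2 \<pi>'(1) by (auto simp: set_tops delta_iff)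
    ultimately have \<sigma>: "?\<sigma> \<in> permutations_of_set (Rel G w Y - ?E0)"
      by (simp add: permutations_of_set_def)
    have "success Y e S0 S1 S2 \<le> measure R {r \<in> space R. e \<in> ?acc r \<pi>}" if e: "e \<in> core_edges Y" for e
    proof (cases "fst e \<in> S2 \<and> dominates Y e S1 (S2 - {fst e})")
      case True
      have "{r \<in> space R. e \<in> selected alg r w ?E0 ?\<sigma>} \<subseteq> {r \<in> space R. e \<in> ?acc r \<pi>}"
      proof safe
        fix r assume r: "r \<in> space R" and sel: "e \<in> selected alg r w ?E0 ?\<sigma>"
        have "selected alg r w ?E0 ?\<sigma> \<in> indep (combination (num_B G) (edge_sys_B G))"
          using selected_indep[OF _ Rel_subset_edges \<sigma> r] by simp
        moreover have "fst e \<notin> Hull_A (fst ` {g \<in> Rel G w Y. w g > w e})"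
          using e by (intro core_agent_not_in_Hull) (auto simp: core_edges_def)
        ultimately show "e \<in> ?acc r \<pi>"
          using S2 True \<pi>' sel subsetD[OF core_edges_subset(1) e]
          by (intro core_edge_accepted) auto
      qed
      then have "measure R {r \<in> space R. e \<in> selected alg r w ?E0 ?\<sigma>} \<le> measure R {r \<in> space R. e \<in> ?acc r \<pi>}"
        by (intro R.finite_measure_mono accepted_event)
      then show ?thesis
        using guarantee_le[OF \<sigma>, of e] True by (simp add: success_def)
    next
      case False
      then show ?thesis
        unfolding success_def if_not_P[OF False] by simp
    qed
    then have "?L \<le> (\<Sum>e\<in>core_edges Y. w e * measure R {r \<in> space R. e \<in> ?acc r \<pi>})"
      using core_edges_w_nonneg by (intro sum_mono mult_left_mono)
    also have "\<dots> \<le> (\<Sum>e\<in>edges G. w e * measure R {r \<in> space R. e \<in> ?acc r \<pi>})"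
      using w_nonneg by (intro sum_mono2 finite_edges core_edges_subset mult_nonneg_nonneg) auto
    finally show ?thesis
      by (simp add: integral_sum_accepted)
  qed
  have "?L = (\<Sum>\<pi>\<in>?P. pmf ?O \<pi>) * ?L"
  proof -
    have "set_pmf ?O \<subseteq> ?P"
      using set_pmf_reveal_order[OF fin] by (auto simp: permutations_of_set_def)
    then have "(\<Sum>\<pi>\<in>?P. pmf ?O \<pi>) = 1"
      by (rule sum_pmf_eq_1[OF finite_permutations_of_set])
    then show ?thesis
      by (simp only: mult_1)
  qed
  also have "\<dots> \<le> (\<Sum>\<pi>\<in>?P. pmf ?O \<pi> * (\<integral>r. sum w (?acc r \<pi>) \<partial>R))"
    unfolding sum_distrib_right
  proof (rule sum_mono)
    fix \<pi>
    show "pmf ?O \<pi> * ?L \<le> pmf ?O \<pi> * (\<integral>r. sum w (?acc r \<pi>) \<partial>R)"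
    proof (cases "\<pi> \<in> set_pmf ?O")
      case True
      then show ?thesis
        by (intro mult_left_mono each) simp_all
    next
      case False
      then show ?thesis
        by (simp only: set_pmf_iff not_not mult_zero_left order_refl)
    qed
  qed
  also have "\<dots> = config_value Y S0 S1 S2"
    unfolding config_value_def expectation_outcome[OF fin]
    by (subst Bochner_Integration.integral_sum)
       (auto intro!: integrable_mult_right sum_accepted_integrable)
  finally show ?thesis .
qed

text \<open>Swapping \<open>S1\<close> and \<open>S2\<close> preserves their joint distribution, and one of the two dominates the
  other, so \<open>S1\<close> dominates with probability at least one half.\<close>

lemma dominates_half:
  assumes "finite V"
  shows "1 / 2 \<le> subset_expectation (1/2) V (\<lambda>S1. if dominates Y e S1 (V - S1) then 1 else 0)"
proof -
  let ?f = "\<lambda>S1. if dominates Y e S1 (V - S1) then 1 else (0::real)"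
  have "1 = subset_expectation (1/2) V (\<lambda>_. 1)"
    by (simp add: subset_expectation_const[OF assms])
  also have "\<dots> \<le> subset_expectation (1/2) V (\<lambda>S. ?f S + ?f (V - S))"
  proof (rule subset_expectation_mono)
    fix S assume "S \<subseteq> V"
    then have "V - (V - S) = S"
      by auto
    then show "1 \<le> ?f S + ?f (V - S)"
      using dominates_total[of Y e S "V - S"] by auto
  qed auto
  also have "\<dots> = 2 * subset_expectation (1/2) V ?f"
    using subset_expectation_half_complement[OF assms, of ?f] by (simp add: subset_expectation_add)
  finally show ?thesis by simp
qed

text \<open>The agent of \<open>e\<close> avoids \<open>S0\<close> with probability
  \<open>1 - q\<close>. Conditioned on this, \<open>S0\<close> is a random subset of the other
  agents, so the OOCS bound for samples from \<open>Rel G w Y - {e}\<close> contributes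
  \<alpha>.\<close>

lemma expected_success:
  assumes e: "e \<in> core_edges Y"
  shows "\<alpha> * (1 - q) / 4 \<le> subset_expectation q (agents G - Y) (\<lambda>S0.
      subset_expectation (1/2) (agents G - Y - S0) (\<lambda>S1.
        success Y e S0 S1 (agents G - Y - S0 - S1)))"
proof -
  define Z where "Z = agents G - Y - {fst e}"
  have eR: "e \<in> Rel G w Y"
    using e core_edges_subset by blast
  have Z: "agents G - Y = insert (fst e) Z" "fst e \<notin> Z" "finite Z"
    using Rel_fst[OF eR] finite_agents by (auto simp: Z_def)
  let ?g = "\<lambda>S0. guarantee Y e (Rel G w Y \<inter> delta G S0)"
  let ?h = "\<lambda>S0. subset_expectation (1/2) (agents G - Y - S0) (\<lambda>S1.
        success Y e S0 S1 (agents G - Y - S0 - S1))"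
  have nonneg: "0 \<le> ?h S0" for S0
    by (intro subset_expectation_nonneg success_nonneg) auto
  \<comment> \<open>One factor 1/2 is for the agent of \<open>e\<close> falling into
    \<open>S2\<close>, the other for domination among the remaining agents.\<close>
  have half: "?g S0 / 4 \<le> ?h S0" if S0: "S0 \<subseteq> Z" for S0
  proof -
    let ?V = "Z - S0"
    have V: "agents G - Y - S0 = insert (fst e) ?V" "fst e \<notin> ?V" "finite ?V"
      using Z S0 by auto
    have "?h S0 = 1 / 2 * subset_expectation (1/2) ?V
          (\<lambda>S1. success Y e S0 (insert (fst e) S1) (insert (fst e) ?V - insert (fst e) S1)) +
        1 / 2 * subset_expectation (1/2) ?V (\<lambda>S1. success Y e S0 S1 (insert (fst e) ?V - S1))"
      unfolding V(1) subset_expectation_insert[OF V(3,2)] by simp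
    also have "\<dots> \<ge> 0 + 1 / 2 * subset_expectation (1/2) ?V
        (\<lambda>S1. ?g S0 * (if dominates Y e S1 (?V - S1) then 1 else 0))"
    proof (intro add_mono mult_left_mono)
      show "0 \<le> 1 / 2 * subset_expectation (1/2) ?V
          (\<lambda>S1. success Y e S0 (insert (fst e) S1) (insert (fst e) ?V - insert (fst e) S1))"
        by (intro mult_nonneg_nonneg subset_expectation_nonneg success_nonneg) auto
      show "subset_expectation (1/2) ?V
          (\<lambda>S1. ?g S0 * (if dominates Y e S1 (?V - S1) then 1 else 0)) \<le>
        subset_expectation (1/2) ?V (\<lambda>S1. success Y e S0 S1 (insert (fst e) ?V - S1))"
      proof (rule subset_expectation_mono)
        fix S1 assume "S1 \<subseteq> ?V"
        then have "fst e \<in> insert (fst e) ?V - S1" "insert (fst e) ?V - S1 - {fst e} = ?V - S1"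
          using V(2) by auto
        then show "?g S0 * (if dominates Y e S1 (?V - S1) then 1 else 0) \<le>
            success Y e S0 S1 (insert (fst e) ?V - S1)"
          by (simp add: success_def)
      qed auto
    qed auto
    also have "0 + 1 / 2 * subset_expectation (1/2) ?V
        (\<lambda>S1. ?g S0 * (if dominates Y e S1 (?V - S1) then 1 else 0)) \<ge> ?g S0 / 4"
      using mult_left_mono[OF dominates_half[OF V(3), of Y e] guarantee_nonneg[of Y e "Rel G w Y \<inter> delta G S0"]]
      by (simp add: subset_expectation_mult)
    finally show ?thesis by simp
  qed
  have "\<alpha> \<le> subset_expectation q (Rel G w Y - {e}) (guarantee Y e)"
    using e by (intro core_guarantee core_edge_in_Core) (auto simp: core_edges_def)
  also have "\<dots> = subset_expectation q Z (\<lambda>S0. guarantee Y e {g \<in> Rel G w Y - {e}. fst g \<in> S0})"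
  proof (rule subset_expectation_image[OF Z(3), symmetric])
    show "inj_on fst (Rel G w Y - {e})"
      by (rule inj_on_subset[OF inj_fst_Rel]) auto
    show "fst ` (Rel G w Y - {e}) \<subseteq> Z"
    proof
      fix a assume "a \<in> fst ` (Rel G w Y - {e})"
      then obtain g where g: "g \<in> Rel G w Y" "g \<noteq> e" "a = fst g"
        by auto
      then show "a \<in> Z"
        using Rel_fst[OF g(1)] inj_onD[OF inj_fst_Rel _ g(1) eR] by (auto simp: Z_def)
    qed
  qed (use finite_Rel in auto)
  also have "\<dots> = subset_expectation q Z ?g"
  proof (rule subset_expectation_cong)
    fix S assume "S \<subseteq> Z"
    then have "{g \<in> Rel G w Y - {e}. fst g \<in> S} = Rel G w Y \<inter> delta G S"
      using Z(2) Rel_subset_edges by (auto simp: delta_def)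
    then show "guarantee Y e {g \<in> Rel G w Y - {e}. fst g \<in> S} = ?g S"
      by simp
  qed
  finally have "\<alpha> * ((1 - q) / 4) \<le> subset_expectation q Z ?g * ((1 - q) / 4)"
    using q_range by (intro mult_right_mono) auto
  also have "\<dots> = (1 - q) * subset_expectation q Z (\<lambda>S0. 1 / 4 * ?g S0)"
    unfolding subset_expectation_mult by simp
  also have "\<dots> \<le> (1 - q) * subset_expectation q Z ?h"
    using q_range half by (intro mult_left_mono subset_expectation_mono) auto
  also have "\<dots> \<le> subset_expectation q (agents G - Y) ?h"
  proof -
    have "0 \<le> subset_expectation q Z (\<lambda>S. ?h (insert (fst e) S))"
      by (rule subset_expectation_nonneg[OF q_range nonneg])
    then show ?thesis
      using q_range unfolding Z(1) subset_expectation_insert[OF Z(3,2)] by simp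
  qed
  finally show ?thesis by simp
qed

text \<open>The groups are drawn one after the other: \<open>Y\<close> with probability
  \<open>p\<close>, then \<open>S0\<close> with \<open>q\<close> among the rest, then
  \<open>S1\<close> with 1/2 among what remains. This distribution agrees with that of the
  arrival-time intervals.\<close>

definition expected_value :: "real \<Rightarrow> real" where
  "expected_value p = subset_expectation p (agents G) (\<lambda>Y.
     subset_expectation q (agents G - Y) (\<lambda>S0.
       subset_expectation (1/2) (agents G - Y - S0) (\<lambda>S1.
         config_value Y S0 S1 (agents G - Y - S0 - S1))))"

lemma expected_value_lower_bound:
  assumes p: "0 \<le> p" "p \<le> 1"
  shows "\<alpha> * (1 - q) / 4 * subset_expectation p (agents G) (\<lambda>Y. sum w (core_edges Y)) \<le> expected_value p"
  unfolding subset_expectation_mult[symmetric] expected_value_def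
proof (rule subset_expectation_mono[OF p])
  fix Y
  let ?E = "\<lambda>f. subset_expectation q (agents G - Y) (\<lambda>S0.
      subset_expectation (1/2) (agents G - Y - S0) (\<lambda>S1. f S0 S1 (agents G - Y - S0 - S1)))"
  have "\<alpha> * (1 - q) / 4 * sum w (core_edges Y) \<le> (\<Sum>e\<in>core_edges Y. w e * ?E (success Y e))"
    unfolding sum_distrib_left mult.commute[of _ "w _"]
    using core_edges_w_nonneg by (intro sum_mono mult_left_mono expected_success)
  also have "\<dots> = ?E (\<lambda>S0 S1 S2. \<Sum>e\<in>core_edges Y. w e * success Y e S0 S1 S2)"
    by (simp add: subset_expectation_sum subset_expectation_mult)
  also have "\<dots> \<le> ?E (config_value Y)"
    using q_range by (intro subset_expectation_mono config_value_lower_bound) auto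
  finally show "\<alpha> * (1 - q) / 4 * sum w (core_edges Y) \<le> ?E (config_value Y)" .
qed

end

section \<open>Integration over the arrival times\<close>

lemma prob_space_uniform_unit: "prob_space (uniform_measure lborel {0<..<1::real})"
  by (rule prob_space_uniform_measure) simp_all

lemma measure_uniform_unit:
  fixes a b :: real
  shows "0 \<le> a \<Longrightarrow> a \<le> b \<Longrightarrow> b \<le> 1 \<Longrightarrow> measure (uniform_measure lborel {0<..<1}) {a<..<b} = b - a"
    and "0 < a \<Longrightarrow> a \<le> b \<Longrightarrow> b \<le> 1 \<Longrightarrow> measure (uniform_measure lborel {0<..<1}) {a..<b} = b - a"
    and "0 < a \<Longrightarrow> a \<le> 1 \<Longrightarrow> measure (uniform_measure lborel {0<..<1}) {a..1} = 1 - a"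
proof -
  have eq: "measure (uniform_measure lborel {0<..<1::real}) B = measure lborel ({0<..<1} \<inter> B)"
    if "B \<in> sets borel" for B
    using that by (subst measure_uniform_measure) simp_all
  show "measure (uniform_measure lborel {0<..<1}) {a<..<b} = b - a" if "0 \<le> a" "a \<le> b" "b \<le> 1"
  proof -
    have "{0<..<1} \<inter> {a<..<b} = {a<..<b}"
      using that by auto
    then show ?thesis
      using that by (simp add: eq)
  qed
  show "measure (uniform_measure lborel {0<..<1}) {a..<b} = b - a" if "0 < a" "a \<le> b" "b \<le> 1"
  proof -
    have "{0<..<1} \<inter> {a..<b} = {a..<b}"
      using that by auto
    then show ?thesis
      using that by (simp add: eq)
  qed
  show "measure (uniform_measure lborel {0<..<1}) {a..1} = 1 - a" if "0 < a" "a \<le> 1"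
  proof -
    have "{0<..<1} \<inter> {a..1} = {a..<1}"
      using that by auto
    then show ?thesis
      using that by (simp add: eq)
  qed
qed

lemma prod_if_subset:
  fixes x :: real
  assumes "finite A" "Y \<subseteq> A"
  shows "(\<Prod>a\<in>A. if a \<in> Y then x else f a) = x ^ card Y * (\<Prod>a\<in>A - Y. f a)"
proof -
  have "A \<inter> {a. a \<in> Y} = Y" "A \<inter> - {a. a \<in> Y} = A - Y"
    using assms(2) by auto
  then show ?thesis
    using assms(1) by (simp add: prod.If_cases)
qed

context secretary_instance
begin

definition arrival_times :: "('a \<Rightarrow> real) measure" where
  "arrival_times = (\<Pi>\<^sub>M a\<in>agents G. uniform_measure lborel {0<..<1})"

lemma prob_space_arrival_times: "prob_space arrival_times"
  unfolding arrival_times_def by (rule prob_space_PiM) (rule prob_space_uniform_unit)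

lemma space_arrival_times: "space arrival_times = PiE (agents G) (\<lambda>_. UNIV)"
  by (simp add: arrival_times_def space_PiM)

text \<open>The event is a product of intervals of lengths \<open>p\<close>,
  \<open>(1 - p) * q\<close> and twice \<open>(1 - p) * (1 - q) / 2\<close>. Regrouping the powers
  yields the weights of sequential sampling.\<close>

lemma prob_regions:
  assumes p: "0 < p" "p \<le> 1" and q: "0 \<le> q" "q \<le> 1"
    and Y: "Y \<subseteq> agents G" and S0: "S0 \<subseteq> agents G - Y" and S1: "S1 \<subseteq> agents G - Y - S0"
  shows "measure arrival_times
      {t \<in> space arrival_times. regions p q t = (Y, S0, S1, agents G - Y - S0 - S1)} =
    (p ^ card Y * (1 - p) ^ card (agents G - Y)) *
    ((q ^ card S0 * (1 - q) ^ card (agents G - Y - S0)) *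
     ((1/2) ^ card S1 * (1 - 1/2) ^ card (agents G - Y - S0 - S1)))"
proof -
  interpret U: prob_space "uniform_measure lborel {0<..<1::real}"
    by (rule prob_space_uniform_unit)
  interpret finite_product_prob_space "\<lambda>_. uniform_measure lborel {0<..<1::real}" "agents G"
    by standard (rule finite_agents)
  define p2 where "p2 = p + (1 - p) * q"
  define p3 where "p3 = (1 + p2) / 2"
  have "0 \<le> (1 - p) * q" "(1 - p) * q \<le> 1 - p"
    using p q by (simp_all add: mult_left_le)
  moreover have "(1 - p) * q = p2 - p"
    by (simp add: p2_def)
  ultimately have "0 \<le> p2 - p" "p2 - p \<le> 1 - p"
    by simp_all
  then have ord: "p \<le> p2" "p2 \<le> p3" "p3 \<le> 1"
    by (simp_all add: p3_def)
  define J where "J a = (if a \<in> Y then {0<..<p} else if a \<in> S0 then {p..<p2}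
      else if a \<in> S1 then {p2..<p3} else {p3..1})" for a
  have "regions p q t = (Y, S0, S1, agents G - Y - S0 - S1) \<longleftrightarrow> (\<forall>a\<in>agents G. t a \<in> J a)" for t
  proof
    assume "regions p q t = (Y, S0, S1, agents G - Y - S0 - S1)"
    then have "{a \<in> agents G. t a \<in> {0<..<p}} = Y" "{a \<in> agents G. t a \<in> {p..<p2}} = S0"
      "{a \<in> agents G. t a \<in> {p2..<p3}} = S1"
      "{a \<in> agents G. t a \<in> {p3..1}} = agents G - Y - S0 - S1"
      unfolding regions_def Let_def p3_def p2_def by (simp_all only: prod.inject)
    then show "\<forall>a\<in>agents G. t a \<in> J a"
      unfolding J_def by auto
  next
    assume J: "\<forall>a\<in>agents G. t a \<in> J a"
    have "t a \<in> {0<..<p} \<longleftrightarrow> a \<in> Y" "t a \<in> {p..<p2} \<longleftrightarrow> a \<in> S0" "t a \<in> {p2..<p3} \<longleftrightarrow> a \<in> S1"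
        "t a \<in> {p3..1} \<longleftrightarrow> a \<in> agents G - Y - S0 - S1" if a: "a \<in> agents G" for a
    proof -
      have disj: "\<not> (a \<in> Y \<and> a \<in> S0)" "\<not> (a \<in> Y \<and> a \<in> S1)" "\<not> (a \<in> S0 \<and> a \<in> S1)"
        using S0 S1 by auto
      have "t a \<in> J a"
        using J a by simp
      then show "t a \<in> {0<..<p} \<longleftrightarrow> a \<in> Y" "t a \<in> {p..<p2} \<longleftrightarrow> a \<in> S0" "t a \<in> {p2..<p3} \<longleftrightarrow> a \<in> S1"
        "t a \<in> {p3..1} \<longleftrightarrow> a \<in> agents G - Y - S0 - S1"
        using disj ord p a by (auto simp: J_def split: if_splits)
    qed
    then have "{a \<in> agents G. t a \<in> {0<..<p}} = Y" "{a \<in> agents G. t a \<in> {p..<p2}} = S0"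
      "{a \<in> agents G. t a \<in> {p2..<p3}} = S1"
      "{a \<in> agents G. t a \<in> {p3..1}} = agents G - Y - S0 - S1"
      using Y S0 S1 by blast+
    then show "regions p q t = (Y, S0, S1, agents G - Y - S0 - S1)"
      unfolding regions_def Let_def p3_def p2_def by (simp only:)
  qed
  then have "{t \<in> space arrival_times. regions p q t = (Y, S0, S1, agents G - Y - S0 - S1)} =
      (\<Pi>\<^sub>E a\<in>agents G. J a)"
    by (auto simp: space_arrival_times PiE_def)
  then have "measure arrival_times
      {t \<in> space arrival_times. regions p q t = (Y, S0, S1, agents G - Y - S0 - S1)} =
      (\<Prod>a\<in>agents G. measure (uniform_measure lborel {0<..<1}) (J a))"
    unfolding arrival_times_def by (simp only:) (rule prob_times, simp add: J_def)
  also have "\<dots> = (\<Prod>a\<in>agents G. if a \<in> Y then p else if a \<in> S0 then (1 - p) * q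
      else if a \<in> S1 then (1 - p) * (1 - q) * (1/2) else (1 - p) * (1 - q) * (1/2))"
  proof (rule prod.cong[OF refl])
    fix a
    have "p2 - p = (1 - p) * q" "p3 - p2 = (1 - p) * (1 - q) * (1/2)" "1 - p3 = (1 - p) * (1 - q) * (1/2)"
      by (simp_all add: p2_def p3_def field_simps)
    then show "measure (uniform_measure lborel {0<..<1}) (J a) =
        (if a \<in> Y then p else if a \<in> S0 then (1 - p) * q
         else if a \<in> S1 then (1 - p) * (1 - q) * (1/2) else (1 - p) * (1 - q) * (1/2))"
      using p ord measure_uniform_unit(1)[of 0 p] measure_uniform_unit(2)[of p p2]
        measure_uniform_unit(2)[of p2 p3] measure_uniform_unit(3)[of p3]
      unfolding J_def by auto
  qed
  also have "\<dots> = p ^ card Y * (((1 - p) * q) ^ card S0 * (((1 - p) * (1 - q) * (1/2)) ^ card S1 *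
      ((1 - p) * (1 - q) * (1/2)) ^ card (agents G - Y - S0 - S1)))"
    using finite_agents Y S0 S1 by (simp only: prod_if_subset finite_Diff prod_constant)
  also have "\<dots> = (p ^ card Y * (1 - p) ^ card (agents G - Y)) *
    ((q ^ card S0 * (1 - q) ^ card (agents G - Y - S0)) *
     ((1/2) ^ card S1 * (1 - 1/2) ^ card (agents G - Y - S0 - S1)))"
  proof -
    have fin: "finite S0" "finite S1"
      using S0 S1 finite_agents by (meson finite_Diff finite_subset)+
    have c0: "card (agents G - Y) = card S0 + card (agents G - Y - S0)"
      using card_Diff_subset[OF fin(1) S0] card_mono[OF _ S0] finite_agents by simp
    have c1: "card (agents G - Y - S0) = card S1 + card (agents G - Y - S0 - S1)"
      using card_Diff_subset[OF fin(2) S1] card_mono[OF _ S1] finite_agents by simp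
    have half: "1 - 1 / 2 = (1 / 2 :: real)"
      by simp
    show ?thesis
      unfolding c0 c1 half power_add power_mult_distrib by (simp only: mult_ac)
  qed
  finally show ?thesis .
qed

lemma regions_event: "{t \<in> space arrival_times. regions p q t = c} \<in> sets arrival_times"
proof -
  have region: "{t \<in> space arrival_times. {a \<in> agents G. t a \<in> I} = X} \<in> sets arrival_times"
    if I: "I \<in> sets borel" for I :: "real set" and X
  proof -
    have ev: "{t \<in> space arrival_times. t a \<in> I \<longleftrightarrow> a \<in> X} \<in> sets arrival_times" if "a \<in> agents G" for a
    proof -
      have "(\<lambda>t. t a) \<in> measurable arrival_times (uniform_measure lborel {0<..<1})"
        unfolding arrival_times_def using that by (rule measurable_component_singleton)
      then have "{t \<in> space arrival_times. t a \<in> I} \<in> sets arrival_times"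
        using I measurable_sets[of "\<lambda>t. t a" arrival_times _ I]
        by (simp add: vimage_def Int_def conj_commute)
      then show ?thesis
        by (cases "a \<in> X") (auto intro: sets.sets_Collect_neg)
    qed
    have "{t \<in> space arrival_times. {a \<in> agents G. t a \<in> I} = X} =
        (if X \<subseteq> agents G then {t \<in> space arrival_times. \<forall>a\<in>agents G. t a \<in> I \<longleftrightarrow> a \<in> X} else {})"
      by auto
    also have "\<dots> \<in> sets arrival_times"
      using ev finite_agents by (auto intro: sets.sets_Collect_finite_All')
    finally show ?thesis .
  qed
  obtain Y S0 S1 S2 where c: "c = (Y, S0, S1, S2)"
    by (metis prod_cases4)
  show ?thesis
    unfolding c regions_def Let_def prod.inject
    by (intro sets.sets_Collect_conj region) simp_all
qed

end

section \<open>From arrival times and random bits to the expected utility\<close>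

context secretary_algorithm
begin

definition outcome_value :: "'a set \<times> 'a set \<times> 'a set \<times> 'a set \<Rightarrow> 'r \<Rightarrow> real" where
  "outcome_value c r = (case c of (Y, S0, S1, S2) \<Rightarrow>
     measure_pmf.expectation (outcome alg r Y S0 S1 S2) (sum w))"

lemma outcome_value_bounds: "0 \<le> outcome_value c r" "outcome_value c r \<le> sum w (edges G)"
proof -
  obtain Y S0 S1 S2 where c: "c = (Y, S0, S1, S2)"
    by (metis prod_cases4)
  let ?D = "outcome alg r Y S0 S1 S2"
  have bounds: "0 \<le> sum w I" "sum w I \<le> sum w (edges G)" if "I \<in> set_pmf ?D" for I
    using sum_feasible_bounds[OF subsetD[OF set_pmf_outcome that]] .
  have "AE I in measure_pmf ?D. sum w I \<le> sum w (edges G)" "AE I in measure_pmf ?D. 0 \<le> sum w I"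
    using bounds by (auto simp: AE_measure_pmf_iff)
  moreover have "integrable (measure_pmf ?D) (sum w)"
    using bounds
    by (intro measure_pmf.integrable_const_bound[of _ "sum w (edges G)"]) (auto simp: AE_measure_pmf_iff)
  ultimately show "0 \<le> outcome_value c r" "outcome_value c r \<le> sum w (edges G)"
    unfolding outcome_value_def c prod.case
    by (auto intro: measure_pmf.integral_le_const integral_nonneg_AE)
qed

lemma outcome_value_measurable:
  assumes "c \<in> Pow (agents G) \<times> Pow (agents G) \<times> Pow (agents G) \<times> Pow (agents G)"
  shows "outcome_value c \<in> borel_measurable R"
proof -
  obtain Y S0 S1 S2 where c: "c = (Y, S0, S1, S2)" "S2 \<subseteq> agents G"
    using assms by auto
  then have "finite S2"
    using finite_agents finite_subset by auto
  then show ?thesis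
    unfolding outcome_value_def c(1) prod.case
    unfolding expectation_outcome[OF \<open>finite S2\<close>]
    by (intro borel_measurable_sum borel_measurable_times borel_measurable_const sum_accepted_measurable)
qed

lemma fos_space_eq: "fos_space G R = arrival_times \<Otimes>\<^sub>M R"
  by (simp add: fos_space_def arrival_times_def)

lemma expected_value_eq:
  "expected_value p = (\<Sum>(Y, S0, S1)\<in>
      Sigma (Pow (agents G)) (\<lambda>Y. Sigma (Pow (agents G - Y)) (\<lambda>S0. Pow (agents G - Y - S0))).
    (p ^ card Y * (1 - p) ^ card (agents G - Y)) *
    ((q ^ card S0 * (1 - q) ^ card (agents G - Y - S0)) *
     ((1/2) ^ card S1 * (1 - 1/2) ^ card (agents G - Y - S0 - S1))) *
    config_value Y S0 S1 (agents G - Y - S0 - S1))"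
  unfolding expected_value_def subset_expectation_def sum_distrib_left
  using finite_agents by (simp add: sum.Sigma[symmetric] mult.assoc)

lemma expected_value_le_integral:
  assumes p: "0 < p" "p \<le> 1"
  shows "expected_value p \<le>
    (\<integral>\<omega>. measure_pmf.expectation (free_order_secretary G w p q alg \<omega>) (sum w) \<partial>fos_space G R)"
proof -
  let ?N = "arrival_times"
  interpret N: prob_space ?N
    by (rule prob_space_arrival_times)
  interpret NR: pair_prob_space ?N R ..
  define Q where "Q = Pow (agents G) \<times> Pow (agents G) \<times> Pow (agents G) \<times> Pow (agents G)"
  define B where "B c = {t \<in> space ?N. regions p q t = c}" for c
  define F where "F \<omega> = measure_pmf.expectation (free_order_secretary G w p q alg \<omega>) (sum w)" for \<omega>
  define V where "V = Sigma (Pow (agents G)) (\<lambda>Y. Sigma (Pow (agents G - Y)) (\<lambda>S0. Pow (agents G - Y - S0)))"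
  define emb where "emb = (\<lambda>(Y, S0, S1). (Y, S0, S1, agents G - Y - S0 - S1))"
  have finQ: "finite Q"
    using finite_agents by (simp add: Q_def)
  have B: "B c \<in> sets ?N" for c
    unfolding B_def by (rule regions_event)
  have F_regions: "F (t, r) = outcome_value (regions p q t) r" for t r
    unfolding F_def free_order_secretary_eq_outcome outcome_value_def by (simp split: prod.split)
  have regionsQ: "regions p q t \<in> Q" for t
    by (auto simp: regions_def Let_def Q_def)
  \<comment> \<open>Splitting by the induced partition writes \<open>F\<close> as a finite sum of
    products of a function of \<open>t\<close> and a function of \<open>r\<close>, which gives
    measurability and evaluates the double integral.\<close>
  have F_sum: "F (t, r) = (\<Sum>c\<in>Q. indicator (B c) t * outcome_value c r)" if t: "t \<in> space ?N" for t r
  proof -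
    have "(\<Sum>c\<in>Q. indicator (B c) t * outcome_value c r) =
        (\<Sum>c\<in>Q. if c = regions p q t then outcome_value c r else 0)"
      using t by (intro sum.cong) (auto simp: B_def indicator_def)
    then show ?thesis
      using finQ regionsQ by (simp add: F_regions)
  qed
  have meas: "F \<in> borel_measurable (?N \<Otimes>\<^sub>M R)"
  proof -
    have "(\<lambda>\<omega>. \<Sum>c\<in>Q. indicator (B c) (fst \<omega>) * outcome_value c (snd \<omega>)) \<in> borel_measurable (?N \<Otimes>\<^sub>M R)"
    proof (rule borel_measurable_sum)
      fix c assume c: "c \<in> Q"
      have "(\<lambda>\<omega>. indicator (B c) (fst \<omega>) :: real) \<in> borel_measurable (?N \<Otimes>\<^sub>M R)"
        using B by (intro measurable_compose[OF measurable_fst]) simp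
      moreover have "(\<lambda>\<omega>. outcome_value c (snd \<omega>)) \<in> borel_measurable (?N \<Otimes>\<^sub>M R)"
        using c unfolding Q_def by (intro measurable_compose[OF measurable_snd] outcome_value_measurable)
      ultimately show "(\<lambda>\<omega>. indicator (B c) (fst \<omega>) * outcome_value c (snd \<omega>)) \<in> borel_measurable (?N \<Otimes>\<^sub>M R)"
        by (rule borel_measurable_times)
    qed
    moreover have "F \<omega> = (\<Sum>c\<in>Q. indicator (B c) (fst \<omega>) * outcome_value c (snd \<omega>))"
      if "\<omega> \<in> space (?N \<Otimes>\<^sub>M R)" for \<omega>
      using F_sum[of "fst \<omega>" "snd \<omega>"] that by (simp add: space_pair_measure mem_Times_iff)
    ultimately show ?thesis
      by (subst measurable_cong) auto
  qed
  have int: "integrable (?N \<Otimes>\<^sub>M R) F"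
  proof (rule NR.integrable_const_bound[OF AE_I2 meas])
    fix \<omega>
    show "norm (F \<omega>) \<le> sum w (edges G)"
      using outcome_value_bounds[of "regions p q (fst \<omega>)" "snd \<omega>"] F_regions[of "fst \<omega>" "snd \<omega>"] by simp
  qed
  define val where "val c = (\<integral>r. outcome_value c r \<partial>R)" for c
  have val_nonneg: "0 \<le> val c" for c
    unfolding val_def using outcome_value_bounds(1) by (intro Bochner_Integration.integral_nonneg)
  have intR: "integrable R (outcome_value c)" if "c \<in> Q" for c
    using outcome_value_bounds outcome_value_measurable that
    by (intro R.integrable_const_bound[of _ "sum w (edges G)"]) (auto simp: Q_def)
  have "(\<integral>\<omega>. F \<omega> \<partial>(?N \<Otimes>\<^sub>M R)) = (\<integral>t. (\<integral>r. F (t, r) \<partial>R) \<partial>?N)"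
    by (rule NR.integral_fst'[OF int, symmetric])
  also have "\<dots> = (\<integral>t. (\<Sum>c\<in>Q. indicator (B c) t * val c) \<partial>?N)"
  proof (rule Bochner_Integration.integral_cong[OF refl])
    fix t assume t: "t \<in> space ?N"
    show "(\<integral>r. F (t, r) \<partial>R) = (\<Sum>c\<in>Q. indicator (B c) t * val c)"
      unfolding F_sum[OF t] val_def using intR
      by (subst Bochner_Integration.integral_sum) (auto intro: integrable_mult_right)
  qed
  also have "\<dots> = (\<Sum>c\<in>Q. measure ?N (B c) * val c)"
    using B by (subst Bochner_Integration.integral_sum)
      (auto intro!: integrable_mult_left sum.cong simp: N.emeasure_eq_measure B_def)
  \<comment> \<open>Only quadruples that partition the agents are kept; the discarded terms are
    nonnegative.\<close>
  also have "\<dots> \<ge> (\<Sum>c\<in>emb ` V. measure ?N (B c) * val c)"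
    using finQ val_nonneg by (intro sum_mono2) (auto simp: emb_def V_def Q_def)
  also have "(\<Sum>c\<in>emb ` V. measure ?N (B c) * val c) = (\<Sum>x\<in>V. measure ?N (B (emb x)) * val (emb x))"
    by (rule sum.reindex_cong[of emb]) (auto simp: emb_def inj_on_def)
  also have "\<dots> = expected_value p"
    unfolding expected_value_eq V_def[symmetric]
  proof (rule sum.cong[OF refl])
    fix x assume "x \<in> V"
    then obtain Y S0 S1 where x: "x = (Y, S0, S1)" "Y \<subseteq> agents G" "S0 \<subseteq> agents G - Y" "S1 \<subseteq> agents G - Y - S0"
      unfolding V_def by auto
    show "measure ?N (B (emb x)) * val (emb x) = (case x of (Y, S0, S1) \<Rightarrow>
        (p ^ card Y * (1 - p) ^ card (agents G - Y)) *
        ((q ^ card S0 * (1 - q) ^ card (agents G - Y - S0)) *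
         ((1/2) ^ card S1 * (1 - 1/2) ^ card (agents G - Y - S0 - S1))) *
        config_value Y S0 S1 (agents G - Y - S0 - S1))"
      unfolding x(1) emb_def prod.case B_def prob_regions[OF p q_range x(2-4)]
      by (simp add: val_def outcome_value_def config_value_def)
  qed
  finally show ?thesis
    unfolding fos_space_eq F_def .
qed

lemma utility_competitive:
  assumes p: "0 < p" "p \<le> 1" and c: "0 \<le> c"
    and core: "\<And>opt. opt \<in> feasible G \<Longrightarrow>
      c * sum w opt \<le> subset_expectation p (agents G) (\<lambda>Y. sum w (core_edges Y))"
  shows "utility_competitive (feasible G) w (fos_space G R) (free_order_secretary G w p q alg)
    (\<alpha> * (1 - q) / 4 * c)"
  unfolding utility_competitive_def
proof (intro conjI ballI)
  fix \<omega> :: "('a \<Rightarrow> real) \<times> 'r"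
  show "set_pmf (free_order_secretary G w p q alg \<omega>) \<subseteq> feasible G"
    by (cases \<omega>) (simp add: free_order_secretary_eq_outcome set_pmf_outcome split: prod.split)
next
  have "Max (sum w ` feasible G) \<in> sum w ` feasible G"
    using finite_feasible empty_feasible by (intro Max_in) auto
  then obtain opt where opt: "opt \<in> feasible G" "Max (sum w ` feasible G) = sum w opt"
    by auto
  have "\<alpha> * (1 - q) / 4 * c * sum w opt \<le> expected_value p"
  proof (cases "0 \<le> \<alpha>")
    case True
    have "\<alpha> * (1 - q) / 4 * (c * sum w opt) \<le>
        \<alpha> * (1 - q) / 4 * subset_expectation p (agents G) (\<lambda>Y. sum w (core_edges Y))"
      using True q_range by (intro mult_left_mono core opt(1)) auto
    also have "\<dots> \<le> expected_value p"
      using p by (intro expected_value_lower_bound) auto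
    finally show ?thesis
      by (simp add: mult.assoc)
  next
    \<comment> \<open>\<open>OOCS\<close> admits negative \<alpha>. The claimed bound is then
      nonpositive, while the expected value is nonnegative.\<close>
    case False
    have "\<alpha> * ((1 - q) / 4 * c * sum w opt) \<le> 0"
      using False q_range c sum_feasible_bounds(1)[OF opt(1)]
      by (intro mult_nonpos_nonneg mult_nonneg_nonneg) auto
    also have "0 \<le> expected_value p"
    proof -
      have "0 \<le> config_value Y S0 S1 S2" for Y S0 S1 S2
        unfolding config_value_def by (rule Bochner_Integration.integral_nonneg)
          (use outcome_value_bounds(1)[of "(Y, S0, S1, S2)"] in \<open>simp add: outcome_value_def\<close>)
      then show ?thesis
        unfolding expected_value_def using p q_range by (intro subset_expectation_nonneg) auto
    qed
    finally show ?thesis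
      by (simp add: mult_ac)
  qed
  also have "\<dots> \<le> (\<integral>\<omega>. measure_pmf.expectation (free_order_secretary G w p q alg \<omega>) (sum w) \<partial>fos_space G R)"
    by (rule expected_value_le_integral[OF p])
  finally show "\<alpha> * (1 - q) / 4 * c * Max (sum w ` feasible G) \<le>
      (\<integral>\<omega>. measure_pmf.expectation (free_order_secretary G w p q alg \<omega>) (sum w) \<partial>fos_space G R)"
    by (simp add: opt(2))
qed

section \<open>Choice of the sampling probability and the resulting ratios\<close>

lemma comps_of_edge:
  "{j \<in> comps. e \<in> ground (comp j)} =
     {j \<in> {1..num_A G}. e \<in> ground (edge_sys_A G j)} <+> {j \<in> {1..num_B G}. e \<in> ground (edge_sys_B G j)}"
  unfolding comps_def comp_def by (auto simp: Plus_def)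

text \<open>The chosen \<open>p\<close> maximizes
  \<open>(1 - (1 - p) / p * k) * ((1 - p) / k)\<close>. This product equals
  \<open>((k + 1) * (1 - p) - k * (1 - p) / p) / k\<close>, up to normalization a combination of
  \<open>p\<close> and \<open>1 / p\<close> that is stationary at
  \<open>p^2 = k / (k + 1)\<close>.\<close>

lemma utility_competitive_growth:
  assumes A: "\<forall>j\<in>{1..num_A G}. growth_system (kA j) (edge_sys_A G j)"
    and B: "\<forall>j\<in>{1..num_B G}. growth_system (lB j) (edge_sys_B G j)"
    and k: "1 \<le> k" "\<And>e. e \<in> edges G \<Longrightarrow>
        (\<Sum>j | j \<in> {1..num_A G} \<and> e \<in> ground (edge_sys_A G j). kA j)
      + (\<Sum>j | j \<in> {1..num_B G} \<and> e \<in> ground (edge_sys_B G j). lB j) \<le> k"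
  shows "utility_competitive (feasible G) w (fos_space G R)
      (free_order_secretary G w (sqrt (1 - 1 / (real k + 1))) q alg)
      (\<alpha> * (1 - q) / 4 * (2 - 2 * sqrt (1 + 1 / real k) + 1 / real k))"
proof -
  define s where "s = sqrt (1 + 1 / real k)"
  define p where "p = sqrt (1 - 1 / (real k + 1))"
  have k0: "real k > 0"
    using k(1) by simp
  have s: "s\<^sup>2 = 1 + 1 / real k" "1 \<le> s"
    using k0 by (simp_all add: s_def)
  have "1 - 1 / (real k + 1) = 1 / (1 + 1 / real k)"
    using k0 by (simp add: field_simps)
  then have p: "p = 1 / s"
    by (simp add: p_def s_def real_sqrt_divide)
  have p01: "0 < p" "p \<le> 1"
    using s(2) by (simp_all add: p)
  have \<theta>: "(1 - p) / p = s - 1"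
    using s(2) by (simp add: p field_simps)
  have "s * 1 \<le> s * s"
    using s(2) by (intro mult_left_mono) auto
  then have "s - 1 \<le> 1 / real k"
    using s(1) by (simp add: power2_eq_square)
  then have \<theta>k: "(s - 1) * real k \<le> 1"
    using k0 by (simp add: field_simps)
  \<comment> \<open>With \<open>s = 1 / p\<close> and \<open>k * s^2 = k + 1\<close> the first
    factor is \<open>k * s * (s - 1)\<close> and the second is \<open>(s - 1) / (s * k)\<close>, so
    the product is the square of \<open>s - 1\<close>.\<close>
  have c: "(1 - (s - 1) * real k) * ((1 - p) / real k) = 2 - 2 * s + 1 / real k"
  proof -
    have "real k * s\<^sup>2 = real k + 1"
      using k0 by (simp add: s(1) field_simps)
    then have "1 - (s - 1) * real k = real k * s * (s - 1)"
      by (simp add: power2_eq_square algebra_simps)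
    moreover have "1 - p = (s - 1) / s"
      using s(2) by (simp add: p field_simps)
    ultimately have "(1 - (s - 1) * real k) * ((1 - p) / real k) = (s - 1)\<^sup>2"
      using k0 s(2) by (simp add: power2_eq_square)
    also have "\<dots> = 2 - 2 * s + 1 / real k"
      using s(1) by (simp add: power2_diff)
    finally show ?thesis .
  qed
  have growth: "growth_system (case_sum kA lB j) (comp j)" if "j \<in> comps" for j
    using that A B by (cases j) (simp_all add: comps_iff comp_def)
  have kk: "(\<Sum>j | j \<in> comps \<and> e \<in> ground (comp j). case_sum kA lB j) \<le> k" if "e \<in> edges G" for e
    unfolding comps_of_edge using k(2)[OF that] by (subst sum.Plus) simp_all
  have "utility_competitive (feasible G) w (fos_space G R) (free_order_secretary G w p q alg)
    (\<alpha> * (1 - q) / 4 * (2 - 2 * s + 1 / real k))"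
  proof (rule utility_competitive[OF p01])
    show "0 \<le> 2 - 2 * s + 1 / real k"
      using \<theta>k p01 k0 unfolding c[symmetric] by (intro mult_nonneg_nonneg) auto
    show "(2 - 2 * s + 1 / real k) * sum w opt
        \<le> subset_expectation p (agents G) (\<lambda>Y. sum w (core_edges Y))" if "opt \<in> feasible G" for opt
      using expected_core_weight_growth[OF growth k(1) kk that p01] \<theta>k
      unfolding c[symmetric] core_edges_def \<theta> by simp
  qed
  then show ?thesis
    by (simp add: p_def s_def)
qed

text \<open>With \<open>u = (1 - p) * k\<close> the core bound is \<open>(1 - u) * u / k^2\<close>,
  which is largest at \<open>u = 1/2\<close>; this determines \<open>p\<close> and the value
  \<open>1 / (4 * k^2)\<close>.\<close>

lemma utility_competitive_matroid:
  assumes A: "\<forall>j\<in>{1..num_A G}. matroid (edge_sys_A G j)"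
    and B: "\<forall>j\<in>{1..num_B G}. matroid (edge_sys_B G j)"
    and k: "1 \<le> k" "\<And>e. e \<in> edges G \<Longrightarrow>
        card {j \<in> {1..num_A G}. e \<in> ground (edge_sys_A G j)}
      + card {j \<in> {1..num_B G}. e \<in> ground (edge_sys_B G j)} \<le> k"
  shows "utility_competitive (feasible G) w (fos_space G R)
      (free_order_secretary G w (1 - 1 / (2 * real k)) q alg) (\<alpha> * (1 - q) / (16 * real k ^ 2))"
proof -
  define p where "p = 1 - 1 / (2 * real k)"
  have k0: "real k \<ge> 1"
    using k(1) by simp
  have p01: "0 < p" "p \<le> 1"
    using k0 by (simp_all add: p_def field_simps)
  have half: "(1 - p) * real k = 1 / 2"
    using k0 by (simp add: p_def)
  have mat: "matroid (comp j)" if "j \<in> comps" for j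
    using that A B by (cases j) (simp_all add: comps_iff comp_def)
  have kk: "card {j \<in> comps. e \<in> ground (comp j)} \<le> k" if "e \<in> edges G" for e
    unfolding comps_of_edge using k(2)[OF that] by (subst card_Plus) simp_all
  have c: "(1 - (1 - p) * real k) * ((1 - p) / real k) = 1 / (4 * real k ^ 2)"
    unfolding half using k0 by (simp add: p_def power2_eq_square)
  have "utility_competitive (feasible G) w (fos_space G R) (free_order_secretary G w p q alg)
    (\<alpha> * (1 - q) / 4 * (1 / (4 * real k ^ 2)))"
  proof (rule utility_competitive[OF p01])
    show "1 / (4 * real k ^ 2) * sum w opt
        \<le> subset_expectation p (agents G) (\<lambda>Y. sum w (core_edges Y))" if "opt \<in> feasible G" for opt
    proof -
      have "(1 - p) * real k \<le> 1"
        using half by simp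
      then show ?thesis
        using expected_core_weight_matroid[OF mat k(1) kk that p01] unfolding c core_edges_def by simp
    qed
  qed simp
  then show ?thesis
    by (simp add: p_def)
qed

end

lemma growth_ratio_lower_bound:
  fixes k :: real
  assumes "1 \<le> k"
  shows "1 / (16 * k ^ 2) - 1 / (32 * k ^ 3) < 1 / 4 * (2 - 2 * sqrt (1 + 1 / k) + 1 / k)"
proof -
  define x where "x = 1 / k"
  have x: "0 < x" "x \<le> 1"
    using assms by (simp_all add: x_def)
  \<comment> \<open>The Taylor polynomial of \<open>sqrt (1 + x)\<close> of degree 3. Its square
    exceeds \<open>1 + x\<close> by terms of order at least 4 whose sum is positive for
    \<open>x\<close> in (0,1], so it bounds the root from above.\<close>
  define y where "y = 1 + x / 2 - x ^ 2 / 8 + x ^ 3 / 16"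
  have pw: "x ^ 2 \<le> 1" "x ^ 5 \<le> x ^ 4" "0 < x ^ 3" "0 < x ^ 4" "0 \<le> x ^ 6"
    using x by (simp_all add: power_le_one power_decreasing)
  have "y ^ 2 = 1 + x + 5 * x ^ 4 / 64 - x ^ 5 / 64 + x ^ 6 / 256"
    unfolding y_def by (simp add: power2_eq_square algebra_simps power_numeral_reduce)
  then have "1 + x < y ^ 2"
    using pw by linarith
  moreover have "0 \<le> y"
    unfolding y_def using pw x by linarith
  ultimately have "sqrt (1 + x) < y"
    by (simp add: real_less_lsqrt x)
  then have "x ^ 2 / 16 - x ^ 3 / 32 < 1 / 4 * (2 - 2 * sqrt (1 + x) + x)"
    by (simp add: y_def field_simps)
  then show ?thesis
    by (simp add: x_def power_divide)
qed

theorem theorem7: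
  fixes G :: "('a, 'b) bipartite_instance"
    and w :: "'a \<times> 'b \<Rightarrow> real"
    and q \<alpha> :: real
    and R :: "'r measure"
    and alg :: "('r, 'a \<times> 'b) online_alg"
  assumes "wf_instance G"
    and "valid_weights w (edges G)"
    and "OOCS (num_B G) (edge_sys_B G) q \<alpha> R alg"
  shows
    "(\<forall>(kA :: nat \<Rightarrow> nat) (lB :: nat \<Rightarrow> nat) (k :: nat).
        edges G \<noteq> {} \<and>
        (\<forall>j\<in>{1..num_A G}. growth_system (kA j) (edge_sys_A G j)) \<and>
        (\<forall>j\<in>{1..num_B G}. growth_system (lB j) (edge_sys_B G j)) \<and>
        k = Max ((\<lambda>e. (\<Sum>j | j \<in> {1..num_A G} \<and> e \<in> ground (edge_sys_A G j). kA j)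
                    + (\<Sum>j | j \<in> {1..num_B G} \<and> e \<in> ground (edge_sys_B G j). lB j)) ` edges G)
        \<longrightarrow>
        utility_competitive (feasible G) w (fos_space G R)
          (free_order_secretary G w (sqrt (1 - 1 / (real k + 1))) q alg)
          (\<alpha> * (1 - q) / 4 * (2 - 2 * sqrt (1 + 1 / real k) + 1 / real k)) \<and>
        1 / 4 * (2 - 2 * sqrt (1 + 1 / real k) + 1 / real k)
          > 1 / (16 * real k ^ 2) - 1 / (32 * real k ^ 3))
     \<and>
     (\<forall>k :: nat.
        k \<ge> 1 \<and>
        (\<forall>j\<in>{1..num_A G}. matroid (edge_sys_A G j)) \<and>
        (\<forall>j\<in>{1..num_B G}. matroid (edge_sys_B G j)) \<and>
        (\<forall>e\<in>edges G. card {j \<in> {1..num_A G}. e \<in> ground (edge_sys_A G j)}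
                    + card {j \<in> {1..num_B G}. e \<in> ground (edge_sys_B G j)} \<le> k)
        \<longrightarrow>
        utility_competitive (feasible G) w (fos_space G R)
          (free_order_secretary G w (1 - 1 / (2 * real k)) q alg)
          (\<alpha> * (1 - q) / (16 * real k ^ 2)))"
proof -
  interpret secretary_algorithm G w q \<alpha> R alg
    by unfold_locales (rule assms)+
  show ?thesis
  proof (intro conjI allI impI; elim conjE)
    fix kA lB :: "nat \<Rightarrow> nat" and k :: nat
    let ?f = "\<lambda>e. (\<Sum>j | j \<in> {1..num_A G} \<and> e \<in> ground (edge_sys_A G j). kA j)
                + (\<Sum>j | j \<in> {1..num_B G} \<and> e \<in> ground (edge_sys_B G j). lB j)"
    assume ne: "edges G \<noteq> {}"
      and A: "\<forall>j\<in>{1..num_A G}. growth_system (kA j) (edge_sys_A G j)"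
      and B: "\<forall>j\<in>{1..num_B G}. growth_system (lB j) (edge_sys_B G j)"
      and k: "k = Max (?f ` edges G)"
    have le: "?f e \<le> k" if "e \<in> edges G" for e
      unfolding k using that finite_edges by (intro Max_ge) auto
    \<comment> \<open>An edge exists, its agent lies in some agent-side component, and growth
      constants are at least 1.\<close>
    have k1: "1 \<le> k"
    proof -
      obtain e where e: "e \<in> edges G"
        using ne by auto
      obtain j where j: "j \<in> {1..num_A G}" "fst e \<in> ground (sys_A G j)"
        using agent_component[OF fst_edge[OF e]] .
      have "1 \<le> kA j"
        using A j(1) unfolding growth_system_def by blast
      also have "\<dots> \<le> (\<Sum>j | j \<in> {1..num_A G} \<and> e \<in> ground (edge_sys_A G j). kA j)"
        using e j by (intro member_le_sum) (auto simp: ground_edge_sys)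
      also have "\<dots> \<le> k"
        using le[OF e] by simp
      finally show ?thesis .
    qed
    show "utility_competitive (feasible G) w (fos_space G R)
          (free_order_secretary G w (sqrt (1 - 1 / (real k + 1))) q alg)
          (\<alpha> * (1 - q) / 4 * (2 - 2 * sqrt (1 + 1 / real k) + 1 / real k))"
      by (rule utility_competitive_growth[OF A B k1 le])
    show "1 / (16 * real k ^ 2) - 1 / (32 * real k ^ 3)
        < 1 / 4 * (2 - 2 * sqrt (1 + 1 / real k) + 1 / real k)"
      using k1 by (intro growth_ratio_lower_bound) simp
  next
    fix k :: nat
    assume "k \<ge> 1" "\<forall>j\<in>{1..num_A G}. matroid (edge_sys_A G j)"
      "\<forall>j\<in>{1..num_B G}. matroid (edge_sys_B G j)"
      "\<forall>e\<in>edges G. card {j \<in> {1..num_A G}. e \<in> ground (edge_sys_A G j)}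
        + card {j \<in> {1..num_B G}. e \<in> ground (edge_sys_B G j)} \<le> k"
    then show "utility_competitive (feasible G) w (fos_space G R)
          (free_order_secretary G w (1 - 1 / (2 * real k)) q alg)
          (\<alpha> * (1 - q) / (16 * real k ^ 2))"
      by (intro utility_competitive_matroid) auto
  qed
qed

end
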